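(* Let $n\ge5$ be odd, $m=\frac{2^n+1}{3}$, and let $\ell$ be the index with $\rho_\ell=9m$. Then $C_\ell(P_\infty)$ is an $[N,k,d]_{2^{2n}}$-linear code with - $N=(3m-1)^2+(3m-1)(9m-7)$, - $k=N-\frac{9m+9}{2}$, - $d\ge d_{ORD}(C_\ell(P_\infty))=16$, - Singleton defect $\delta=N-k+1-d\le N-k+1-d_{ORD}(C_\ell(P_\infty))=\frac{9m-21}{2}$, - relative Singleton defect $\Delta=\frac{\delta}{N}\le\frac{9m-21}{2(3m-1)(12m-8)}$; hence $\Delta$ goes to zero as $n$ goes to infinity.
   Context: Let $n\ge5$ be odd, $m=(2^n+1)/3$, and let $GGS(2,n)$ be (the nonsingular model of) the curve $X^2+X=Y^{3}$, $Y^{4}-Y=Z^m$; it is $\mathbb F_{2^{2n}}$-maximal of genus $g=\frac{9m-7}{2}$ and has a unique point at infinity $P_\infty$. The Weierstrass semigroup $H(P_\infty)$ (the set of $r\ge 0$ such that some rational function has pole divisor $rP_\infty$) is known to be $$H(P_\infty)=\{3im+2jm+8k \mid i\in\{0,1\},\ j\in\{0,1,2,3\},\ k\ge0\}.$$ Write $H(P_\infty)=\{\rho_1=0<\rho_2<\rho_3<\cdots\}$. For $\ell\ge1$, $\nu_\ell$ is the number of ordered pairs $(a,b)\in H(P_\infty)\times H(P_\infty)$ with $a+b=\rho_{\ell+1}$. Let $\overline D$ be the sum of all $\mathbb F_{2^{2n}}$-rational points other than $P_\infty$, and $C_\ell(P_\infty)=C^\perp(\overline D,\rho_\ell P_\infty)$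 the dual of the one-point AG code over $\mathbb F_{2^{2n}}$ obtained by evaluating $\mathcal L(\rho_\ell P_\infty)$ at the points of $\overline D$. The order bound (Feng-Rao designed minimum distance), a known lower bound for the minimum distance of $C_\ell(P_\infty)$, is $d_{ORD}(C_\ell(P_\infty))=\min\{\nu_r\mid r\ge\ell\}$. The notation $[N,k,d]_{Q}$ means a linear code over $\mathbb F_Q$ of length $N$, dimension $k$, minimum distance $d$. *)

theory Defs
  imports
    Complex_Main
    "HOL-Library.Infinite_Set"
    "HOL-Algebra.Generated_Fields"
    "HOL-Algebra.Finite_Extensions"
    "HOL-Algebra.Algebraic_Closure_Type"
    "Jordan_Normal_Form.Missing_VectorSpace"
begin

section \<open>Places of a function field\<close>

text \<open>
  A function field \<open>F\<close> with constant field \<open>K\<close> is a pair of subfields of an ambient field type.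
  The closed points of the nonsingular projective curve with function field \<open>F\<close> are the normalized
  (i.e. surjective) discrete valuations of \<open>F\<close> that are trivial on \<open>K\<close>.  A valuation is a total
  function into \<open>int\<close>, with the dummy value 0 at 0 and outside \<open>F\<close>: this makes equality of
  functions coincide with equality of places, and the value at 0 is never meant to be used.
\<close>

definition places :: "'a::field set \<Rightarrow> 'a set \<Rightarrow> ('a \<Rightarrow> int) set" where
  "places K F = {v.
     (\<forall>f\<in>F - {0}. \<forall>g\<in>F - {0}. v (f * g) = v f + v g) \<and>
     (\<forall>f\<in>F - {0}. \<forall>g\<in>F - {0}. f + g \<noteq> 0 \<longrightarrow> min (v f) (v g) \<le> v (f + g)) \<and>
     (\<forall>c\<in>K - {0}. v c = 0) \<and>
     (\<exists>t\<in>F - {0}. v t = 1) \<and>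
     (\<forall>f. f \<notin> F - {0} \<longrightarrow> v f = 0)}"

definition regular_at :: "('a::field \<Rightarrow> int) \<Rightarrow> 'a \<Rightarrow> bool" where
  "regular_at v f \<longleftrightarrow> f = 0 \<or> 0 \<le> v f"

definition vanishes_at :: "('a::field \<Rightarrow> int) \<Rightarrow> 'a \<Rightarrow> bool" where
  "vanishes_at v f \<longleftrightarrow> f = 0 \<or> 0 < v f"

text \<open>Degree-one places: the residue field is \<open>K\<close>.\<close>

definition rational_places :: "'a::field set \<Rightarrow> 'a set \<Rightarrow> ('a \<Rightarrow> int) set" where
  "rational_places K F =
     {v \<in> places K F. \<forall>f\<in>F. regular_at v f \<longrightarrow> (\<exists>c\<in>K. vanishes_at v (f - c))}"

text \<open>The value \<open>f(P)\<close> of a function regular at a rational place \<open>P\<close>.\<close>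

definition value_at :: "'a::field set \<Rightarrow> ('a \<Rightarrow> int) \<Rightarrow> 'a \<Rightarrow> 'a" where
  "value_at K v f = (THE c. c \<in> K \<and> vanishes_at v (f - c))"

definition riemann_roch_space ::
  "'a::field set \<Rightarrow> 'a set \<Rightarrow> (('a \<Rightarrow> int) \<Rightarrow> int) \<Rightarrow> 'a set" where
  "riemann_roch_space K F G = {f \<in> F. f = 0 \<or> (\<forall>Q\<in>places K F. 0 \<le> Q f + G Q)}"

definition one_point_divisor :: "nat \<Rightarrow> ('a \<Rightarrow> int) \<Rightarrow> ('a \<Rightarrow> int) \<Rightarrow> int" where
  "one_point_divisor r P = (\<lambda>Q. if Q = P then int r else 0)"

definition weierstrass_semigroup :: "'a::field set \<Rightarrow> 'a set \<Rightarrow> ('a \<Rightarrow> int) \<Rightarrow> nat set" where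
  "weierstrass_semigroup K F P =
     {r. \<exists>f\<in>F - {0}. P f = - int r \<and> (\<forall>Q\<in>places K F - {P}. 0 \<le> Q f)}"


section \<open>Linear codes\<close>

text \<open>
  Words are indexed by a set \<open>D\<close> of coordinates and extended by 0 outside \<open>D\<close>.  The fields
  \<open>mult\<close> and \<open>one\<close> of the module record play no role in the module structure.
\<close>

definition word_space :: "'a::field set \<Rightarrow> 'p set \<Rightarrow> ('a, 'p \<Rightarrow> 'a) module" where
  "word_space K D = \<lparr>
     carrier = {w. (\<forall>p\<in>D. w p \<in> K) \<and> (\<forall>p. p \<notin> D \<longrightarrow> w p = 0)},
     monoid.mult = (\<lambda>v w p. v p * w p),
     one = (\<lambda>p. if p \<in> D then 1 else 0),
     ring.zero = (\<lambda>p. 0),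
     add = (\<lambda>v w p. v p + w p),
     module.smult = (\<lambda>c w p. c * w p)\<rparr>"

abbreviation scalars :: "'a::field set \<Rightarrow> 'a ring" where
  "scalars K \<equiv> ring_of_type_algebra\<lparr>carrier := K\<rparr>"

definition linear_code :: "'a::field set \<Rightarrow> 'p set \<Rightarrow> ('p \<Rightarrow> 'a) set \<Rightarrow> bool" where
  "linear_code K D C \<longleftrightarrow> finite D \<and> subspace (scalars K) C (word_space K D)"

definition code_dim :: "'a::field set \<Rightarrow> 'p set \<Rightarrow> ('p \<Rightarrow> 'a) set \<Rightarrow> nat" where
  "code_dim K D C = vectorspace.dim (scalars K) (word_space K D\<lparr>carrier := C\<rparr>)"

definition hamming_dist :: "'p set \<Rightarrow> ('p \<Rightarrow> 'a) \<Rightarrow> ('p \<Rightarrow> 'a) \<Rightarrow> nat" where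
  "hamming_dist D v w = card {p \<in> D. v p \<noteq> w p}"

definition min_dist :: "'p set \<Rightarrow> ('p \<Rightarrow> 'a) set \<Rightarrow> nat" where
  "min_dist D C = Inf {hamming_dist D v w | v w. v \<in> C \<and> w \<in> C \<and> v \<noteq> w}"

text \<open>\<open>C\<close> is an \<open>[N, k, d]\<close>-linear code over the field with \<open>q\<close> elements.\<close>

definition linear_code_params ::
  "'a::field set \<Rightarrow> 'p set \<Rightarrow> ('p \<Rightarrow> 'a) set \<Rightarrow> nat \<Rightarrow> nat \<Rightarrow> nat \<Rightarrow> nat \<Rightarrow> bool" where
  "linear_code_params K D C q N k d \<longleftrightarrow>
     card K = q \<and> linear_code K D C \<and> card D = N \<and> code_dim K D C = k \<and> min_dist D C = d"

definition singleton_defect :: "'a::field set \<Rightarrow> 'p set \<Rightarrow> ('p \<Rightarrow> 'a) set \<Rightarrow> int" where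
  "singleton_defect K D C = int (card D) - int (code_dim K D C) + 1 - int (min_dist D C)"

definition relative_singleton_defect :: "'a::field set \<Rightarrow> 'p set \<Rightarrow> ('p \<Rightarrow> 'a) set \<Rightarrow> real" where
  "relative_singleton_defect K D C = real_of_int (singleton_defect K D C) / real (card D)"

definition dual_code :: "'a::field set \<Rightarrow> 'p set \<Rightarrow> ('p \<Rightarrow> 'a) set \<Rightarrow> ('p \<Rightarrow> 'a) set" where
  "dual_code K D C = {w \<in> carrier (word_space K D). \<forall>c\<in>C. (\<Sum>p\<in>D. w p * c p) = 0}"


section \<open>Dual one-point codes and the order bound\<close>

text \<open>The divisor called \<open>D\<close> in the literature is the sum of the places in the set \<open>D\<close>.\<close>

definition ag_code ::
  "'a::field set \<Rightarrow> 'a set \<Rightarrow> ('a \<Rightarrow> int) set \<Rightarrow> (('a \<Rightarrow> int) \<Rightarrow> int) \<Rightarrow> (('a \<Rightarrow> int) \<Rightarrow> 'a) set" where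
  "ag_code K F D G =
     (\<lambda>f Q. if Q \<in> D then value_at K Q f else 0) ` riemann_roch_space K F G"

text \<open>\<open>pole_number K F P l\<close> is \<open>\<rho>\<^sub>l\<close>, counted from \<open>\<rho>\<^sub>1 = 0\<close>; \<open>enumerate\<close> counts from 0.\<close>

definition pole_number :: "'a::field set \<Rightarrow> 'a set \<Rightarrow> ('a \<Rightarrow> int) \<Rightarrow> nat \<Rightarrow> nat" where
  "pole_number K F P l = enumerate (weierstrass_semigroup K F P) (l - 1)"

definition feng_rao_nu :: "'a::field set \<Rightarrow> 'a set \<Rightarrow> ('a \<Rightarrow> int) \<Rightarrow> nat \<Rightarrow> nat" where
  "feng_rao_nu K F P l =
     card {(a, b) \<in> weierstrass_semigroup K F P \<times> weierstrass_semigroup K F P.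
             a + b = pole_number K F P (l + 1)}"

definition order_bound :: "'a::field set \<Rightarrow> 'a set \<Rightarrow> ('a \<Rightarrow> int) \<Rightarrow> nat \<Rightarrow> nat" where
  "order_bound K F P l = Inf {feng_rao_nu K F P r | r. l \<le> r}"

definition evaluation_places :: "'a::field set \<Rightarrow> 'a set \<Rightarrow> ('a \<Rightarrow> int) \<Rightarrow> ('a \<Rightarrow> int) set" where
  "evaluation_places K F P = rational_places K F - {P}"

definition dual_one_point_code ::
  "'a::field set \<Rightarrow> 'a set \<Rightarrow> ('a \<Rightarrow> int) \<Rightarrow> nat \<Rightarrow> (('a \<Rightarrow> int) \<Rightarrow> 'a) set" where
  "dual_one_point_code K F P l =
     dual_code K (evaluation_places K F P)
       (ag_code K F (evaluation_places K F P) (one_point_divisor (pole_number K F P l) P))"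


section \<open>The curve GGS(2,n)\<close>

text \<open>
  \<open>F = K(x, y, z)\<close> is the function field over the field \<open>K\<close> with \<open>2^(2n)\<close> elements of the curve
  \<open>X^2 + X = Y^3\<close>, \<open>Y^4 - Y = Z^m\<close>: the triple \<open>(x, y, z)\<close> is a generic point, which is what
  the transcendence of \<open>z\<close> says.
\<close>

definition GGS2_function_field ::
  "nat \<Rightarrow> 'a::field set \<Rightarrow> 'a set \<Rightarrow> 'a \<Rightarrow> 'a \<Rightarrow> 'a \<Rightarrow> bool" where
  "GGS2_function_field n K F x y z \<longleftrightarrow>
     subfield K ring_of_type_algebra \<and> card K = 2 ^ (2 * n) \<and>
     ring.transcendental ring_of_type_algebra K z \<and>
     x ^ 2 + x = y ^ 3 \<and>
     y ^ 4 - y = z ^ ((2 ^ n + 1) div 3) \<and>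
     F = generate_field ring_of_type_algebra (K \<union> {x, y, z})"

text \<open>The places not centred on the affine curve.\<close>

definition places_at_infinity ::
  "'a::field set \<Rightarrow> 'a set \<Rightarrow> 'a \<Rightarrow> 'a \<Rightarrow> 'a \<Rightarrow> ('a \<Rightarrow> int) set" where
  "places_at_infinity K F x y z =
     {P \<in> places K F. \<not> (regular_at P x \<and> regular_at P y \<and> regular_at P z)}"

text \<open>\<open>P\<close> is the (unique) point at infinity and \<open>l\<close> is the index with \<open>\<rho>\<^sub>l = 9m\<close>.\<close>

definition GGS2_setting ::
  "nat \<Rightarrow> nat \<Rightarrow> 'a::field set \<Rightarrow> 'a set \<Rightarrow> 'a \<Rightarrow> 'a \<Rightarrow> 'a \<Rightarrow> ('a \<Rightarrow> int) \<Rightarrow> nat \<Rightarrow> bool" where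
  "GGS2_setting n m K F x y z P l \<longleftrightarrow>
     5 \<le> n \<and> odd n \<and> m = (2 ^ n + 1) div 3 \<and>
     GGS2_function_field n K F x y z \<and>
     P \<in> places_at_infinity K F x y z \<and>
     1 \<le> l \<and> pole_number K F P l = 9 * m"

end

theory Submission
  imports Defs "HOL-Computational_Algebra.Polynomial"
begin

text \<open>
  In characteristic 2 and with \<open>t = y\<^sup>2 + y\<close> the curve is a tower \<open>K[z] < K[z,t] < K[z,t,y] < K[z,t,y,x] = R\<close> of
  Artin-Schreier steps \<open>w\<^sup>2 + w = u\<close>.  At a pole of \<open>z\<close> the values of \<open>z, t, y, x\<close> are proportional to
  \<open>8, 4m, 2m, 3m\<close> with \<open>m\<close> odd, so at each step the two summands of \<open>a + b w\<close> have values of different parity.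
  Hence \<open>1, w\<close> are independent, the pole is unique, and its values on \<open>R\<close> form the semigroup
  generated by \<open>8, 2m, 3m\<close>.  The steps are unramified over the affine line, which makes the localizations of \<open>R\<close>
  at its maximal ideals discrete valuation rings; so \<open>R\<close> is the ring of functions regular outside \<open>P\<close>, and
  its degree-one places are the \<open>K\<close>-points of the curve.

  With \<open>q = 2\<^sup>n\<close>, a point \<open>c\<close> of \<open>K\<close> is the \<open>z\<close>-coordinate of a \<open>K\<close>-point iff its norm \<open>c ^ (q + 1) = (c ^ m) ^ 3\<close> is the cube of
  some \<open>s\<^sup>4 + s\<close> with \<open>s\<close> in the field of \<open>q\<close> elements, and then there are 8 points above it: this gives \<open>4 q (q - 1)\<close>
  points.  A function with pole order at most \<open>9m\<close> has a norm in \<open>K[z]\<close> of degree at most \<open>9m\<close> and so cannot vanish at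
  all of them, which gives the dimension.  The bounds on the distance count words over the finite field \<open>K\<close>.
\<close>

section \<open>Subrings of a field, given as sets\<close>

text \<open>The place \<open>P\<close> is given only by its defining properties, so its values, its
  uniqueness and its semigroup must all come out of the equations; no genus or Riemann-Roch count is
  used. The delicate inclusion is that a function with poles only at \<open>P\<close> lies in
  \<open>R\<close>: \<open>K\<close> is not algebraically closed, so a denominator in
  \<open>K[z]\<close> may have prime factors of any degree, and a place where the function has a
  pole has to be constructed. Two facts make this possible: \<open>R / d R\<close> is finite, and it
  is reduced for prime \<open>d\<close>, because in characteristic 2 the square of
  \<open>a + b * w\<close> has no cross term. The constants come from \<open>m mod 8 = 3\<close>, a
  consequence of \<open>3 * m = 2 ^ n + 1\<close>. Multiplication by \<open>m\<close> acts on
  residues modulo 8 as multiplication by 3, so the eight sums of subsets of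
  \<open>4m, 2m, 3m\<close> represent each class once. The largest sum is \<open>9m\<close>, and
  beyond it every integer is a pole order. In the class of \<open>9m\<close>, the least elements of
  two complementary classes always add up to \<open>9m\<close>; thus \<open>9m + 8\<close> has two
  decompositions for each of the eight classes of the first summand, which is the 16.\<close>

locale subring_set =
  fixes A :: "'a::field set"
  assumes zero_mem [simp]: "0 \<in> A" and one_mem [simp]: "1 \<in> A"
    and add_mem: "\<lbrakk>a \<in> A; b \<in> A\<rbrakk> \<Longrightarrow> a + b \<in> A"
    and uminus_mem: "a \<in> A \<Longrightarrow> - a \<in> A"
    and mult_mem: "\<lbrakk>a \<in> A; b \<in> A\<rbrakk> \<Longrightarrow> a * b \<in> A"
begin

lemma diff_mem: "\<lbrakk>a \<in> A; b \<in> A\<rbrakk> \<Longrightarrow> a - b \<in> A"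
  using add_mem[of a "- b"] uminus_mem[of b] by simp

lemma power_mem: "a \<in> A \<Longrightarrow> a ^ i \<in> A"
  by (induction i) (auto simp: mult_mem)

lemma sum_mem: "(\<And>i. i \<in> I \<Longrightarrow> f i \<in> A) \<Longrightarrow> sum f I \<in> A"
  by (induction I rule: infinite_finite_induct) (auto simp: add_mem)

lemma prod_mem: "(\<And>i. i \<in> I \<Longrightarrow> f i \<in> A) \<Longrightarrow> prod f I \<in> A"
  by (induction I rule: infinite_finite_induct) (auto simp: mult_mem)

lemmas closed = add_mem uminus_mem mult_mem diff_mem power_mem sum_mem prod_mem

end

locale subfield_set = subring_set K for K :: "'a::field set" +
  assumes inverse_mem: "a \<in> K \<Longrightarrow> inverse a \<in> K"
begin

lemma divide_mem: "\<lbrakk>a \<in> K; b \<in> K\<rbrakk> \<Longrightarrow> a / b \<in> K"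
  using mult_mem[of a "inverse b"] inverse_mem[of b] by (simp add: divide_inverse)

lemmas field_closed = closed inverse_mem divide_mem

end

lemma ring_of_type_algebra_simps [simp]:
  "carrier ring_of_type_algebra = UNIV" "\<zero>\<^bsub>ring_of_type_algebra\<^esub> = 0" "\<one>\<^bsub>ring_of_type_algebra\<^esub> = 1"
  "x \<oplus>\<^bsub>ring_of_type_algebra\<^esub> y = x + y" "x \<otimes>\<^bsub>ring_of_type_algebra\<^esub> y = x * y"
  by (simp_all add: ring_of_type_algebra_def)

lemma a_inv_ring_of_type_algebra [simp]: "\<ominus>\<^bsub>ring_of_type_algebra\<^esub> x = - (x :: 'a::field)"
proof -
  interpret R: field "ring_of_type_algebra :: 'a ring"
    by (rule field_from_type_algebra)
  show ?thesis
    using R.minus_equality[of "- x" x] by simp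
qed

lemma m_inv_ring_of_type_algebra:
  assumes "x \<noteq> (0 :: 'a::field)"
  shows "inv\<^bsub>ring_of_type_algebra\<^esub> x = inverse x"
proof -
  interpret R: field "ring_of_type_algebra :: 'a ring"
    by (rule field_from_type_algebra)
  show ?thesis
    using R.comm_inv_char[of x "inverse x"] assms by simp
qed

text \<open>Bridge from the record-based hypothesis on \<open>K\<close> to arithmetic in the field
  type, in which all later computations take place.\<close>

lemma subfield_set_if_subfield:
  assumes "subfield K (ring_of_type_algebra :: 'a::field ring)"
  shows "subfield_set K"
proof -
  interpret R: field "ring_of_type_algebra :: 'a ring"
    by (rule field_from_type_algebra)
  note sub = subringE[OF subfieldE(1)[OF assms]]
  show ?thesis
  proof
    show "inverse a \<in> K" if "a \<in> K" for a
      using R.subfield_m_inv(1)[OF assms, of a] that sub(2) m_inv_ring_of_type_algebra[of a]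
      by (cases "a = 0") auto
  qed (use sub in auto)
qed

section \<open>Counting the affine rational points\<close>

locale finite_subfield = subfield_set +
  assumes fin: "finite K"
begin

text \<open>Multiplication by a nonzero \<open>a\<close> permutes \<open>K - {0}\<close>, so it does
  not change the product of all elements of that set.\<close>

lemma power_card:
  assumes "a \<in> K"
  shows "a ^ card K = a"
proof (cases "a = 0")
  case True
  moreover have "card K > 0"
    using fin zero_mem by (auto simp: card_gt_0_iff simp del: zero_mem)
  ultimately show ?thesis
    by (simp add: zero_power)
next
  case False
  have bij: "bij_betw ((*) a) (K - {0}) (K - {0})"
  proof (rule bij_betw_byWitness[of _ "(*) (inverse a)"])
    show "(*) a ` (K - {0}) \<subseteq> K - {0}" "(*) (inverse a) ` (K - {0}) \<subseteq> K - {0}"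
      using assms False by (auto intro: mult_mem inverse_mem)
    show "\<forall>x\<in>K - {0}. inverse a * (a * x) = x" "\<forall>x\<in>K - {0}. a * (inverse a * x) = x"
      using False by (simp_all flip: mult.assoc)
  qed
  have "\<Prod>(K - {0}) = (\<Prod>x\<in>K - {0}. a * x)"
    using prod.reindex_bij_betw[OF bij, of "\<lambda>x. x"] by simp
  also have "\<dots> = a ^ card (K - {0}) * \<Prod>(K - {0})"
    by (simp add: prod.distrib)
  finally have "a ^ card (K - {0}) = 1"
    using fin by (simp add: prod_zero_iff)
  moreover have "card K = Suc (card (K - {0}))"
    by (rule card_Suc_Diff1[OF fin zero_mem, symmetric])
  ultimately show ?thesis
    by (simp only: power_Suc mult_1_right)
qed

text \<open>Translation by 1 permutes \<open>K\<close>; comparing the sums of all elements before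
  and after gives the claim. For \<open>card K\<close> a power of 2 this yields characteristic
  2.\<close>

lemma of_nat_card: "of_nat (card K) = (0 :: 'a)"
proof -
  have bij: "bij_betw (\<lambda>x. x + 1) K K"
    by (rule bij_betw_byWitness[of _ "\<lambda>x. x - 1"]) (auto intro: add_mem diff_mem)
  have "\<Sum>K = (\<Sum>x\<in>K. x + 1)"
    using sum.reindex_bij_betw[OF bij, of "\<lambda>x. x"] by simp
  also have "\<dots> = \<Sum>K + of_nat (card K)"
    by (simp add: sum.distrib)
  finally show ?thesis
    by simp
qed

end

lemma card_power_eq_le:
  fixes c :: "'a::field"
  assumes "e > 0"
  shows "finite {x. x ^ e = c}" and "card {x. x ^ e = c} \<le> e"
proof -
  define p where "p = monom 1 e - [:c:]"
  have "coeff p e = 1"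
    using assms by (cases e) (simp_all add: p_def)
  then have p: "p \<noteq> 0"
    by auto
  have *: "{x. x ^ e = c} = {x. poly p x = 0}"
    by (simp add: p_def poly_monom)
  show "finite {x. x ^ e = c}"
    unfolding * using p by (rule poly_roots_finite)
  have "degree p \<le> e"
    unfolding p_def by (rule degree_diff_le) (simp_all add: degree_monom_le)
  then show "card {x. x ^ e = c} \<le> e"
    unfolding * using card_poly_roots_bound[OF p] by linarith
qed

locale binary_field = finite_subfield +
  fixes n :: nat
  assumes card_K: "card K = 2 ^ (2 * n)" and odd_n: "odd n"
begin

abbreviation q :: nat where "q \<equiv> 2 ^ n"

lemma two_eq_0 [simp]: "(2 :: 'a) = 0"
  using of_nat_card unfolding card_K by simp

lemma double [simp]: "x + x = (0 :: 'a)" "x + (x + y) = (y :: 'a)"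
  using two_eq_0 by (metis mult_2 mult_zero_left, metis add.assoc add_0 mult_2 mult_zero_left)

lemma uminus_eq: "- x = (x :: 'a)"
  using double(1)[of x] by (metis add_eq_0_iff)

lemma diff_eq: "x - y = x + (y :: 'a)"
  using uminus_eq[of y] by (metis diff_conv_add_uminus)

lemma sq_add: "(a + b) ^ 2 = a ^ 2 + (b :: 'a) ^ 2"
  by (simp add: power2_sum two_eq_0)

lemma add_power: "(a + b) ^ (2 ^ k) = a ^ (2 ^ k) + (b :: 'a) ^ (2 ^ k)"
proof (induction k)
  case (Suc k)
  have sq: "x ^ (2 ^ Suc k) = (x ^ (2 ^ k)) ^ 2" for x :: 'a
    by (simp add: power_mult[symmetric] mult.commute)
  show ?case
    unfolding sq Suc.IH by (rule sq_add)
qed simp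

lemma add_power_4: "(a + b) ^ 4 = a ^ 4 + (b :: 'a) ^ 4"
  using add_power[of a b 2] by simp

lemma card_K_sq: "card K = q\<^sup>2"
  by (simp add: card_K power_mult mult.commute power_even_eq)

lemma q_gt_1: "q \<ge> 2"
  using odd_n by (cases n) simp_all

lemma power_q_sq: "a \<in> K \<Longrightarrow> a ^ (q\<^sup>2) = a"
  using power_card card_K_sq by simp

section \<open>Additive equations and the norm over the subfield with \<open>q\<close>
  elements\<close>

lemma obtain_omega:
  obtains w where "w \<in> K" "w ^ 2 = w + 1"
proof -
  define e where "e = (card K - 1) div 3"
  have "card K mod 3 = 1"
    unfolding card_K using power_mod[of "4 :: nat" 3 n] by (simp add: power_mult)
  then have e: "card K = 3 * e + 1"
    unfolding e_def by presburger
  have "card K \<ge> 4"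
    using power_mono[OF q_gt_1, of 2] unfolding card_K_sq by simp
  then have "e > 0"
    using e by simp
  \<comment> \<open>The \<open>3 * e\<close> nonzero elements cannot all be roots of
    \<open>x ^ e = 1\<close>. The \<open>e\<close>-th power of an exception is a primitive cube root
    of unity.\<close>
  have "\<not> K - {0} \<subseteq> {x. x ^ e = 1}"
  proof
    assume "K - {0} \<subseteq> {x. x ^ e = 1}"
    then have "card (K - {0}) \<le> e"
      using card_power_eq_le[OF \<open>e > 0\<close>, of "1 :: 'a"] card_mono by (metis le_trans)
    then show False
      using e fin \<open>e > 0\<close> by simp
  qed
  then obtain g where g: "g \<in> K" "g \<noteq> 0" "g ^ e \<noteq> 1"
    by blast
  define w where "w = g ^ e"
  have "g ^ (3 * e) * g = g"
    using power_card[OF g(1)] unfolding e by (simp add: mult.commute)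
  then have "g ^ (3 * e) = 1"
    using g(2) by simp
  then have "w ^ 3 = 1"
    unfolding w_def by (simp add: power_mult[symmetric] mult.commute)
  then have "(w - 1) * (w ^ 2 + w + 1) = 0"
    by (simp add: power2_eq_square power3_eq_cube ring_distribs mult.assoc)
  then have "w ^ 2 + (w + 1) = 0"
    using g(3) by (simp add: w_def add.assoc)
  then have "w ^ 2 = w + 1"
    using uminus_eq[of "w + 1"] by (metis add_eq_0_iff2)
  then show thesis
    using that[of w] g(1) power_mem by (simp add: w_def)
qed

text \<open>A primitive cube root of unity: \<open>0, 1, w, w + 1\<close> form the field with 4
  elements.\<close>

definition w :: 'a where "w = (SOME w. w \<in> K \<and> w ^ 2 = w + 1)"

lemma w: "w \<in> K" "w ^ 2 = w + 1"
proof -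
  have "\<exists>w. w \<in> K \<and> w ^ 2 = w + 1"
    using obtain_omega by blast
  from someI_ex[OF this] show "w \<in> K" "w ^ 2 = w + 1"
    by (simp_all add: w_def)
qed

lemma w_cube: "w ^ 3 = 1"
proof -
  have "w ^ 3 = w * w ^ 2"
    by (simp add: power2_eq_square power3_eq_cube)
  also have "\<dots> = w + 1 + w"
    by (simp only: w(2)) (simp add: distrib_left power2_eq_square w(2)[unfolded power2_eq_square])
  also have "\<dots> = 1"
    by (simp add: add.assoc add.commute[of 1 w])
  finally show ?thesis .
qed

lemma w_pow_4: "w ^ 4 = w"
proof -
  have "w ^ 4 = w ^ 3 * w"
    by (simp add: eval_nat_numeral)
  then show ?thesis
    by (simp add: w_cube)
qed

lemma w_neq [simp]: "w \<noteq> 0" "w \<noteq> 1"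
  using w(2) by auto

lemma q_mod_3: "q mod 3 = 2"
proof -
  have "4 ^ k mod 3 = (1 :: nat)" for k
  proof (induction k)
    case (Suc k)
    then show ?case
      by (simp add: mod_mult_right_eq[of 4 "4 ^ k" 3, symmetric])
  qed simp
  obtain k where "n = 2 * k + 1"
    using odd_n by (metis oddE)
  then have "q mod 3 = 2 * (4 ^ k mod 3) mod 3"
    unfolding mod_mult_right_eq by (simp add: power_mult)
  then show ?thesis
    by (simp add: \<open>\<And>k. 4 ^ k mod 3 = (1 :: nat)\<close>)
qed

text \<open>The subfield of \<open>K\<close> with \<open>q\<close> elements, as the fixed set of the
  \<open>q\<close>-th power map; its cardinality comes out of the norm count in
  \<open>card_Fq_fibre\<close>.\<close>

definition Fq :: "'a set" where "Fq = {a \<in> K. a ^ q = a}"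

lemma Fq_K: "a \<in> Fq \<Longrightarrow> a \<in> K"
  and Fq_pow: "a \<in> Fq \<Longrightarrow> a ^ q = a"
  by (simp_all add: Fq_def)

lemma Fq_add: "a \<in> Fq \<Longrightarrow> b \<in> Fq \<Longrightarrow> a + b \<in> Fq"
  by (simp add: Fq_def add_mem add_power)

lemma Fq_power: "a \<in> Fq \<Longrightarrow> a ^ i \<in> Fq"
  by (simp add: Fq_def power_mem) (metis mult.commute power_mult)

lemma Fq_01 [simp]: "0 \<in> Fq" "1 \<in> Fq"
  using q_gt_1 by (simp_all add: Fq_def)

text \<open>The fields with \<open>q\<close> and 4 elements meet in the prime field because
  \<open>n\<close> is odd: \<open>q = 2 * 4 ^ k\<close>, so \<open>a ^ 4 = a\<close> turns
  \<open>a ^ q\<close> into \<open>a ^ 2\<close>.\<close>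

lemma Fq_F4:
  assumes "a ^ q = (a :: 'a)" "a ^ 4 = a"
  shows "a = 0 \<or> a = 1"
proof -
  obtain k where k: "n = 2 * k + 1"
    using odd_n by (metis oddE)
  have "a ^ (4 ^ j) = a" for j
  proof (induction j)
    case (Suc j)
    then show ?case
      by (simp only: power_Suc power_mult assms(2))
  qed simp
  moreover have "a ^ q = (a ^ (4 ^ k)) ^ 2"
  proof -
    have "q = 4 ^ k * 2"
      by (simp add: k power_mult)
    then show ?thesis
      by (simp only: power_mult)
  qed
  ultimately have "a ^ 2 = a"
    using assms(1) by simp
  then show ?thesis
    by (simp add: power2_eq_square)
qed

text \<open>For odd \<open>n\<close> the half trace \<open>h\<close>, the sum of the
  \<open>e ^ (4 ^ i)\<close>, satisfies \<open>h ^ 2 + h = T + e\<close> with the absolute trace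
  \<open>T\<close> in \<open>{0, 1}\<close>. If \<open>T = 1\<close>, adding \<open>w\<close>
  repairs the equation since \<open>w ^ 2 + w = 1\<close>; the solution then lies in
  \<open>K\<close> but need not lie in \<open>Fq\<close>.\<close>

lemma half_trace:
  assumes "e \<in> Fq"
  shows "\<exists>a\<in>K. a ^ 2 + a = e"
proof -
  obtain k where k: "n = 2 * k + 1"
    using odd_n by (metis oddE)
  define h where "h = (\<Sum>i\<le>k. e ^ (4 ^ i))"
  define T where "T = (\<Sum>j<n. e ^ (2 ^ j))"
  \<comment> \<open>The powers \<open>4 ^ i\<close> are the \<open>2 ^ j\<close> with even
    \<open>j\<close>; squaring supplies the odd ones.\<close>
  have h: "(\<Sum>i\<le>j. e ^ (4 ^ i)) ^ 2 + (\<Sum>i\<le>j. e ^ (4 ^ i)) = (\<Sum>i<2 * j + 2. e ^ (2 ^ i))" for j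
  proof (induction j)
    case 0
    then show ?case
      by (simp add: eval_nat_numeral add.commute)
  next
    case (Suc j)
    have e: "2 ^ (2 * j + 2) = (4 :: nat) ^ Suc j" "2 ^ (2 * j + 3) = (4 :: nat) ^ Suc j * 2"
      by (simp_all add: power_add power_mult)
    have "(e ^ (4 ^ Suc j)) ^ 2 = e ^ (2 ^ (2 * j + 3))" "e ^ (4 ^ Suc j) = e ^ (2 ^ (2 * j + 2))"
      by (simp_all only: e power_mult)
    moreover have "2 * Suc j + 2 = Suc (Suc (2 * j + 2))" "2 * j + 3 = Suc (2 * j + 2)"
      by simp_all
    moreover have "(S + x) ^ 2 + (S + x) = (S ^ 2 + S) + x + x ^ 2" for S x :: 'a
      by (simp add: sq_add add_ac)
    ultimately show ?case
      using Suc.IH by (simp only: sum.atMost_Suc sum.lessThan_Suc)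
  qed
  have hT: "h ^ 2 + h = T + e"
  proof -
    have "2 * k + 2 = Suc n"
      by (simp add: k)
    then show ?thesis
      using h[of k] Fq_pow[OF assms] unfolding h_def T_def by (simp only: sum.lessThan_Suc)
  qed
  \<comment> \<open>Squaring shifts the sum by one place; at \<open>i = n\<close> the two boundary
    terms cancel because \<open>e ^ q = e\<close>.\<close>
  have T2: "(\<Sum>j<i. e ^ (2 ^ j)) ^ 2 = (\<Sum>j<i. e ^ (2 ^ j)) + e + e ^ (2 ^ i)" for i
  proof (induction i)
    case (Suc i)
    have "(e ^ (2 ^ i)) ^ 2 = e ^ (2 ^ Suc i)"
      by (simp add: power_mult[symmetric] mult.commute)
    then show ?case
      using Suc.IH by (simp add: sq_add add_ac)
  qed simp
  have "T ^ 2 = T"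
    using T2[of n] Fq_pow[OF assms] unfolding T_def by (simp add: add.assoc)
  then have "T = 0 \<or> T = 1"
    by (simp add: power2_eq_square)
  moreover have "h \<in> K"
    unfolding h_def using Fq_K[OF assms] by (intro field_closed)
  moreover have "(h + w) ^ 2 + (h + w) = T + e + 1"
    unfolding hT[symmetric] by (simp add: sq_add w(2) add_ac)
  ultimately show ?thesis
  proof (elim disjE)
    assume "T = 1"
    then have "(h + w) ^ 2 + (h + w) = e"
      using \<open>(h + w) ^ 2 + (h + w) = T + e + 1\<close> by (simp add: add.commute)
    then show ?thesis
      using \<open>h \<in> K\<close> w(1) add_mem by blast
  qed (use hT in auto)
qed

lemma w_pow_q: "w ^ q = w + 1"
proof -
  have "q = 3 * (q div 3) + 2"
    using q_mod_3 by presburger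
  then have "w ^ q = (w ^ 3) ^ (q div 3) * w ^ 2"
    by (metis power_add power_mult)
  then show ?thesis
    by (simp add: w_cube w(2))
qed

text \<open>The hypothesis says that \<open>b ^ q + b\<close> is 0 or 1. In the first case
  \<open>b\<close> is in \<open>Fq\<close> and the half trace applies. In the second,
  \<open>w ^ q = w + 1\<close> makes \<open>s = b + w\<close> an element of \<open>Fq\<close>, and
  \<open>b ^ 3\<close> is expanded as \<open>(s + w) ^ 3\<close>.\<close>

lemma exists_sol_x:
  assumes b: "b \<in> K" and "(b ^ q + b) ^ 2 = b ^ q + b"
  shows "\<exists>a\<in>K. a ^ 2 + a = b ^ 3" "\<exists>s\<in>Fq. s ^ 4 + s = b ^ 4 + b"
proof -
  have "b ^ q + b = 0 \<or> b ^ q + b = 1"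
    using assms(2) by (simp add: power2_eq_square)
  then have "(\<exists>a\<in>K. a ^ 2 + a = b ^ 3) \<and> (\<exists>s\<in>Fq. s ^ 4 + s = b ^ 4 + b)"
  proof
    assume "b ^ q + b = 0"
    then have "b \<in> Fq"
      using b uminus_eq[of b] by (simp add: Fq_def add_eq_0_iff2)
    then show ?thesis
      using half_trace Fq_power by blast
  next
    assume *: "b ^ q + b = 1"
    define s where "s = b + w"
    have "b ^ q = 1 + b"
      using * by (metis add.commute add.left_commute double(2))
    then have "s ^ q = s"
      unfolding s_def add_power w_pow_q by (simp add: add_ac)
    then have s: "s \<in> Fq"
      using b w(1) add_mem by (simp add: Fq_def s_def)
    have b_s: "b = s + w"
      by (simp add: s_def add.assoc)
    have "s ^ 3 + 1 \<in> Fq"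
      using s Fq_power Fq_add by simp
    then obtain a0 where a0: "a0 \<in> K" "a0 ^ 2 + a0 = s ^ 3 + 1"
      using half_trace by blast
    \<comment> \<open>The square of \<open>w ^ 2 * s\<close> is \<open>w * s ^ 2\<close>, so this
      summand accounts for the mixed terms of \<open>(s + w) ^ 3\<close>; \<open>a0\<close> accounts
      for \<open>s ^ 3 + w ^ 3 = s ^ 3 + 1\<close>.\<close>
    define a where "a = a0 + w ^ 2 * s"
    have w4: "(w ^ 2) ^ 2 = w"
      using w_pow_4 by (simp add: power_mult[symmetric])
    have "a ^ 2 + a = (a0 ^ 2 + a0) + (w * s ^ 2 + w ^ 2 * s)"
      unfolding a_def sq_add power_mult_distrib w4 by (simp add: add_ac)
    also have "\<dots> = b ^ 3"
    proof -
      have "b ^ 3 = s ^ 3 + 3 * (s ^ 2 * w + s * w ^ 2) + w ^ 3"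
        unfolding b_s by (simp add: power2_eq_square power3_eq_cube algebra_simps)
      moreover have "(3 :: 'a) = 1"
      proof -
        show ?thesis
          by (simp only: numeral_Bit1 numeral_One double(1) add_0)
      qed
      ultimately show ?thesis
        unfolding a0 w_cube by (simp add: add_ac mult.commute)
    qed
    finally have "a ^ 2 + a = b ^ 3" .
    moreover have "a \<in> K"
      unfolding a_def using a0 w s Fq_K field_closed by simp
    moreover have "s ^ 4 + s = b ^ 4 + b"
      unfolding s_def add_power_4 w_pow_4 by (simp add: add_ac)
    ultimately show ?thesis
      using s by blast
  qed
  then show "\<exists>a\<in>K. a ^ 2 + a = b ^ 3" "\<exists>s\<in>Fq. s ^ 4 + s = b ^ 4 + b"
    by blast+
qed

lemma w_cases:
  assumes "d ^ 4 = (d :: 'a)"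
  shows "d = 0 \<or> d = 1 \<or> d = w \<or> d = w + 1"
proof -
  have "d * ((d + 1) * ((d + w) * (d + (w + 1)))) = d * ((d + 1) * (d ^ 2 + d + (w ^ 2 + w)))"
    by (simp add: algebra_simps power2_eq_square)
  also have "w ^ 2 + w = 1"
    by (simp add: w(2) add_ac)
  also have "d * ((d + 1) * (d ^ 2 + d + 1)) = d ^ 4 + d"
    by (simp add: algebra_simps power2_eq_square eval_nat_numeral)
  finally have "d * ((d + 1) * ((d + w) * (d + (w + 1)))) = 0"
    by (simp add: assms)
  then have "d = 0 \<or> d + 1 = 0 \<or> d + w = 0 \<or> d + (w + 1) = 0"
    by simp
  then show ?thesis
    by (simp add: add_eq_0_iff2 uminus_eq)
qed

lemma eq_iff_add: "x = y \<longleftrightarrow> x + y = (0 :: 'a)"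
  by (simp add: add_eq_0_iff2 uminus_eq)

lemma add_eq_imp: "x + y = d \<Longrightarrow> x = y + (d :: 'a)"
  by (metis add.commute double(2))

text \<open>A quotient of two elements with equal cubes is a cube root of unity in
  \<open>Fq\<close>, hence 1 by \<open>Fq_F4\<close>. Finiteness then makes cubing a bijection of
  \<open>Fq\<close>.\<close>

lemma cube_inj: "inj_on (\<lambda>r. r ^ 3) Fq"
proof (rule inj_onI)
  fix r s
  assume rs: "r \<in> Fq" "s \<in> Fq" "r ^ 3 = s ^ 3"
  show "r = s"
  proof (cases "s = 0")
    case True
    then show ?thesis
      using rs by simp
  next
    case False
    define t where "t = r / s"
    have "t ^ 3 = 1"
      using rs False by (simp add: t_def power_divide)
    have "t ^ 4 = t ^ 3 * t"
      by (simp add: eval_nat_numeral)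
    then have "t ^ 4 = t"
      unfolding \<open>t ^ 3 = 1\<close> by simp
    moreover have "t ^ q = t"
      using rs by (simp add: t_def power_divide Fq_pow)
    ultimately have "t = 0 \<or> t = 1"
      using Fq_F4 by blast
    then show ?thesis
      using \<open>t ^ 3 = 1\<close> False by (auto simp: t_def)
  qed
qed

lemma finite_Fq: "finite Fq"
  using fin by (simp add: Fq_def)

lemma cube_surj:
  assumes "r \<in> Fq"
  shows "\<exists>s\<in>Fq. s ^ 3 = r"
proof -
  have "(\<lambda>r. r ^ 3) ` Fq = Fq"
    by (rule endo_inj_surj[OF finite_Fq _ cube_inj]) (auto intro: Fq_power)
  then show ?thesis
    using assms by force
qed

lemma norm_Fq:
  assumes "c \<in> K"
  shows "c ^ (q + 1) \<in> Fq"
proof -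
  have "(c ^ (q + 1)) ^ q = c ^ (q\<^sup>2) * c ^ q"
    by (simp add: power_add power_mult_distrib power2_eq_square flip: power_mult)
  then show ?thesis
    using assms power_q_sq[OF assms] by (simp add: Fq_def power_mem mult_mem)
qed

definition norm_fibre :: "'a \<Rightarrow> 'a set" where
  "norm_fibre r = {c \<in> K. c ^ (q + 1) = r}"

text \<open>The \<open>(q - 1) * (q + 1)\<close> nonzero elements of \<open>K\<close> are
  distributed over at most \<open>q - 1\<close> norm fibres with at most \<open>q + 1\<close>
  elements each, both bounds being root counts; so both must be attained.\<close>

lemma card_Fq_fibre: "card Fq = q" "r \<in> Fq - {0} \<Longrightarrow> card (norm_fibre r) = q + 1"
proof -
  have fin_fibre: "finite (norm_fibre r)" for r
    using fin by (simp add: norm_fibre_def)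
  have le: "card (norm_fibre r) \<le> q + 1" for r
  proof -
    have "norm_fibre r \<subseteq> {c. c ^ (q + 1) = r}"
      unfolding norm_fibre_def by blast
    then have "card (norm_fibre r) \<le> card {c. c ^ (q + 1) = r}"
      by (intro card_mono card_power_eq_le(1)) simp_all
    also have "\<dots> \<le> q + 1"
      by (intro card_power_eq_le(2)) simp
    finally show ?thesis .
  qed
  have "Fq - {0} \<subseteq> {x. x ^ (q - 1) = 1}"
  proof
    fix x
    assume x: "x \<in> Fq - {0}"
    have "x ^ (q - 1) * x = x ^ q"
      using q_gt_1 by (metis power_minus_mult zero_less_numeral zero_less_power)
    then show "x \<in> {x. x ^ (q - 1) = 1}"
      using x Fq_pow[of x] by simp
  qed
  then have le': "card (Fq - {0}) \<le> q - 1"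
    using card_power_eq_le[of "q - 1" "1 :: 'a"] card_mono[of "{x :: 'a. x ^ (q - 1) = 1}" "Fq - {0}"] q_gt_1
    by simp
  have "K - {0} = (\<Union>r\<in>Fq - {0}. norm_fibre r)"
    using norm_Fq by (auto simp: norm_fibre_def)
  then have "card (K - {0}) = card (\<Union>r\<in>Fq - {0}. norm_fibre r)"
    by simp
  also have "\<dots> = (\<Sum>r\<in>Fq - {0}. card (norm_fibre r))"
    using finite_Fq fin_fibre by (intro card_UN_disjoint) (auto simp: norm_fibre_def)
  finally have sum: "(\<Sum>r\<in>Fq - {0}. card (norm_fibre r)) = (q - 1) * (q + 1)"
    using fin card_K_sq by (simp add: algebra_simps power2_eq_square diff_mult_distrib)
  have "(\<Sum>r\<in>Fq - {0}. card (norm_fibre r)) \<le> (\<Sum>r\<in>Fq - {0}. q + 1)"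
    by (intro sum_mono le)
  then have "(q - 1) * (q + 1) \<le> card (Fq - {0}) * (q + 1)"
    unfolding sum sum_constant by simp
  then have card: "card (Fq - {0}) = q - 1"
    using le' mult_le_cancel2[of "q - 1" "q + 1" "card (Fq - {0})"] by simp
  then show "card Fq = q"
    using card_Suc_Diff1[OF finite_Fq Fq_01(1)] q_gt_1 by linarith
  show "card (norm_fibre r) = q + 1" if r: "r \<in> Fq - {0}"
  proof (rule ccontr)
    assume "card (norm_fibre r) \<noteq> q + 1"
    then have "card (norm_fibre r) < q + 1"
      using le[of r] by linarith
    then have "(\<Sum>r\<in>Fq - {0}. card (norm_fibre r)) < (\<Sum>r\<in>Fq - {0}. q + 1)"
      using finite_Fq le r by (intro sum_strict_mono_ex1) auto
    then show False
      unfolding sum sum_constant card by simp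
  qed
qed

text \<open>The map \<open>s ^ 4 + s\<close> is additive and its kernel on \<open>Fq\<close> is
  \<open>{0, 1}\<close> by \<open>Fq_F4\<close>, so it is two-to-one.\<close>

lemma card_F4_image: "2 * card ((\<lambda>s. s ^ 4 + s) ` Fq) = q"
proof -
  let ?f = "\<lambda>s :: 'a. s ^ 4 + s"
  have "card {s \<in> Fq. ?f s = v} = 2" if v: "v \<in> ?f ` Fq" for v
  proof -
    obtain s where s: "s \<in> Fq" "v = ?f s"
      using v by blast
    have "{s' \<in> Fq. ?f s' = v} = {s, s + 1}"
    proof (intro Set.set_eqI iffI)
      fix s'
      assume "s' \<in> {s' \<in> Fq. ?f s' = v}"
      then have s': "s' \<in> Fq" "?f s' + ?f s = 0"
        using s(2) by simp_all
      then have "(s' + s) ^ 4 + (s' + s) = 0"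
        unfolding add_power_4 by (simp add: add_ac)
      moreover have "(s' + s) ^ q = s' + s"
        using Fq_add[OF s'(1) s(1)] by (rule Fq_pow)
      ultimately have "s' + s = 0 \<or> s' + s = 1"
        using Fq_F4[of "s' + s"] eq_iff_add by blast
      then show "s' \<in> {s, s + 1}"
        using add_eq_imp[of s' s 0] add_eq_imp[of s' s 1] by auto
    qed (use s Fq_add in \<open>auto simp: add_power_4 add_ac\<close>)
    then show ?thesis
      by simp
  qed
  then have "(\<Sum>v\<in>?f ` Fq. card {s \<in> Fq. ?f s = v}) = 2 * card (?f ` Fq)"
    by simp
  then show ?thesis
    using sum.image_gen[OF finite_Fq, of "\<lambda>_. 1 :: nat" ?f] card_Fq_fibre(1) by simp
qed

end

locale ggs_field = binary_field +
  fixes m :: nat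
  assumes m: "3 * m = 2 ^ n + 1"
begin

definition V :: "'a set" where "V = (\<lambda>s. (s ^ 4 + s) ^ 3) ` Fq"

lemma power_q1: "c ^ (q + 1) = (c ^ m) ^ (3 :: nat)" for c :: 'a
  unfolding m[symmetric] by (simp add: mult.commute flip: power_mult)

lemma m_pos: "m > 0"
  using m by simp

text \<open>The \<open>y\<close>-equation alone forces both the solvability of the
  \<open>x\<close>-equation in \<open>K\<close> and the condition on the norm of \<open>c\<close>.
  The norm \<open>(c ^ m) ^ 3\<close> has a cube root \<open>r\<close> in \<open>Fq\<close>; after
  rescaling \<open>b\<close> the \<open>y\<close>-equation has right-hand side \<open>r\<close>, so
  \<open>d = b' ^ q + b'\<close> satisfies \<open>d ^ 4 = d\<close> and \<open>d ^ q = d\<close>,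
  hence is 0 or 1, and \<open>exists_sol_x\<close> applies.\<close>

lemma point_over:
  assumes bc: "b \<in> K" "c \<in> K" "b ^ 4 + b = c ^ m"
  shows "(\<exists>a\<in>K. a ^ 2 + a = b ^ 3) \<and> c ^ (q + 1) \<in> V"
proof (cases "c ^ m = 0")
  case True
  then have "b * (b ^ 3 + 1) = 0"
    using bc(3) by (simp add: algebra_simps eval_nat_numeral)
  then have "b ^ 3 = 0 \<or> b ^ 3 = 1"
    using eq_iff_add by auto
  then have "b ^ 3 \<in> Fq"
    by auto
  moreover have "c ^ (q + 1) = (0 ^ 4 + 0) ^ 3"
    unfolding power_q1 True by simp
  then have "c ^ (q + 1) \<in> V"
    unfolding V_def by (rule image_eqI) simp
  ultimately show ?thesis
    using half_trace by simp
next
  case False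
  obtain r where r: "r \<in> Fq" "r ^ 3 = (c ^ m) ^ 3"
    using cube_surj norm_Fq[OF bc(2)] unfolding power_q1 by blast
  have "r \<noteq> 0"
    using r(2) False by auto
  \<comment> \<open>A cube root of unity: dividing \<open>b\<close> by it keeps
    \<open>b ^ 3\<close>, and because \<open>z ^ 4 = z\<close> it divides \<open>b ^ 4 + b\<close>
    by \<open>z\<close>, leaving \<open>r\<close>.\<close>
  define z where "z = c ^ m / r"
  have z: "z \<in> K" "z ^ 3 = 1" "z \<noteq> 0"
    using bc r Fq_K False \<open>r \<noteq> 0\<close> by (simp_all add: z_def power_divide divide_mem power_mem)
  have "z ^ 4 = z ^ 3 * z"
    by (simp add: eval_nat_numeral)
  then have z4: "z ^ 4 = z"
    using z(2) by simp
  define b' where "b' = b / z"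
  have b': "b' \<in> K" "b' ^ 3 = b ^ 3"
    using bc z by (simp_all add: b'_def divide_mem power_divide)
  have "b' ^ 4 + b' = (b ^ 4 + b) / z"
    using z by (simp add: b'_def power_divide z4 add_divide_distrib)
  also have "\<dots> = r"
    unfolding bc(3) z_def using False by simp
  finally have b'r: "b' ^ 4 + b' = r" .
  define d where "d = b' ^ q + b'"
  have "d ^ 4 + d = (b' ^ 4 + b') ^ q + (b' ^ 4 + b')"
    unfolding d_def add_power_4 add_power by (simp add: add_ac mult.commute flip: power_mult)
  then have "d ^ 4 = d"
    unfolding b'r Fq_pow[OF r(1)] using eq_iff_add by simp
  moreover have "d ^ q = b' ^ (q\<^sup>2) + b' ^ q"
    unfolding d_def add_power by (simp add: power2_eq_square flip: power_mult)
  then have "d ^ q = d"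
    unfolding power_q_sq[OF b'(1)] d_def by (simp add: add.commute)
  ultimately have "d = 0 \<or> d = 1"
    using Fq_F4 by blast
  then have "d ^ 2 = d"
    by auto
  from exists_sol_x[OF b'(1) this[unfolded d_def]]
  obtain a s where as: "a \<in> K" "a ^ 2 + a = b' ^ 3" "s \<in> Fq" "s ^ 4 + s = b' ^ 4 + b'"
    by blast
  then have "c ^ (q + 1) = (s ^ 4 + s) ^ 3"
    unfolding power_q1 b'r r(2)[symmetric] by simp
  then have "c ^ (q + 1) \<in> V"
    unfolding V_def using as(3) by (rule image_eqI)
  then show ?thesis
    using as(1,2) b'(2) by auto
qed

definition z_coords :: "'a set" where
  "z_coords = {c \<in> K. \<exists>b\<in>K. b ^ 4 + b = c ^ m}"

text \<open>Conversely, if \<open>c ^ m\<close> and \<open>s ^ 4 + s\<close> have equal nonzero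
  cubes, they differ by a cube root of unity \<open>z\<close>, and \<open>z * s\<close> is a
  \<open>y\<close>-coordinate above \<open>c\<close>.\<close>

lemma z_coords_iff:
  assumes "c \<in> K"
  shows "c \<in> z_coords \<longleftrightarrow> c ^ (q + 1) \<in> V"
proof
  assume "c ^ (q + 1) \<in> V"
  then obtain s where s: "s \<in> Fq" "(c ^ m) ^ 3 = (s ^ 4 + s) ^ 3"
    unfolding V_def power_q1 by blast
  show "c \<in> z_coords"
  proof (cases "s ^ 4 + s = 0")
    case True
    then have "c ^ m = 0"
      using s(2) by simp
    then have "0 ^ 4 + 0 = c ^ m"
      by simp
    then show ?thesis
      unfolding z_coords_def using assms zero_mem by blast
  next
    case False
    define z where "z = c ^ m / (s ^ 4 + s)"
    have z: "z \<in> K" "z ^ 3 = 1"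
      using assms s Fq_K False by (simp_all add: z_def power_divide divide_mem power_mem add_mem)
    have "z ^ 4 = z ^ 3 * z"
      by (simp add: eval_nat_numeral)
    then have "(z * s) ^ 4 + z * s = z * (s ^ 4 + s)"
      using z(2) by (simp add: power_mult_distrib distrib_left)
    also have "\<dots> = c ^ m"
      using False by (simp add: z_def)
    finally show ?thesis
      unfolding z_coords_def using assms z s Fq_K mult_mem by blast
  qed
qed (use point_over assms in \<open>auto simp: z_coords_def\<close>)

text \<open>\<open>V\<close> has \<open>q / 2\<close> elements. The fibre over 0 is a single point
  and the others have \<open>q + 1\<close> points:
  \<open>1 + (q / 2 - 1) * (q + 1) = q * (q - 1) / 2\<close>.\<close>

lemma card_z_coords: "2 * card z_coords = q * (q - 1)"
proof -
  let ?f = "\<lambda>s :: 'a. s ^ 4 + s"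
  have f_Fq: "?f ` Fq \<subseteq> Fq"
    using Fq_add Fq_power by blast
  have "V = (\<lambda>r. r ^ 3) ` (?f ` Fq)"
    by (auto simp: V_def)
  then have "card V = card (?f ` Fq)"
    using card_image[OF inj_on_subset[OF cube_inj f_Fq]] by simp
  then have V: "2 * card V = q"
    using card_F4_image by simp
  have V_Fq: "V \<subseteq> Fq"
    using f_Fq Fq_power by (auto simp: V_def)
  have fin_V: "finite V"
    using finite_subset[OF V_Fq finite_Fq] .
  have "0 \<in> V"
    unfolding V_def by (intro image_eqI[of _ _ 0]) simp_all
  have "z_coords = (\<Union>v\<in>V. norm_fibre v)"
    using z_coords_iff by (auto simp: norm_fibre_def) (auto simp: z_coords_def)
  then have "card z_coords = card (\<Union>v\<in>V. norm_fibre v)"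
    by simp
  also have "\<dots> = (\<Sum>v\<in>V. card (norm_fibre v))"
    using fin_V fin by (intro card_UN_disjoint) (auto simp: norm_fibre_def)
  also have "\<dots> = card (norm_fibre 0) + (\<Sum>v\<in>V - {0}. card (norm_fibre v))"
    using sum.remove[OF fin_V \<open>0 \<in> V\<close>] .
  also have "(\<Sum>v\<in>V - {0}. card (norm_fibre v)) = (\<Sum>v\<in>V - {0}. q + 1)"
    using V_Fq by (intro sum.cong card_Fq_fibre(2)) auto
  also have "\<dots> = (card V - 1) * (q + 1)"
    using fin_V \<open>0 \<in> V\<close> by simp
  also have "norm_fibre 0 = {0}"
    by (auto simp: norm_fibre_def)
  finally have "2 * card z_coords = 2 + (2 * card V - 2) * (q + 1)"
    by (simp add: algebra_simps)
  then have "2 * card z_coords = 2 + (q - 2) * (q + 1)"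
    unfolding V .
  moreover have "2 + (x - 2) * (x + 1) = x * (x - 1)" if "2 \<le> x" for x :: nat
    using that by (auto simp: algebra_simps dest!: le_Suc_ex)
  from this[OF q_gt_1] have "2 + (q - 2) * (q + 1) = q * (q - 1)" .
  ultimately show ?thesis
    by (simp only:)
qed

definition affine_points :: "('a \<times> 'a \<times> 'a) set" where
  "affine_points = {(c, b, a). c \<in> K \<and> b \<in> K \<and> a \<in> K \<and> b ^ 4 + b = c ^ m \<and> a ^ 2 + a = b ^ 3}"

lemma fst_affine_points: "fst ` affine_points = z_coords"
proof -
  have "c \<in> fst ` affine_points" if c: "c \<in> z_coords" for c
  proof -
    obtain b where b: "b \<in> K" "c \<in> K" "b ^ 4 + b = c ^ m"
      using c unfolding z_coords_def by blast
    then obtain a where "a \<in> K" "a ^ 2 + a = b ^ 3"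
      using point_over by blast
    then have "(c, b, a) \<in> affine_points"
      using b by (simp add: affine_points_def)
    then show ?thesis
      by force
  qed
  then show ?thesis
    by (auto simp: affine_points_def z_coords_def)
qed

text \<open>Above a \<open>z\<close>-coordinate, the \<open>y\<close>-values form a coset of the
  field with 4 elements, and above each of them the \<open>x\<close>-values form a coset of
  \<open>{0, 1}\<close>; \<open>point_over\<close> guarantees that the latter is not empty.\<close>

lemma card_affine_points: "card affine_points = 4 * q * (q - 1)"
proof -
  define A where "A b = {a \<in> K. a ^ 2 + a = b ^ 3}" for b
  define B where "B c = {b \<in> K. b ^ 4 + b = c ^ m}" for c
  have fin_AB: "finite (A b)" "finite (B c)" for b c
    using fin by (simp_all add: A_def B_def)
  have A: "card (A b) = 2" if c: "c \<in> K" "b \<in> B c" for b c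
  proof -
    obtain a where a: "a \<in> K" "a ^ 2 + a = b ^ 3"
      using point_over[of b c] c by (auto simp: B_def)
    have "A b = {a, a + 1}"
    proof (intro Set.set_eqI iffI)
      fix a'
      assume "a' \<in> A b"
      then have "a' ^ 2 + a' + (a ^ 2 + a) = 0"
        using a by (simp add: A_def)
      then have "(a' + a) * (a' + a + 1) = 0"
        by (simp add: algebra_simps power2_eq_square)
      then have "a' + a = 0 \<or> a' + a = 1"
        using eq_iff_add by auto
      then show "a' \<in> {a, a + 1}"
        using add_eq_imp[of a' a 0] add_eq_imp[of a' a 1] by auto
    qed (use a add_mem in \<open>auto simp: A_def sq_add add_ac\<close>)
    then show ?thesis
      by simp
  qed
  have B: "card (B c) = 4" if c: "c \<in> z_coords" for c
  proof -
    obtain b where b: "b \<in> K" "b ^ 4 + b = c ^ m"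
      using c unfolding z_coords_def by blast
    have Bc: "B c = (\<lambda>d. b + d) ` {0, 1, w, w + 1}"
    proof (intro Set.set_eqI iffI)
      fix b'
      assume "b' \<in> B c"
      then have "b' ^ 4 + b' + (b ^ 4 + b) = 0"
        using b by (simp add: B_def)
      then have "(b + b') ^ 4 + (b + b') = 0"
        unfolding add_power_4 by (simp add: add_ac)
      then have "b + b' \<in> {0, 1, w, w + 1}"
        using w_cases[of "b + b'"] eq_iff_add by simp
      moreover have "b' = b + (b + b')"
        by simp
      ultimately show "b' \<in> (\<lambda>d. b + d) ` {0, 1, w, w + 1}"
        by (rule rev_image_eqI)
    qed (use b w add_mem in \<open>auto simp: B_def add_power_4 w_pow_4 add_ac\<close>)
    have "card {0, 1, w, w + 1} = 4"
    proof -
      have "w + 1 \<noteq> 0" "w + 1 \<noteq> 1" "w + 1 \<noteq> w"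
        using eq_iff_add[of w 1] by auto
      then show ?thesis
        using w_neq by (simp add: card_insert_if)
    qed
    moreover have "card (B c) = card {0, 1, w, w + 1}"
      unfolding Bc by (intro card_image inj_onI) (rule add_left_imp_eq)
    ultimately show ?thesis
      by simp
  qed
  have "affine_points = (SIGMA c:z_coords. SIGMA b:B c. A b)"
    by (auto simp: affine_points_def z_coords_def A_def B_def)
  moreover have "finite z_coords"
    using fin by (simp add: z_coords_def)
  ultimately have "card affine_points = (\<Sum>c\<in>z_coords. card (SIGMA b:B c. A b))"
    using fin_AB by simp
  also have "\<dots> = (\<Sum>c\<in>z_coords. 8)"
  proof (rule sum.cong)
    fix c
    assume c: "c \<in> z_coords"
    then have "c \<in> K"
      by (simp add: z_coords_def)
    have "card (SIGMA b:B c. A b) = (\<Sum>b\<in>B c. card (A b))"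
      using fin_AB by simp
    also have "\<dots> = (\<Sum>b\<in>B c. 2)"
      using A[OF \<open>c \<in> K\<close>] by (intro sum.cong) auto
    finally show "card (SIGMA b:B c. A b) = 8"
      using B[OF c] by simp
  qed simp
  also have "\<dots> = 4 * (2 * card z_coords)"
    by simp
  finally show ?thesis
    unfolding card_z_coords by (simp only: mult.assoc)
qed

end

section \<open>The semigroup generated by 8, 2m and 3m\<close>

text \<open>The pole orders of the monomials \<open>z ^ k * t ^ a * y ^ b * x ^ c\<close>, the last
  three exponents being at most 1 because of the quadratic steps. With \<open>j = 2 * a + b\<close>
  this is the usual description by \<open>j\<close> in \<open>{0, 1, 2, 3}\<close>.\<close>

definition ggs_semigroup :: "nat \<Rightarrow> nat set" where
  "ggs_semigroup m = {8 * k + 4 * m * a + 2 * m * b + 3 * m * c | k a b c. a \<le> 1 \<and> b \<le> 1 \<and> c \<le> 1}"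

text \<open>If \<open>m mod 8 = 3\<close>, the least element of the semigroup in the class of \<open>r\<close> modulo 8 is \<open>apery r * m\<close>.\<close>

definition apery :: "nat \<Rightarrow> nat" where
  "apery r = [0, 3, 6, 9, 4, 7, 2, 5] ! r"

lemma apery_simps [simp]:
  "apery 0 = 0" "apery (Suc 0) = 3" "apery 2 = 6" "apery 3 = 9"
  "apery 4 = 4" "apery 5 = 7" "apery 6 = 2" "apery 7 = 5"
  by (simp_all add: apery_def)

lemma nat_mod_8_cases:
  fixes s :: nat
  obtains "s mod 8 = 0" | "s mod 8 = 1" | "s mod 8 = 2" | "s mod 8 = 3"
    | "s mod 8 = 4" | "s mod 8 = 5" | "s mod 8 = 6" | "s mod 8 = 7"
proof -
  have "s mod 8 < 8"
    by simp
  then have "s mod 8 = 0 \<or> s mod 8 = 1 \<or> s mod 8 = 2 \<or> s mod 8 = 3 \<or>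
      s mod 8 = 4 \<or> s mod 8 = 5 \<or> s mod 8 = 6 \<or> s mod 8 = 7"
    by linarith
  then show thesis
    by (elim disjE) (erule that)+
qed

text \<open>The multiplier \<open>e = 4 * a + 2 * b + 3 * c\<close> takes the values 0, 2, 3, 4, 5,
  6, 7, 9, each for one triple. As \<open>m\<close> is 3 modulo 8, the residues of
  \<open>e * m\<close> are \<open>3 * e\<close>, which run through each class exactly once.\<close>

lemma mem_ggs_semigroup_iff:
  assumes m: "m = 8 * u + 3"
  shows "s \<in> ggs_semigroup m \<longleftrightarrow> apery (s mod 8) * m \<le> s"
proof
  assume "s \<in> ggs_semigroup m"
  then obtain k a b c where s: "s = 8 * k + 4 * m * a + 2 * m * b + 3 * m * c"
    and abc: "a \<le> 1" "b \<le> 1" "c \<le> 1"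
    by (auto simp: ggs_semigroup_def)
  define e where "e = 4 * a + 2 * b + 3 * c"
  have ab: "a = 0 \<or> a = 1" "b = 0 \<or> b = 1" "c = 0 \<or> c = 1"
    using abc by linarith+
  have "apery (3 * e mod 8) = e"
    using ab unfolding e_def by (elim disjE) simp_all
  moreover have se: "s = 8 * k + e * m"
    unfolding s e_def by (simp add: algebra_simps)
  then have "s = 8 * (k + e * u) + 3 * e"
    unfolding m by (simp add: algebra_simps)
  then have "s mod 8 = 3 * e mod 8"
    by (metis mod_mult_self4)
  ultimately show "apery (s mod 8) * m \<le> s"
    using se by simp
next
  assume le: "apery (s mod 8) * m \<le> s"
  have *: "s \<in> ggs_semigroup m"
    if "s = 8 * k + 4 * m * a + 2 * m * b + 3 * m * c" "a \<le> 1" "b \<le> 1" "c \<le> 1" for k a b c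
    unfolding ggs_semigroup_def using that by blast
  have div: "s = 8 * ((s - e * m) div 8) + e * m"
    if "e * m \<le> s" "e * m mod 8 = s mod 8" for e
  proof -
    have "8 dvd s - e * m"
      using that mod_eq_dvd_iff_nat[of "e * m" s 8] by simp
    then have "8 * ((s - e * m) div 8) = s - e * m"
      by simp
    then show ?thesis
      using that(1) by linarith
  qed
  show "s \<in> ggs_semigroup m"
  proof (cases rule: nat_mod_8_cases[of s])
    case 1
    then show ?thesis
      by (intro *[of "s div 8" 0 0 0]) presburger+
  next
    case 2
    moreover have "3 * m mod 8 = 1"
      using m by presburger
    ultimately show ?thesis
      using le by (intro *[of "(s - 3 * m) div 8" 0 0 1]) (use div[of 3] in simp_all)
  next
    case 3
    moreover have "6 * m mod 8 = 2"
      using m by presburger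
    ultimately show ?thesis
      using le by (intro *[of "(s - 6 * m) div 8" 1 1 0]) (use div[of 6] in simp_all)
  next
    case 4
    moreover have "9 * m mod 8 = 3"
      using m by presburger
    ultimately show ?thesis
      using le by (intro *[of "(s - 9 * m) div 8" 1 1 1]) (use div[of 9] in simp_all)
  next
    case 5
    moreover have "4 * m mod 8 = 4"
      using m by presburger
    ultimately show ?thesis
      using le by (intro *[of "(s - 4 * m) div 8" 1 0 0]) (use div[of 4] in simp_all)
  next
    case 6
    moreover have "7 * m mod 8 = 5"
      using m by presburger
    ultimately show ?thesis
      using le by (intro *[of "(s - 7 * m) div 8" 1 0 1]) (use div[of 7] in simp_all)
  next
    case 7
    moreover have "2 * m mod 8 = 6"
      using m by presburger
    ultimately show ?thesis
      using le by (intro *[of "(s - 2 * m) div 8" 0 1 0]) (use div[of 2] in simp_all)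
  next
    case 8
    moreover have "5 * m mod 8 = 7"
      using m by presburger
    ultimately show ?thesis
      using le by (intro *[of "(s - 5 * m) div 8" 0 1 1]) (use div[of 5] in simp_all)
  qed
qed

text \<open>The largest Apery multiplier is 9. The bound is not sharp, the exact conductor being
  \<open>9 * m - 7\<close>, but \<open>9 * m\<close> is where the code starts.\<close>

lemma ggs_semigroup_conductor:
  assumes "m = 8 * u + 3" and "9 * m \<le> s"
  shows "s \<in> ggs_semigroup m"
proof -
  have "apery (s mod 8) \<le> 9"
    by (cases rule: nat_mod_8_cases[of s]) simp_all
  then have "apery (s mod 8) * m \<le> 9 * m"
    by simp
  then show ?thesis
    using assms(2) unfolding mem_ggs_semigroup_iff[OF assms(1)] by linarith
qed

lemma card_residue_class_interval:
  fixes a b r :: nat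
  assumes "a mod 8 = r"
  shows "card {s. s mod 8 = r \<and> a \<le> s \<and> s \<le> b} = (if a \<le> b then (b - a) div 8 + 1 else 0)"
proof (cases "a \<le> b")
  case True
  have "{s. s mod 8 = r \<and> a \<le> s \<and> s \<le> b} = (\<lambda>i. a + 8 * i) ` {..(b - a) div 8}"
  proof (intro Set.set_eqI iffI)
    fix s
    assume "s \<in> {s. s mod 8 = r \<and> a \<le> s \<and> s \<le> b}"
    then have s: "s mod 8 = r" "a \<le> s" "s \<le> b"
      by auto
    then have "8 dvd s - a"
      using assms mod_eq_dvd_iff_nat[of a s 8] by simp
    then have "8 * ((s - a) div 8) = s - a"
      by simp
    then have "s = a + 8 * ((s - a) div 8)"
      using s by linarith
    moreover have "(s - a) div 8 \<le> (b - a) div 8"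
      using s by (simp add: div_le_mono)
    ultimately show "s \<in> (\<lambda>i. a + 8 * i) ` {..(b - a) div 8}"
      by blast
  qed (use assms True in auto)
  then show ?thesis
    using True by (simp add: card_image inj_on_def)
qed auto

lemma card_split_mod_8:
  assumes "finite (A :: nat set)"
  shows "card A = (\<Sum>r<8. card {s \<in> A. s mod 8 = r})"
proof -
  have "A = (\<Union>r<8. {s \<in> A. s mod 8 = r})"
    by auto
  then have "card A = card (\<Union>r<8. {s \<in> A. s mod 8 = r})"
    by simp
  also have "\<dots> = (\<Sum>r<8. card {s \<in> A. s mod 8 = r})"
    using assms by (intro card_UN_disjoint) auto
  finally show ?thesis .
qed

lemma sum_lessThan_8:
  "(\<Sum>r<(8::nat). f r) = f 0 + f 1 + f 2 + f 3 + f 4 + f 5 + f 6 + (f 7 :: nat)"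
  by (simp add: eval_nat_numeral lessThan_Suc)

lemma apery_mod:
  assumes "m = 8 * u + 3" "r < 8"
  shows "apery r * m mod 8 = r"
proof -
  have "apery (r mod 8) * m mod 8 = r mod 8"
    by (cases rule: nat_mod_8_cases[of r]) (use assms(1) in \<open>simp; presburger\<close>)+
  then show ?thesis
    using assms(2) by simp
qed

text \<open>Each class contributes an arithmetic progression with difference 8 from its Apery
  element up to \<open>9 * m\<close>. The total equals \<open>(9 * m + 9) / 2\<close>.\<close>

lemma card_ggs_semigroup_le:
  assumes m: "m = 8 * u + 3"
  shows "card {s \<in> ggs_semigroup m. s \<le> 9 * m} = 36 * u + 18"
proof -
  let ?A = "{s \<in> ggs_semigroup m. s \<le> 9 * m}"
  have fin: "finite ?A"
    by (rule finite_subset[of _ "{..9 * m}"]) auto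
  have "card {s \<in> ?A. s mod 8 = r} = (9 * m - apery r * m) div 8 + 1" if "r < 8" for r
  proof -
    have "apery (r mod 8) \<le> 9"
      by (cases rule: nat_mod_8_cases[of r]) simp_all
    then have le: "apery r * m \<le> 9 * m"
      using that by simp
    have "{s \<in> ?A. s mod 8 = r} = {s. s mod 8 = r \<and> apery r * m \<le> s \<and> s \<le> 9 * m}"
      using mem_ggs_semigroup_iff[OF m] by auto
    then show ?thesis
      using card_residue_class_interval[OF apery_mod[OF m that]] le by simp
  qed
  then have "card ?A = (\<Sum>r<8. (9 * m - apery r * m) div 8 + 1)"
    using card_split_mod_8[OF fin] by simp
  also have "\<dots> = 36 * u + 18"
  proof -
    have "(72 * u + 27) div 8 = 9 * u + 3" "(48 * u + 18) div 8 = 6 * u + 2"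
      "(24 * u + 9) div 8 = 3 * u + 1" "(40 * u + 15) div 8 = 5 * u + 1"
      "(16 * u + 6) div 8 = 2 * u" "(56 * u + 21) div 8 = 7 * u + 2" "(32 * u + 12) div 8 = 4 * u + 1"
      by presburger+
    then show ?thesis
      unfolding sum_lessThan_8 using m by (simp add: add.commute)
  qed
  finally show ?thesis .
qed

text \<open>The Feng-Rao number of the pole order \<open>s\<close>, counted by first summands;
  \<open>a \<le> s\<close> guards the truncated subtraction.\<close>

definition summand_count :: "nat set \<Rightarrow> nat \<Rightarrow> nat" where
  "summand_count S s = card {a \<in> S. a \<le> s \<and> s - a \<in> S}"

text \<open>If \<open>a\<close> is in the class \<open>r\<close>, then \<open>s - a\<close> is in
  the class of \<open>s - r\<close>, so both memberships become inequalities and \<open>a\<close>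
  runs through a progression with difference 8. The term \<open>s + 8 - r\<close> keeps the
  subtraction from being truncated.\<close>

lemma summand_count_ggs_semigroup:
  assumes m: "m = 8 * u + 3"
  shows "summand_count (ggs_semigroup m) s =
    (\<Sum>r<8. let w = apery r * m + apery ((s + 8 - r) mod 8) * m in
       if w \<le> s then (s - w) div 8 + 1 else 0)"
proof -
  let ?S = "ggs_semigroup m"
  let ?A = "{a \<in> ?S. a \<le> s \<and> s - a \<in> ?S}"
  have fin: "finite ?A"
    by (rule finite_subset[of _ "{..s}"]) auto
  have "card {a \<in> ?A. a mod 8 = r} =
      (let w = apery r * m + apery ((s + 8 - r) mod 8) * m in
       if w \<le> s then (s - w) div 8 + 1 else 0)" if "r < 8" for r
  proof -
    define v where "v = apery ((s + 8 - r) mod 8) * m"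
    define w where "w = apery r * m"
    have w: "w mod 8 = r"
      unfolding w_def using apery_mod[OF m that] .
    have mem: "a \<in> ?A \<and> a mod 8 = r \<longleftrightarrow> a mod 8 = r \<and> w \<le> a \<and> a + v \<le> s" for a
    proof (cases "a mod 8 = r \<and> a \<le> s")
      case True
      then obtain i where "a = 8 * i + r" "a \<le> s"
        by (metis mult_div_mod_eq)
      then have "s + 8 - r = (s - a) + 8 * (i + 1)"
        using \<open>r < 8\<close> by simp
      then have mod: "(s + 8 - r) mod 8 = (s - a) mod 8"
        using mod_mult_self2[of "s - a" 8 "i + 1"] by (simp only:)
      have "a \<in> ?S \<longleftrightarrow> w \<le> a" "s - a \<in> ?S \<longleftrightarrow> v \<le> s - a"
        using True by (simp_all only: mem_ggs_semigroup_iff[OF m] v_def w_def mod)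
      moreover have "v \<le> s - a \<longleftrightarrow> a + v \<le> s"
        using \<open>a \<le> s\<close> by linarith
      ultimately show ?thesis
        using True by blast
    qed auto
    have "card {a \<in> ?A. a mod 8 = r} = (if w + v \<le> s then (s - (w + v)) div 8 + 1 else 0)"
    proof (cases "v \<le> s")
      case True
      have "{a \<in> ?A. a mod 8 = r} = {a. a mod 8 = r \<and> w \<le> a \<and> a + v \<le> s}"
        using mem by blast
      also have "\<dots> = {a. a mod 8 = r \<and> w \<le> a \<and> a \<le> s - v}"
        using True by auto
      finally have "card {a \<in> ?A. a mod 8 = r} = (if w \<le> s - v then (s - v - w) div 8 + 1 else 0)"
        using card_residue_class_interval[OF w] by simp
      moreover have "w \<le> s - v \<longleftrightarrow> w + v \<le> s" "s - v - w = s - (w + v)"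
        using True by linarith+
      ultimately show ?thesis
        by simp
    next
      case False
      then have "\<not> (a \<in> ?A \<and> a mod 8 = r)" for a
        using mem[of a] by linarith
      then have "{a \<in> ?A. a mod 8 = r} = {}"
        by blast
      moreover have "\<not> w + v \<le> s"
        using False by linarith
      ultimately show ?thesis
        by (simp only: card.empty if_False)
    qed
    then show ?thesis
      unfolding w_def v_def Let_def .
  qed
  then show ?thesis
    unfolding summand_count_def using card_split_mod_8[OF fin] by simp
qed

text \<open>For each class of \<open>s\<close> it suffices to keep those \<open>r\<close> whose two
  Apery multipliers have the least sum \<open>c\<close>, in the first case also one with
  \<open>c = 8\<close>. In seven classes the number of decompositions grows with \<open>u\<close>,
  and \<open>u \<ge> 1\<close> brings it to 16.\<close>

lemma summand_count_ggs_semigroup_ge: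
  assumes m: "m = 8 * u + 3" and u: "u \<ge> 1" and s: "s > 9 * m"
  shows "summand_count (ggs_semigroup m) s \<ge> 16"
proof -
  define f where "f r = (let w = apery r * m + apery ((s + 8 - r) mod 8) * m in
       if w \<le> s then (s - w) div 8 + 1 else 0)" for r
  have f: "k + 1 \<le> f r"
    if "s mod 8 = t" "r < 8" "apery r + apery ((t + 8 - r) mod 8) = c" "8 * k + c * m \<le> s" for r t c k
  proof -
    define i where "i = s div 8"
    then have "s = 8 * i + t"
      using that(1) by (metis mult_div_mod_eq)
    then have "s + 8 - r = (t + 8 - r) + 8 * i"
      using that(2) by simp
    then have "(s + 8 - r) mod 8 = (t + 8 - r) mod 8"
      using mod_mult_self2[of "t + 8 - r" 8 i] by (simp only:)
    then have "apery r * m + apery ((s + 8 - r) mod 8) * m = c * m"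
      unfolding that(3)[symmetric] by (simp only: add_mult_distrib)
    moreover have "k \<le> (s - c * m) div 8"
      using that(4) by (simp add: less_eq_div_iff_mult_less_eq)
    ultimately show ?thesis
      using that(4) by (simp add: f_def)
  qed
  have si: "s = 8 * (s div 8) + s mod 8"
    by simp
  have "16 \<le> f 0 + f 1 + f 2 + f 3 + f 4 + f 5 + f 6 + f 7"
  proof (cases rule: nat_mod_8_cases[of s])
    case 1
    then have "9 * u + 4 \<le> s div 8"
      using s m si by linarith
    then have le: "72 * u + 32 \<le> s"
      using si 1 by linarith
    moreover have "9 * u + 4 + 1 \<le> f 0"
      by (rule f[OF 1, where c = 0]; use le m in simp)+
    moreover have "u + 1 + 1 \<le> f 4"
      by (rule f[OF 1, where c = 8]; use le m in simp)+
    ultimately show ?thesis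
      using u by linarith
  next
    case 2
    then have "9 * u + 4 \<le> s div 8"
      using s m si by linarith
    then have le: "72 * u + 33 \<le> s"
      using si 2 by linarith
    moreover have "6 * u + 3 + 1 \<le> f 0" "6 * u + 3 + 1 \<le> f 1"
      by (rule f[OF 2, where c = 3]; use le m in simp)+
    ultimately show ?thesis
      using u by linarith
  next
    case 3
    then have "9 * u + 4 \<le> s div 8"
      using s m si by linarith
    then have le: "72 * u + 34 \<le> s"
      using si 3 by linarith
    moreover have "3 * u + 2 + 1 \<le> f 0" "3 * u + 2 + 1 \<le> f 1" "3 * u + 2 + 1 \<le> f 2" "3 * u + 2 + 1 \<le> f 4" "3 * u + 2 + 1 \<le> f 6"
      by (rule f[OF 3, where c = 6]; use le m in simp)+
    ultimately show ?thesis
      using u by linarith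
  next
    \<comment> \<open>The tight class: all eight sums are 9. Since \<open>s > 9 * m\<close> lies in
      the class of \<open>9 * m\<close>, it is at least \<open>9 * m + 8\<close>, which gives two
      decompositions for every \<open>r\<close>.\<close>
    case 4
    then have "9 * u + 4 \<le> s div 8"
      using s m si by linarith
    then have le: "72 * u + 35 \<le> s"
      using si 4 by linarith
    moreover have "1 + 1 \<le> f 0" "1 + 1 \<le> f 1" "1 + 1 \<le> f 2" "1 + 1 \<le> f 3" "1 + 1 \<le> f 4" "1 + 1 \<le> f 5" "1 + 1 \<le> f 6" "1 + 1 \<le> f 7"
      by (rule f[OF 4, where c = 9]; use le m in simp)+
    ultimately show ?thesis
      using u by linarith
  next
    case 5
    then have "9 * u + 3 \<le> s div 8"
      using s m si by linarith
    then have le: "72 * u + 28 \<le> s"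
      using si 5 by linarith
    moreover have "5 * u + 2 + 1 \<le> f 0" "5 * u + 2 + 1 \<le> f 4"
      by (rule f[OF 5, where c = 4]; use le m in simp)+
    ultimately show ?thesis
      using u by linarith
  next
    case 6
    then have "9 * u + 3 \<le> s div 8"
      using s m si by linarith
    then have le: "72 * u + 29 \<le> s"
      using si 6 by linarith
    moreover have "2 * u + 1 + 1 \<le> f 0" "2 * u + 1 + 1 \<le> f 1" "2 * u + 1 + 1 \<le> f 4" "2 * u + 1 + 1 \<le> f 5" "2 * u + 1 + 1 \<le> f 6" "2 * u + 1 + 1 \<le> f 7"
      by (rule f[OF 6, where c = 7]; use le m in simp)+
    ultimately show ?thesis
      using u by linarith
  next
    case 7
    then have "9 * u + 3 \<le> s div 8"
      using s m si by linarith
    then have le: "72 * u + 30 \<le> s"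
      using si 7 by linarith
    moreover have "7 * u + 3 + 1 \<le> f 0" "7 * u + 3 + 1 \<le> f 6"
      by (rule f[OF 7, where c = 2]; use le m in simp)+
    ultimately show ?thesis
      using u by linarith
  next
    case 8
    then have "9 * u + 3 \<le> s div 8"
      using s m si by linarith
    then have le: "72 * u + 31 \<le> s"
      using si 8 by linarith
    moreover have "4 * u + 2 + 1 \<le> f 0" "4 * u + 2 + 1 \<le> f 7" "4 * u + 2 + 1 \<le> f 1" "4 * u + 2 + 1 \<le> f 6"
      by (rule f[OF 8, where c = 5]; use le m in simp)+
    ultimately show ?thesis
      using u by linarith
  qed
  then show ?thesis
    unfolding summand_count_ggs_semigroup[OF m] sum_lessThan_8 f_def .
qed

lemma summand_count_ggs_semigroup_eq:
  assumes m: "m = 8 * u + 3"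
  shows "summand_count (ggs_semigroup m) (9 * m + 8) = 16"
proof -
  have "(9 * m + 8 + 8 - r) mod 8 = (11 - r) mod 8" if "r < 8" for r
  proof -
    have "9 * m + 8 + 8 - r = (11 - r) + 8 * (9 * u + 4)"
      using that m by simp
    then show ?thesis
      using mod_mult_self2[of "11 - r" 8 "9 * u + 4"] by (simp only:)
  qed
  from this[of 0] this[of 1] this[of 2] this[of 3] this[of 4] this[of 5] this[of 6] this[of 7]
  show ?thesis
    unfolding summand_count_ggs_semigroup[OF m] sum_lessThan_8 Let_def by simp
qed

section \<open>Codes from order functions\<close>

definition words :: "'a::field set \<Rightarrow> 'p set \<Rightarrow> ('p \<Rightarrow> 'a) set" where
  "words K D = {w. (\<forall>p\<in>D. w p \<in> K) \<and> (\<forall>p. p \<notin> D \<longrightarrow> w p = 0)}"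

lemma carrier_word_space [simp]: "carrier (word_space K D) = words K D"
  by (simp add: word_space_def words_def)

lemma word_space_simps [simp]:
  "\<zero>\<^bsub>word_space K D\<^esub> = (\<lambda>p. 0)" "v \<oplus>\<^bsub>word_space K D\<^esub> w = (\<lambda>p. v p + w p)"
  "c \<odot>\<^bsub>word_space K D\<^esub> w = (\<lambda>p. c * w p)"
  by (simp_all add: word_space_def)

lemma scalars_simps [simp]:
  "carrier (scalars K) = K" "\<zero>\<^bsub>scalars K\<^esub> = 0" "\<one>\<^bsub>scalars K\<^esub> = 1"
  "x \<oplus>\<^bsub>scalars K\<^esub> y = x + y" "x \<otimes>\<^bsub>scalars K\<^esub> y = x * y"
  by (simp_all add: ring_of_type_algebra_def)

lemma field_scalars:
  assumes "subfield K (ring_of_type_algebra :: 'a::field ring)"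
  shows "field (scalars K)"
proof -
  interpret R: field "ring_of_type_algebra :: 'a ring"
    by (rule field_from_type_algebra)
  show ?thesis
    using R.subfield_iff(2)[OF assms] .
qed

lemma vectorspace_word_space:
  assumes "subfield K (ring_of_type_algebra :: 'a::field ring)"
  shows "vectorspace (scalars K) (word_space K D)"
proof -
  interpret S: field "scalars K"
    by (rule field_scalars[OF assms])
  interpret K: subfield_set K
    by (rule subfield_set_if_subfield[OF assms])
  have "abelian_group (word_space K D)"
  proof (rule abelian_groupI)
    fix v
    assume "v \<in> carrier (word_space K D)"
    then show "\<exists>w\<in>carrier (word_space K D). w \<oplus>\<^bsub>word_space K D\<^esub> v = \<zero>\<^bsub>word_space K D\<^esub>"
      by (intro bexI[of _ "\<lambda>p. - v p"]) (simp_all add: words_def K.uminus_mem)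
  qed (auto simp: words_def K.add_mem algebra_simps)
  then have "module (scalars K) (word_space K D)"
    by (intro moduleI S.is_cring) (auto simp: words_def K.mult_mem algebra_simps)
  then show ?thesis
    unfolding vectorspace_def using S.field_axioms by blast
qed

text \<open>Over a finite field the dimension can be read off from the cardinality; dimension
  statements below thereby become counting statements.\<close>

lemma card_vectorspace:
  assumes "vectorspace F W" "finite (carrier W)" "finite (carrier F)"
  shows "card (carrier W) = card (carrier F) ^ vectorspace.dim F W"
proof -
  interpret W: vectorspace F W
    by fact
  have "W.gen_set (carrier W)"
    using W.span_closed W.in_own_span by blast
  then have "W.fin_dim"
    unfolding W.fin_dim_def using assms(2) by blast
  then obtain B where B: "finite B" "W.basis B"
    using W.finite_basis_exists by blast
  then have sub: "B \<subseteq> carrier W"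
    by (simp add: W.basis_def)
  have *: "\<forall>v. v \<in> carrier W \<longrightarrow> (\<exists>!a. a \<in> B \<rightarrow>\<^sub>E carrier F \<and> W.lincomb a B = v)"
    using W.basis_criterion[OF B(1) sub] B(2) by blast
  have "bij_betw (\<lambda>a. W.lincomb a B) (B \<rightarrow>\<^sub>E carrier F) (carrier W)"
    unfolding bij_betw_def
  proof
    have closed: "W.lincomb a B \<in> carrier W" if "a \<in> B \<rightarrow>\<^sub>E carrier F" for a
      using that sub by (intro W.lincomb_closed) auto
    then show "inj_on (\<lambda>a. W.lincomb a B) (B \<rightarrow>\<^sub>E carrier F)"
      using * by (intro inj_onI) blast
    show "(\<lambda>a. W.lincomb a B) ` (B \<rightarrow>\<^sub>E carrier F) = carrier W"
      using * closed by blast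
  qed
  then have "card (carrier W) = card (B \<rightarrow>\<^sub>E carrier F)"
    by (simp add: bij_betw_same_card)
  then show ?thesis
    using B W.dim_basis by (simp add: card_PiE)
qed

context finite_subfield
begin

lemma card_K_ge_2: "card K \<ge> 2"
proof -
  have "card {0 :: 'a, 1} \<le> card K"
    using fin by (intro card_mono) auto
  then show ?thesis
    by simp
qed

lemma card_words:
  assumes "finite D"
  shows "card (words K D) = card K ^ card D" and "finite (words K D)"
proof -
  have bij: "bij_betw (\<lambda>w. restrict w D) (words K D) (D \<rightarrow>\<^sub>E K)"
    by (rule bij_betw_byWitness[of _ "\<lambda>g p. if p \<in> D then g p else 0"])
      (auto simp: words_def PiE_def extensional_def)
  then show "card (words K D) = card K ^ card D"
    using bij_betw_same_card[OF bij] assms by (simp add: card_PiE)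
  show "finite (words K D)"
    using bij_betw_finite[OF bij] assms fin by (simp add: finite_PiE)
qed

lemma words_sub: "v \<in> words K D \<Longrightarrow> w \<in> words K D \<Longrightarrow> (\<lambda>p. v p - w p) \<in> words K D"
  by (simp add: words_def diff_mem)

lemma words_sum: "(\<And>i. i \<in> I \<Longrightarrow> v i \<in> words K D) \<Longrightarrow> (\<And>i. i \<in> I \<Longrightarrow> c i \<in> K) \<Longrightarrow>
    (\<lambda>p. \<Sum>i\<in>I. c i * v i p) \<in> words K D"
  by (auto simp: words_def intro!: sum_mem mult_mem sum.neutral)

end

section \<open>Duality of words over a finite field\<close>

definition pairing :: "'p set \<Rightarrow> ('p \<Rightarrow> 'a::field) \<Rightarrow> ('p \<Rightarrow> 'a) \<Rightarrow> 'a" where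
  "pairing D v w = (\<Sum>p\<in>D. v p * w p)"

lemma pairing_diff: "pairing D (\<lambda>p. u p - v p) w = pairing D u w - pairing D v w"
  by (simp add: pairing_def left_diff_distrib sum_subtractf)

lemma pairing_sum: "pairing D (\<lambda>p. \<Sum>i\<in>I. c i * v i p) w = (\<Sum>i\<in>I. c i * pairing D (v i) w)"
  unfolding pairing_def by (simp add: sum_distrib_right sum_distrib_left mult.assoc) (rule sum.swap)

lemma pairing_commute: "pairing D v w = pairing D w v"
  by (simp add: pairing_def mult.commute)

text \<open>An indexed family rather than a set, so that a repeated word counts as a dependence. The
  coordinate set is a parameter because the order bound tests independence on the support of a
  single word.\<close>

definition independent_words :: "'a::field set \<Rightarrow> 'p set \<Rightarrow> 'i set \<Rightarrow> ('i \<Rightarrow> 'p \<Rightarrow> 'a) \<Rightarrow> bool" where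
  "independent_words K D I f \<longleftrightarrow> (\<forall>c. (\<forall>i\<in>I. c i \<in> K) \<longrightarrow> (\<forall>p\<in>D. (\<Sum>i\<in>I. c i * f i p) = 0) \<longrightarrow> (\<forall>i\<in>I. c i = 0))"

context finite_subfield
begin

lemma pairing_mem: "v \<in> words K D \<Longrightarrow> w \<in> words K D \<Longrightarrow> pairing D v w \<in> K"
  unfolding pairing_def words_def by (auto intro!: sum_mem mult_mem)

text \<open>Induction in the style of Gram-Schmidt. If no word, once made orthogonal to the old
  \<open>f j\<close>, paired nontrivially with the new \<open>f k\<close>, then \<open>f k\<close>
  would be a combination of the old ones.\<close>

lemma dual_system:
  assumes "finite I" "finite D" "\<And>i. i \<in> I \<Longrightarrow> f i \<in> words K D" "independent_words K D I f"
  shows "\<exists>w. \<forall>i\<in>I. w i \<in> words K D \<and> (\<forall>j\<in>I. pairing D (w i) (f j) = (if i = j then 1 else 0))"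
  using assms(1,3,4)
proof (induction I)
  case (insert k I)
  have "independent_words K D I f"
    unfolding independent_words_def
  proof (intro allI impI)
    fix c
    assume c: "\<forall>i\<in>I. c i \<in> K" "\<forall>p\<in>D. (\<Sum>i\<in>I. c i * f i p) = 0"
    let ?c = "c(k := 0)"
    have "\<forall>i\<in>insert k I. ?c i \<in> K" "\<forall>p\<in>D. (\<Sum>i\<in>insert k I. ?c i * f i p) = 0"
      using c insert.hyps by (auto intro!: sum.cong trans[OF _ bspec[OF c(2)]])
    then have "\<forall>i\<in>insert k I. ?c i = 0"
      using insert.prems(2) unfolding independent_words_def by blast
    then show "\<forall>i\<in>I. c i = 0"
      using insert.hyps by (auto split: if_splits)
  qed
  then obtain w where w: "\<And>i. i \<in> I \<Longrightarrow> w i \<in> words K D"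
    "\<And>i j. i \<in> I \<Longrightarrow> j \<in> I \<Longrightarrow> pairing D (w i) (f j) = (if i = j then 1 else 0)"
    using insert.IH insert.prems(1) by blast
  have fk: "f k \<in> words K D" "\<And>i. i \<in> I \<Longrightarrow> f i \<in> words K D"
    using insert.prems(1) by auto
  \<comment> \<open>Projection onto the words orthogonal to all \<open>f i\<close> with
    \<open>i\<close> in \<open>I\<close>, along the dual words found so far.\<close>
  define red where "red v = (\<lambda>p. v p - (\<Sum>i\<in>I. pairing D v (f i) * w i p))" for v
  have red: "red v \<in> words K D" if "v \<in> words K D" for v
    unfolding red_def by (intro words_sub words_sum that w(1) pairing_mem[OF that fk(2)])
  have red_0: "pairing D (red v) (f j) = 0" if "j \<in> I" for v j
  proof -
    have "(\<Sum>i\<in>I. pairing D v (f i) * pairing D (w i) (f j)) = (\<Sum>i\<in>I. if i = j then pairing D v (f i) else 0)"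
      using w(2) that by (intro sum.cong) auto
    then show ?thesis
      unfolding red_def pairing_diff pairing_sum using insert.hyps(1) that by simp
  qed
  have "\<exists>v\<in>words K D. pairing D (red v) (f k) \<noteq> 0"
  proof (rule ccontr)
    assume "\<not> ?thesis"
    then have *: "pairing D v (f k) = (\<Sum>i\<in>I. pairing D v (f i) * pairing D (w i) (f k))" if "v \<in> words K D" for v
      using that unfolding red_def pairing_diff pairing_sum by simp
    define c where "c i = (if i = k then 1 else - pairing D (w i) (f k))" for i
    have "(\<Sum>i\<in>insert k I. c i * f i p) = 0" if "p \<in> D" for p
    proof -
      \<comment> \<open>Pairing with a unit word reads off one coordinate, so the identity for all
        words becomes a linear relation between the \<open>f i\<close> at every
        \<open>p\<close>.\<close>
      define v where "v = (\<lambda>p'. if p' = p then 1 else 0 :: 'a)"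
      have v: "v \<in> words K D"
        using that by (auto simp: v_def words_def)
      have pv: "pairing D v u = u p" for u
      proof -
        have "pairing D v u = (\<Sum>p'\<in>D. if p' = p then u p' else 0)"
          unfolding pairing_def v_def by (intro sum.cong) auto
        then show ?thesis
          using assms(2) that by simp
      qed
      have "(\<Sum>i\<in>insert k I. c i * f i p) = f k p + (\<Sum>i\<in>I. - (f i p * pairing D (w i) (f k)))"
        using insert.hyps by (auto simp: c_def intro!: sum.cong)
      also have "\<dots> = 0"
        using *[OF v] unfolding pv by (simp add: sum_negf)
      finally show ?thesis .
    qed
    moreover have "\<forall>i\<in>insert k I. c i \<in> K"
      unfolding c_def by (auto intro: uminus_mem pairing_mem[OF w(1) fk(1)])
    ultimately have "c k = 0"
      using insert.prems(2) unfolding independent_words_def by blast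
    then show False
      by (simp add: c_def)
  qed
  then obtain v where v: "v \<in> words K D" "pairing D (red v) (f k) \<noteq> 0"
    by blast
  define u where "u = (\<lambda>p. inverse (pairing D (red v) (f k)) * red v p)"
  have pu: "pairing D u x = inverse (pairing D (red v) (f k)) * pairing D (red v) x" for x
    unfolding u_def pairing_def by (simp add: sum_distrib_left mult.assoc)
  have u: "u \<in> words K D"
    using red[OF v(1)] inverse_mem[OF pairing_mem[OF red[OF v(1)] fk(1)]]
    by (auto simp: u_def words_def mult_mem)
  have u_k: "pairing D u (f k) = 1" and u_j: "\<And>j. j \<in> I \<Longrightarrow> pairing D u (f j) = 0"
    unfolding pu using v(2) red_0 by simp_all
  \<comment> \<open>The old dual words are corrected by multiples of \<open>u\<close> to become
    orthogonal to \<open>f k\<close>.\<close>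
  define w' where "w' i = (if i = k then u else (\<lambda>p. w i p - pairing D (w i) (f k) * u p))" for i
  have w'_pair: "pairing D (\<lambda>p. w i p - pairing D (w i) (f k) * u p) x =
      pairing D (w i) x - pairing D (w i) (f k) * pairing D u x" for i x
    unfolding pairing_diff by (simp add: pairing_def sum_distrib_left mult.assoc)
  have W1: "\<forall>i\<in>insert k I. w' i \<in> words K D"
    unfolding w'_def using u w(1) pairing_mem[OF _ fk(1)] by (auto simp: words_def diff_mem mult_mem)
  have W2: "\<forall>i\<in>insert k I. \<forall>j\<in>insert k I. pairing D (w' i) (f j) = (if i = j then 1 else 0)"
    unfolding w'_def using w(2) u_k u_j insert.hyps(2) by (auto simp: w'_pair)
  show ?case
    by (intro exI[of _ w'] ballI conjI bspec[OF W1] bspec[OF bspec[OF W2]])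
qed simp

definition annihilator :: "'p set \<Rightarrow> 'i set \<Rightarrow> ('i \<Rightarrow> 'p \<Rightarrow> 'a) \<Rightarrow> ('p \<Rightarrow> 'a) set" where
  "annihilator D I f = {w \<in> words K D. \<forall>i\<in>I. pairing D w (f i) = 0}"

text \<open>Every word splits uniquely into an element of the annihilator and a combination of dual
  words with coefficients in \<open>K\<close>, the coefficients being its pairings with the
  \<open>f i\<close>.\<close>

lemma card_annihilator:
  assumes fin_I: "finite I" and fin_D: "finite D" and f: "\<And>i. i \<in> I \<Longrightarrow> f i \<in> words K D"
    and ind: "independent_words K D I f"
  shows "card (annihilator D I f) * card K ^ card I = card K ^ card D"
proof -
  obtain w where w: "\<And>i. i \<in> I \<Longrightarrow> w i \<in> words K D"
    "\<And>i j. i \<in> I \<Longrightarrow> j \<in> I \<Longrightarrow> pairing D (w i) (f j) = (if i = j then 1 else 0)"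
    using dual_system[OF assms] by blast
  define S where "S c = (\<lambda>p. \<Sum>i\<in>I. c i * w i p)" for c
  have S: "S c \<in> words K D" if "\<And>i. i \<in> I \<Longrightarrow> c i \<in> K" for c
    unfolding S_def using that w(1) by (intro words_sum)
  have S_pair: "pairing D (S c) (f j) = c j" if "j \<in> I" for c j
  proof -
    have "pairing D (S c) (f j) = (\<Sum>i\<in>I. if i = j then c i else 0)"
      unfolding S_def pairing_sum using w(2) that by (intro sum.cong) auto
    then show ?thesis
      using that fin_I by simp
  qed
  have add_pair: "pairing D (\<lambda>p. u p + v p) x = pairing D u x + pairing D v x" for u v x
    by (simp add: pairing_def distrib_right sum.distrib)
  have S_cong: "S c = S c'" if "\<And>i. i \<in> I \<Longrightarrow> c i = c' i" for c c'
    unfolding S_def using that by (intro ext sum.cong) auto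
  have "bij_betw (\<lambda>(v, c) p. v p + S c p) (annihilator D I f \<times> (I \<rightarrow>\<^sub>E K)) (words K D)"
  proof (rule bij_betw_byWitness[of _ "\<lambda>u. (\<lambda>p. u p - S (\<lambda>i. pairing D u (f i)) p, restrict (\<lambda>i. pairing D u (f i)) I)"])
    show "\<forall>vc\<in>annihilator D I f \<times> (I \<rightarrow>\<^sub>E K).
        (\<lambda>u. (\<lambda>p. u p - S (\<lambda>i. pairing D u (f i)) p, restrict (\<lambda>i. pairing D u (f i)) I))
          ((\<lambda>(v, c) p. v p + S c p) vc) = vc"
    proof
      fix vc
      assume "vc \<in> annihilator D I f \<times> (I \<rightarrow>\<^sub>E K)"
      then obtain v c where vc: "vc = (v, c)" and v: "v \<in> annihilator D I f" and c: "c \<in> I \<rightarrow>\<^sub>E K"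
        by blast
      have *: "pairing D (\<lambda>p. v p + S c p) (f i) = c i" if "i \<in> I" for i
        unfolding add_pair S_pair[OF that] using v that by (simp add: annihilator_def)
      have "restrict (\<lambda>i. pairing D (\<lambda>p. v p + S c p) (f i)) I = c"
        using c * by (auto simp: fun_eq_iff PiE_def extensional_def restrict_def)
      moreover have "S (\<lambda>i. pairing D (\<lambda>p. v p + S c p) (f i)) = S c"
        using * by (rule S_cong)
      ultimately show "(\<lambda>u. (\<lambda>p. u p - S (\<lambda>i. pairing D u (f i)) p, restrict (\<lambda>i. pairing D u (f i)) I))
          ((\<lambda>(v, c) p. v p + S c p) vc) = vc"
        unfolding vc by simp
    qed
    show "\<forall>u\<in>words K D. (\<lambda>(v, c) p. v p + S c p)
        (\<lambda>p. u p - S (\<lambda>i. pairing D u (f i)) p, restrict (\<lambda>i. pairing D u (f i)) I) = u"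
    proof
      fix u
      have "S (restrict (\<lambda>i. pairing D u (f i)) I) = S (\<lambda>i. pairing D u (f i))"
        by (rule S_cong) simp
      then show "(\<lambda>(v, c) p. v p + S c p)
        (\<lambda>p. u p - S (\<lambda>i. pairing D u (f i)) p, restrict (\<lambda>i. pairing D u (f i)) I) = u"
        by simp
    qed
    show "(\<lambda>(v, c) p. v p + S c p) ` (annihilator D I f \<times> (I \<rightarrow>\<^sub>E K)) \<subseteq> words K D"
    proof clarify
      fix v c
      assume "v \<in> annihilator D I f" "c \<in> I \<rightarrow>\<^sub>E K"
      then have "v \<in> words K D" "S c \<in> words K D"
        using S[of c] by (auto simp: annihilator_def)
      then show "(\<lambda>p. v p + S c p) \<in> words K D"
        by (simp add: words_def add_mem)
    qed
    show "(\<lambda>u. (\<lambda>p. u p - S (\<lambda>i. pairing D u (f i)) p, restrict (\<lambda>i. pairing D u (f i)) I)) ` words K D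
        \<subseteq> annihilator D I f \<times> (I \<rightarrow>\<^sub>E K)"
    proof (rule image_subsetI)
      fix u
      assume u: "u \<in> words K D"
      have K: "pairing D u (f i) \<in> K" if "i \<in> I" for i
        using pairing_mem u f that by blast
      have "(\<lambda>p. u p - S (\<lambda>i. pairing D u (f i)) p) \<in> annihilator D I f"
        unfolding annihilator_def using words_sub[OF u S] K S_pair by (simp add: pairing_diff)
      then show "(\<lambda>p. u p - S (\<lambda>i. pairing D u (f i)) p, restrict (\<lambda>i. pairing D u (f i)) I)
          \<in> annihilator D I f \<times> (I \<rightarrow>\<^sub>E K)"
        using K by auto
    qed
  qed
  from bij_betw_same_card[OF this] show ?thesis
    using card_words[OF fin_D] fin_I by (simp add: card_cartesian_product card_PiE)
qed

lemma annihilator_subspace: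
  assumes "subfield K ring_of_type_algebra" and f: "\<And>i. i \<in> I \<Longrightarrow> f i \<in> words K D"
  shows "subspace (scalars K) (annihilator D I f) (word_space K D)"
proof -
  have vs: "vectorspace (scalars K) (word_space K D)"
    by (rule vectorspace_word_space[OF assms(1)])
  then have "module (scalars K) (word_space K D)"
    by (simp add: vectorspace_def)
  then have "submodule (scalars K) (annihilator D I f) (word_space K D)"
    by (rule submodule.intro)
      (auto simp: annihilator_def words_def add_mem mult_mem pairing_def distrib_right sum.distrib
        mult.assoc sum_distrib_left[symmetric])
  then show ?thesis
    using vs by (simp add: subspace_def)
qed

lemma dim_annihilator:
  assumes "subfield K ring_of_type_algebra"
    and "finite I" "finite D" "\<And>i. i \<in> I \<Longrightarrow> f i \<in> words K D" "independent_words K D I f"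
  shows "code_dim K D (annihilator D I f) + card I = card D"
proof -
  let ?V = "word_space K D\<lparr>carrier := annihilator D I f\<rparr>"
  have finite_K: "finite K"
    by (rule fin)
  interpret vectorspace "scalars K" "word_space K D"
    by (rule vectorspace_word_space[OF assms(1)])
  have "vectorspace (scalars K) ?V"
    using annihilator_subspace[OF assms(1,4)] by (rule subspace_is_vs)
  moreover have "finite (annihilator D I f)"
    using card_words(2)[OF assms(3)] by (simp add: annihilator_def)
  ultimately have "card (annihilator D I f) = card K ^ code_dim K D (annihilator D I f)"
    using card_vectorspace[of "scalars K" ?V] finite_K by (simp add: code_dim_def)
  then have "card K ^ (code_dim K D (annihilator D I f) + card I) = card K ^ card D"
    using card_annihilator[OF assms(2-5)] by (simp add: power_add)
  then show ?thesis
    using card_K_ge_2 by (simp add: power_inject_exp)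
qed

text \<open>Pigeonhole: the words supported on \<open>card I + 1\<close> coordinates outnumber the
  possible tuples of pairings, and the difference of two words with equal tuples is orthogonal to
  all \<open>f i\<close>. This is the Singleton bound, needed for the defect to be
  nonnegative.\<close>

lemma exists_small_weight:
  assumes "finite I" "finite D" "\<And>i. i \<in> I \<Longrightarrow> f i \<in> words K D" "card I < card D"
  shows "\<exists>w\<in>annihilator D I f. w \<noteq> (\<lambda>p. 0) \<and> card {p \<in> D. w p \<noteq> 0} \<le> card I + 1"
proof -
  obtain T where T: "T \<subseteq> D" "card T = card I + 1"
    using assms(4) by (metis Suc_eq_plus1 Suc_leI obtain_subset_with_card_n)
  then have fin_T: "finite T"
    using assms(2) finite_subset by blast
  define \<phi> where "\<phi> w = restrict (\<lambda>i. pairing D w (f i)) I" for w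
  have TD: "w \<in> words K D" if "w \<in> words K T" for w
    using that T(1) zero_mem by (auto simp: words_def)
  have "\<phi> ` words K T \<subseteq> I \<rightarrow>\<^sub>E K"
    using pairing_mem[OF TD assms(3)] by (auto simp: \<phi>_def)
  then have "card (\<phi> ` words K T) \<le> card (I \<rightarrow>\<^sub>E K)"
    using assms(1) fin by (intro card_mono finite_PiE) auto
  also have "\<dots> < card (words K T)"
    using card_words(1)[OF fin_T] T(2) assms(1) card_K_ge_2 by (simp add: card_PiE)
  finally have "\<not> inj_on \<phi> (words K T)"
    using card_image by fastforce
  then obtain u v where uv: "u \<in> words K T" "v \<in> words K T" "u \<noteq> v" "\<phi> u = \<phi> v"
    unfolding inj_on_def by blast
  define w where "w = (\<lambda>p. u p - v p)"
  have w: "w \<in> words K T"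
    unfolding w_def using words_sub uv by blast
  have "pairing D u (f i) = pairing D v (f i)" if "i \<in> I" for i
    using fun_cong[OF uv(4), of i] that by (simp add: \<phi>_def)
  then have "w \<in> annihilator D I f"
    using TD[OF w] by (simp add: annihilator_def w_def pairing_diff)
  moreover have "w \<noteq> (\<lambda>p. 0)"
    using uv(3) by (auto simp: w_def fun_eq_iff)
  moreover have "card {p \<in> D. w p \<noteq> 0} \<le> card T"
    using w fin_T by (intro card_mono) (auto simp: words_def)
  ultimately show ?thesis
    using T(2) by auto
qed

text \<open>Independence makes the map from coefficient tuples to words on \<open>T\<close>
  injective; the inequality is that of the exponents of \<open>card K\<close>.\<close>

lemma independent_words_card_le:
  assumes "finite I" "finite T" "\<And>i p. i \<in> I \<Longrightarrow> p \<in> T \<Longrightarrow> f i p \<in> K" "independent_words K T I f"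
  shows "card I \<le> card T"
proof -
  define \<phi> where "\<phi> c = restrict (\<lambda>p. \<Sum>i\<in>I. c i * f i p) T" for c
  have "inj_on \<phi> (I \<rightarrow>\<^sub>E K)"
  proof (rule inj_onI)
    fix c d
    assume cd: "c \<in> I \<rightarrow>\<^sub>E K" "d \<in> I \<rightarrow>\<^sub>E K" "\<phi> c = \<phi> d"
    have "(\<Sum>i\<in>I. (c i - d i) * f i p) = 0" if "p \<in> T" for p
      using fun_cong[OF cd(3), of p] that by (simp add: \<phi>_def left_diff_distrib sum_subtractf)
    moreover have "\<forall>i\<in>I. c i - d i \<in> K"
      using cd by (auto intro!: diff_mem)
    ultimately have "\<forall>i\<in>I. c i - d i = 0"
      using assms(4)[unfolded independent_words_def, rule_format, of "\<lambda>i. c i - d i"] by blast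
    then show "c = d"
      using PiE_ext[OF cd(1,2)] by simp
  qed
  moreover have "\<phi> ` (I \<rightarrow>\<^sub>E K) \<subseteq> T \<rightarrow>\<^sub>E K"
    using assms(3) by (auto simp: \<phi>_def intro!: sum_mem mult_mem)
  ultimately have "card (I \<rightarrow>\<^sub>E K) \<le> card (T \<rightarrow>\<^sub>E K)"
    using assms(2) fin by (intro card_inj_on_le[of \<phi>] finite_PiE) auto
  then show ?thesis
    using assms(1,2) card_K_ge_2 by (simp add: card_PiE power_increasing_iff)
qed

end

text \<open>What the order bound needs from the curve: \<open>R\<close> stands for the functions
  regular outside \<open>P\<close>, \<open>ord\<close> for the pole order at \<open>P\<close>.
  \<open>ord_lead\<close> says that functions of equal order agree to leading order up to a
  constant; \<open>ev_sep\<close> makes every nonzero word detectable by some function. Nothing is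
  required of \<open>ord 0\<close>.\<close>

locale order_code = finite_subfield K + R: subring_set R
  for K R :: "'a::field set" +
  fixes D :: "'p set" and ev :: "'p \<Rightarrow> 'a \<Rightarrow> 'a" and ord :: "'a \<Rightarrow> nat"
  assumes fin_D: "finite D" and K_R: "K \<subseteq> R"
    and ev_K: "\<lbrakk>p \<in> D; f \<in> R\<rbrakk> \<Longrightarrow> ev p f \<in> K"
    and ev_add: "\<lbrakk>p \<in> D; f \<in> R; g \<in> R\<rbrakk> \<Longrightarrow> ev p (f + g) = ev p f + ev p g"
    and ev_mult: "\<lbrakk>p \<in> D; f \<in> R; g \<in> R\<rbrakk> \<Longrightarrow> ev p (f * g) = ev p f * ev p g"
    and ev_const: "\<lbrakk>p \<in> D; c \<in> K\<rbrakk> \<Longrightarrow> ev p c = c"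
    and ev_sep: "p \<in> D \<Longrightarrow> \<exists>f\<in>R. ev p f = 1 \<and> (\<forall>p'\<in>D - {p}. ev p' f = 0)"
    and ord_mult: "\<lbrakk>f \<in> R - {0}; g \<in> R - {0}\<rbrakk> \<Longrightarrow> ord (f * g) = ord f + ord g"
    and ord_add: "\<lbrakk>f \<in> R - {0}; g \<in> R - {0}; f + g \<noteq> 0\<rbrakk> \<Longrightarrow> ord (f + g) \<le> max (ord f) (ord g)"
    and ord_const: "c \<in> K - {0} \<Longrightarrow> ord c = 0"
    and ord_lead: "\<lbrakk>f \<in> R - {0}; g \<in> R - {0}; ord f = ord g\<rbrakk> \<Longrightarrow>
      \<exists>k\<in>K - {0}. f - k * g = 0 \<or> ord (f - k * g) < ord f"
begin

definition L :: "nat \<Rightarrow> 'a set" where "L r = {f \<in> R. f = 0 \<or> ord f \<le> r}"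

definition orders :: "nat set" where "orders = ord ` (R - {0})"

definition of_order :: "nat \<Rightarrow> 'a" where "of_order s = (SOME f. f \<in> R - {0} \<and> ord f = s)"

definition ev_word :: "'a \<Rightarrow> 'p \<Rightarrow> 'a" where "ev_word f p = (if p \<in> D then ev p f else 0)"

definition dual_order_code :: "nat \<Rightarrow> ('p \<Rightarrow> 'a) set" where
  "dual_order_code r = {w \<in> words K D. \<forall>f\<in>L r. pairing D w (ev_word f) = 0}"

lemma of_order:
  assumes "s \<in> orders"
  shows "of_order s \<in> R" "of_order s \<noteq> 0" "ord (of_order s) = s"
proof -
  have "\<exists>f. f \<in> R - {0} \<and> ord f = s"
    using assms by (auto simp: orders_def)
  from someI_ex[OF this] show "of_order s \<in> R" "of_order s \<noteq> 0" "ord (of_order s) = s"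
    by (simp_all add: of_order_def)
qed

lemma ev_0: "p \<in> D \<Longrightarrow> ev p 0 = 0"
  using ev_const zero_mem by blast

lemma ev_sum: "p \<in> D \<Longrightarrow> (\<And>i. i \<in> I \<Longrightarrow> f i \<in> R) \<Longrightarrow> ev p (sum f I) = (\<Sum>i\<in>I. ev p (f i))"
  by (induction I rule: infinite_finite_induct) (auto simp: ev_0 ev_add R.sum_mem)

lemma ev_scale: "p \<in> D \<Longrightarrow> c \<in> K \<Longrightarrow> f \<in> R \<Longrightarrow> ev p (c * f) = c * ev p f"
  using ev_mult ev_const K_R by (simp add: subset_iff)

lemma ev_word_mem: "f \<in> R \<Longrightarrow> ev_word f \<in> words K D"
  by (simp add: ev_word_def words_def ev_K)

lemma pairing_ev_sum:
  assumes "\<And>i. i \<in> I \<Longrightarrow> f i \<in> R" "\<And>i. i \<in> I \<Longrightarrow> c i \<in> K"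
  shows "pairing D w (ev_word (\<Sum>i\<in>I. c i * f i)) = (\<Sum>i\<in>I. c i * pairing D w (ev_word (f i)))"
proof -
  have "pairing D w (ev_word (\<Sum>i\<in>I. c i * f i)) = pairing D (\<lambda>p. \<Sum>i\<in>I. c i * ev_word (f i) p) w"
    unfolding pairing_commute[of D w] pairing_def
    using assms K_R by (intro sum.cong) (auto simp: ev_word_def ev_sum ev_scale R.mult_mem subset_iff)
  then show ?thesis
    unfolding pairing_sum pairing_commute[of D w] .
qed

lemma pairing_ev_add_scale:
  assumes "f \<in> R" "g \<in> R" "c \<in> K"
  shows "pairing D w (ev_word (f + c * g)) = pairing D w (ev_word f) + c * pairing D w (ev_word g)"
  using pairing_ev_sum[of "{0, 1 :: nat}" "\<lambda>i. if i = 0 then f else g" "\<lambda>i. if i = 0 then 1 else c"] assms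
  by simp

lemma scale_order:
  assumes "c \<in> K - {0}" "f \<in> R - {0}"
  shows "c * f \<in> R - {0}" "ord (c * f) = ord f"
  using assms K_R R.mult_mem ord_mult[of c f] ord_const[of c] by auto

text \<open>Subtracting the right multiple of \<open>of_order (ord f)\<close> lowers the order, so
  one function for each order up to \<open>r\<close> spans \<open>L r\<close>.\<close>

lemma decompose:
  assumes "f \<in> R" "f \<noteq> 0" "ord f \<le> r"
  shows "\<exists>c. (\<forall>s. c s \<in> K) \<and> f = (\<Sum>s\<in>orders \<inter> {..r}. c s * of_order s)"
  using assms
proof (induction "ord f" arbitrary: f rule: less_induct)
  case less
  define g where "g = of_order (ord f)"
  have s: "ord f \<in> orders"
    using less.prems by (auto simp: orders_def)
  have g: "g \<in> R - {0}" "ord f = ord g"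
    using of_order[OF s] by (simp_all add: g_def)
  obtain k where k: "k \<in> K - {0}" "f - k * g = 0 \<or> ord (f - k * g) < ord f"
    using ord_lead[of f g] less.prems g by blast
  have mem: "f - k * g \<in> R"
    using less.prems(1) g(1) k(1) K_R by (intro R.diff_mem R.mult_mem) auto
  have "\<exists>c. (\<forall>s. c s \<in> K) \<and> f - k * g = (\<Sum>s\<in>orders \<inter> {..r}. c s * of_order s)"
  proof (cases "f - k * g = 0")
    case True
    then show ?thesis
      by (intro exI[of _ "\<lambda>_. 0"]) simp
  next
    case False
    then show ?thesis
      using less.hyps[of "f - k * g"] mem k(2) less.prems(3) by simp
  qed
  then obtain c where c: "\<And>s. c s \<in> K" "f - k * g = (\<Sum>s\<in>orders \<inter> {..r}. c s * of_order s)"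
    by blast
  define c' where "c' s = c s + (if s = ord f then k else 0)" for s
  have "(\<Sum>s\<in>orders \<inter> {..r}. c' s * of_order s) =
      (\<Sum>s\<in>orders \<inter> {..r}. c s * of_order s) + (\<Sum>s\<in>orders \<inter> {..r}. if s = ord f then k * g else 0)"
    unfolding c'_def sum.distrib[symmetric] by (intro sum.cong) (auto simp: distrib_right g_def)
  also have "(\<Sum>s\<in>orders \<inter> {..r}. if s = ord f then k * g else 0) = k * g"
    using s less.prems(3) by (simp add: sum.delta)
  finally have "f = (\<Sum>s\<in>orders \<inter> {..r}. c' s * of_order s)"
    unfolding c(2)[symmetric] by simp
  moreover have "c' s \<in> K" for s
    using c(1)[of s] k(1) by (auto simp: c'_def intro: add_mem)
  ultimately show ?case
    by blast
qed

lemma order_sum_less: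
  assumes "finite T" "\<And>s. s \<in> T \<Longrightarrow> s \<in> orders \<and> s < i" "\<And>s. s \<in> T \<Longrightarrow> c s \<in> K"
  shows "(\<Sum>s\<in>T. c s * of_order s) = 0 \<or> ord (\<Sum>s\<in>T. c s * of_order s) < i"
  using assms
proof (induction T)
  case (insert t T)
  let ?x = "c t * of_order t" and ?y = "\<Sum>s\<in>T. c s * of_order s"
  have y: "?y = 0 \<or> ord ?y < i"
    using insert by simp
  have t: "of_order t \<in> R - {0}" "ord (of_order t) < i" "c t \<in> K"
    using of_order[of t] insert.prems by auto
  have yR: "?y \<in> R"
    using insert.prems of_order K_R by (intro R.sum_mem R.mult_mem) auto
  show ?case
  proof (cases "c t = 0")
    case True
    then show ?thesis
      using y insert.hyps by simp
  next
    case False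
    then have x: "?x \<in> R - {0}" "ord ?x < i"
      using scale_order[of "c t" "of_order t"] t by auto
    then show ?thesis
      using ord_add[of ?x ?y] y yR insert.hyps by (cases "?y = 0"; cases "?x + ?y = 0") auto
  qed
qed simp

text \<open>The term of largest order with nonzero coefficient cannot be cancelled by the others,
  whose sum has smaller order or is zero.\<close>

lemma independent_of_order:
  assumes "finite T" "T \<subseteq> orders" "\<And>s. s \<in> T \<Longrightarrow> c s \<in> K" "(\<Sum>s\<in>T. c s * of_order s) = 0" "s \<in> T"
  shows "c s = 0"
proof (rule ccontr)
  assume "c s \<noteq> 0"
  define N where "N = {s \<in> T. c s \<noteq> 0}"
  define i where "i = Max N"
  have N: "finite N" "N \<noteq> {}"
    using assms(1,5) \<open>c s \<noteq> 0\<close> by (auto simp: N_def)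
  then have i: "i \<in> T" "c i \<noteq> 0" and max: "\<And>s. s \<in> N \<Longrightarrow> s \<le> i"
    using Max_in[OF N] Max_ge[OF N(1)] by (auto simp: i_def N_def)
  have "(\<Sum>s\<in>T. c s * of_order s) = (\<Sum>s\<in>N. c s * of_order s)"
    using assms(1) by (intro sum.mono_neutral_right) (auto simp: N_def)
  also have "\<dots> = c i * of_order i + (\<Sum>s\<in>N - {i}. c s * of_order s)"
    using N i by (intro sum.remove) (auto simp: N_def)
  finally have eq: "c i * of_order i = (\<Sum>s\<in>N - {i}. - c s * of_order s)"
    using assms(4) by (simp add: sum_negf eq_neg_iff_add_eq_0)
  have "(\<Sum>s\<in>N - {i}. - c s * of_order s) = 0 \<or> ord (\<Sum>s\<in>N - {i}. - c s * of_order s) < i"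
  proof (rule order_sum_less)
    show "s \<in> orders \<and> s < i" if "s \<in> N - {i}" for s
      using that assms(2) max[of s] by (auto simp: N_def)
    show "- c s \<in> K" if "s \<in> N - {i}" for s
      using that assms(3) uminus_mem by (auto simp: N_def)
  qed (use N in simp)
  moreover have "c i * of_order i \<noteq> 0" "ord (c i * of_order i) = i"
    using scale_order[of "c i" "of_order i"] of_order[of i] i assms(2,3) by auto
  ultimately show False
    unfolding eq[symmetric] by simp
qed

lemma dual_order_code_eq_annihilator:
  "dual_order_code r = annihilator D (orders \<inter> {..r}) (\<lambda>s. ev_word (of_order s))"
proof -
  have "pairing D w (ev_word f) = 0"
    if w: "\<forall>s\<in>orders \<inter> {..r}. pairing D w (ev_word (of_order s)) = 0" and f: "f \<in> L r" for w f
  proof (cases "f = 0")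
    case True
    then show ?thesis
      by (auto simp: pairing_def ev_word_def ev_0 intro!: sum.neutral)
  next
    case False
    then obtain c where c: "\<forall>s. c s \<in> K" "f = (\<Sum>s\<in>orders \<inter> {..r}. c s * of_order s)"
      using decompose[of f r] f by (auto simp: L_def)
    have "pairing D w (ev_word f) = (\<Sum>s\<in>orders \<inter> {..r}. c s * pairing D w (ev_word (of_order s)))"
      unfolding c(2) using c(1) of_order by (intro pairing_ev_sum) auto
    then show ?thesis
      using w by simp
  qed
  moreover have "of_order s \<in> L r" if "s \<in> orders \<inter> {..r}" for s
    using that of_order by (simp add: L_def)
  ultimately show ?thesis
    unfolding dual_order_code_def annihilator_def by blast
qed

text \<open>The hypothesis is injectivity of evaluation on \<open>L r\<close>; it carries the
  independence of functions over to their words.\<close>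

lemma independent_ev_words:
  assumes "\<And>f. f \<in> L r \<Longrightarrow> (\<forall>p\<in>D. ev p f = 0) \<Longrightarrow> f = 0"
  shows "independent_words K D (orders \<inter> {..r}) (\<lambda>s. ev_word (of_order s))"
  unfolding independent_words_def
proof (intro allI impI ballI)
  fix c s
  assume c: "\<forall>i\<in>orders \<inter> {..r}. c i \<in> K"
    "\<forall>p\<in>D. (\<Sum>i\<in>orders \<inter> {..r}. c i * ev_word (of_order i) p) = 0" and s: "s \<in> orders \<inter> {..r}"
  let ?f = "\<Sum>i\<in>orders \<inter> {..r}. c i * of_order i"
  have R: "c i * of_order i \<in> R" if "i \<in> orders \<inter> {..r}" for i
    using that c(1) of_order K_R R.mult_mem by blast
  have "?f = 0 \<or> ord ?f < Suc r"
    using c(1) by (intro order_sum_less) auto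
  then have "?f \<in> L r"
    using R.sum_mem[of "orders \<inter> {..r}" "\<lambda>i. c i * of_order i"] R by (auto simp: L_def)
  moreover have "ev p ?f = 0" if "p \<in> D" for p
  proof -
    have "ev p ?f = (\<Sum>i\<in>orders \<inter> {..r}. ev p (c i * of_order i))"
      using that R by (intro ev_sum)
    also have "\<dots> = (\<Sum>i\<in>orders \<inter> {..r}. c i * ev_word (of_order i) p)"
      using that c(1) of_order
      by (intro sum.cong) (auto simp: ev_scale ev_word_def)
    finally show ?thesis
      using c(2) that by simp
  qed
  ultimately have "?f = 0"
    using assms by blast
  then show "c s = 0"
    using independent_of_order[of "orders \<inter> {..r}" c s] c(1) s by auto
qed

text \<open>The order bound: the evaluations at the support of \<open>w\<close> of functions \<open>f\<^sub>a\<close> with \<open>a\<close> and \<open>s - a\<close> in the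
  semigroup are independent, since the matrix of pairings of \<open>w\<close> with \<open>f\<^sub>a * f\<^sub>b\<close> is triangular.\<close>

lemma feng_rao_bound:
  assumes w: "w \<in> dual_order_code r" "w \<noteq> (\<lambda>p. 0)"
  shows "\<exists>s>r. summand_count orders s \<le> card {p \<in> D. w p \<noteq> 0}"
proof -
  have wK: "w \<in> words K D"
    using w(1) by (simp add: dual_order_code_def)
  define P where "P s \<longleftrightarrow> (\<exists>f\<in>R - {0}. ord f = s \<and> pairing D w (ev_word f) \<noteq> 0)" for s
  obtain p where p: "p \<in> D" "w p \<noteq> 0"
    using w(2) wK by (auto simp: words_def fun_eq_iff)
  \<comment> \<open>A function separating a point \<open>p\<close> of the support pairs with
    \<open>w\<close> to \<open>w p\<close>, so some order fails to be orthogonal and a least one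
    exists.\<close>
  obtain f where f: "f \<in> R" "ev p f = 1" "\<And>p'. p' \<in> D - {p} \<Longrightarrow> ev p' f = 0"
    using ev_sep[OF p(1)] by blast
  have "pairing D w (ev_word f) = (\<Sum>p'\<in>D. if p' = p then w p else 0)"
    unfolding pairing_def ev_word_def using f by (intro sum.cong) auto
  then have "pairing D w (ev_word f) \<noteq> 0"
    using p fin_D by simp
  moreover have "f \<noteq> 0"
    using f(2) ev_0 p(1) by auto
  ultimately have "P (ord f)"
    unfolding P_def using f(1) by blast
  \<comment> \<open>By minimality \<open>w\<close> is orthogonal to everything of order below
    \<open>s\<close>; by \<open>ord_lead\<close> it then pairs nontrivially with every function of
    order exactly \<open>s\<close>. Membership in the dual code puts \<open>s\<close> above
    \<open>r\<close>.\<close>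
  define s where "s = (LEAST s. P s)"
  have "P s"
    unfolding s_def using \<open>P (ord f)\<close> by (rule LeastI)
  then obtain f0 where f0: "f0 \<in> R - {0}" "ord f0 = s" "pairing D w (ev_word f0) \<noteq> 0"
    unfolding P_def by blast
  have low: "pairing D w (ev_word g) = 0" if "g \<in> R" "g = 0 \<or> ord g < s" for g
  proof (cases "g = 0")
    case True
    then show ?thesis
      by (auto simp: pairing_def ev_word_def ev_0 intro!: sum.neutral)
  next
    case False
    then show ?thesis
      using that not_less_Least[of "ord g" P] unfolding P_def s_def by blast
  qed
  have top: "pairing D w (ev_word h) \<noteq> 0" if h: "h \<in> R - {0}" "ord h = s" for h
  proof -
    obtain k where k: "k \<in> K - {0}" "h - k * f0 = 0 \<or> ord (h - k * f0) < s"
      using ord_lead[of h f0] h f0 by auto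
    have mem: "h - k * f0 \<in> R"
      using h f0 k K_R by (intro R.diff_mem R.mult_mem) auto
    have "pairing D w (ev_word ((h - k * f0) + k * f0)) = pairing D w (ev_word (h - k * f0)) + k * pairing D w (ev_word f0)"
      using mem f0 k by (intro pairing_ev_add_scale) auto
    then show ?thesis
      using low[OF mem k(2)] f0 k by simp
  qed
  have "s > r"
  proof (rule ccontr)
    assume "\<not> s > r"
    then have "f0 \<in> L r"
      using f0 by (simp add: L_def)
    then show False
      using w(1) f0(3) by (simp add: dual_order_code_def)
  qed
  define A where "A = {a \<in> orders. a \<le> s \<and> s - a \<in> orders}"
  define T where "T = {p \<in> D. w p \<noteq> 0}"
  have fin_A: "finite A"
    by (rule finite_subset[of _ "{..s}"]) (auto simp: A_def)
  have A: "a \<in> orders" "s - a \<in> orders" "a \<le> s" if "a \<in> A" for a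
    using that by (auto simp: A_def)
  have "independent_words K T A (\<lambda>a p. ev p (of_order a))"
    unfolding independent_words_def
  proof (intro allI impI, rule ccontr)
    fix c
    assume c: "\<forall>a\<in>A. c a \<in> K" "\<forall>p\<in>T. (\<Sum>a\<in>A. c a * ev p (of_order a)) = 0"
      and nz: "\<not> (\<forall>a\<in>A. c a = 0)"
    define N where "N = {a \<in> A. c a \<noteq> 0}"
    define i where "i = Max N"
    have N: "finite N" "N \<noteq> {}"
      using fin_A nz by (auto simp: N_def)
    then have i: "i \<in> A" "c i \<noteq> 0" and max: "\<And>a. a \<in> N \<Longrightarrow> a \<le> i"
      using Max_in[OF N] Max_ge[OF N(1)] by (auto simp: i_def N_def)
    \<comment> \<open>Multiplying a supposed relation by \<open>h\<close> gives the
      \<open>i\<close>-th term order exactly \<open>s\<close>, while the other terms with nonzero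
      coefficient have order below \<open>s\<close> and pair to zero.\<close>
    define h where "h = of_order (s - i)"
    have h: "h \<in> R - {0}" "ord h = s - i"
      using of_order[OF A(2)[OF i(1)]] by (simp_all add: h_def)
    have fa: "of_order a \<in> R - {0}" "ord (of_order a) = a" if "a \<in> A" for a
      using of_order[OF A(1)[OF that]] by simp_all
    have prod: "of_order a * h \<in> R - {0}" "ord (of_order a * h) = a + (s - i)" if "a \<in> A" for a
      using fa[OF that] h ord_mult[of "of_order a" h] R.mult_mem by auto
    have vanish: "c a * pairing D w (ev_word (of_order a * h)) = 0" if a: "a \<in> A - {i}" for a
    proof (cases "c a = 0")
      case False
      then have "a < i"
        using a max[of a] by (force simp: N_def)
      then have "ord (of_order a * h) < s"
        using prod[of a] a A(3)[OF i(1)] by simp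
      then show ?thesis
        using low prod[of a] a by simp
    qed simp
    have "(\<Sum>a\<in>A. c a * pairing D w (ev_word (of_order a * h))) = pairing D w (ev_word (\<Sum>a\<in>A. c a * (of_order a * h)))"
      using c(1) prod by (intro pairing_ev_sum[symmetric]) auto
    also have "\<dots> = (\<Sum>p\<in>D. w p * ((\<Sum>a\<in>A. c a * ev p (of_order a)) * ev p h))"
      unfolding pairing_def
    proof (rule sum.cong)
      fix p
      assume p: "p \<in> D"
      have "ev p (\<Sum>a\<in>A. c a * (of_order a * h)) = (\<Sum>a\<in>A. ev p (c a * (of_order a * h)))"
      proof (rule ev_sum[OF p])
        show "c a * (of_order a * h) \<in> R" if "a \<in> A" for a
          using that c(1) prod[OF that] K_R by (intro R.mult_mem[of "c a"]) auto
      qed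
      also have "\<dots> = (\<Sum>a\<in>A. c a * ev p (of_order a) * ev p h)"
        using p c(1) prod fa h by (intro sum.cong) (simp_all add: ev_scale ev_mult)
      finally show "w p * ev_word (\<Sum>a\<in>A. c a * (of_order a * h)) p = w p * ((\<Sum>a\<in>A. c a * ev p (of_order a)) * ev p h)"
        using p by (simp add: ev_word_def sum_distrib_right)
    qed simp
    also have "\<dots> = 0"
      using c(2) by (intro sum.neutral) (auto simp: T_def)
    finally have "(\<Sum>a\<in>A. c a * pairing D w (ev_word (of_order a * h))) = 0" .
    then have "c i * pairing D w (ev_word (of_order i * h)) = 0"
      using sum.remove[OF fin_A i(1), of "\<lambda>a. c a * pairing D w (ev_word (of_order a * h))"] vanish by simp
    moreover have "pairing D w (ev_word (of_order i * h)) \<noteq> 0"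
      using prod[OF i(1)] A(3)[OF i(1)] by (intro top) simp_all
    ultimately show False
      using i(2) by simp
  qed
  then have "card A \<le> card T"
    using fin_A fin_D ev_K of_order A by (intro independent_words_card_le) (auto simp: T_def)
  then show ?thesis
    using \<open>s > r\<close> unfolding A_def T_def summand_count_def by blast
qed

end

section \<open>Discrete valuation rings and places\<close>

definition fractions :: "'a::field set \<Rightarrow> 'a set" where
  "fractions R = {r / d | r d. r \<in> R \<and> d \<in> R \<and> d \<noteq> 0}"

text \<open>
  The localization of \<open>R\<close> at \<open>M\<close> is a discrete valuation ring: inverting \<open>e\<close> makes \<open>\<pi>\<close> a generator of \<open>M\<close>.
\<close>

locale dvr_prime = subring_set R for R :: "'a::field set" +
  fixes M :: "'a set" and \<pi> e :: 'a
  assumes M_sub: "M \<subseteq> R"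
    and one_notin: "1 \<notin> M"
    and M_add: "\<lbrakk>g \<in> M; h \<in> M\<rbrakk> \<Longrightarrow> g + h \<in> M"
    and M_mult: "\<lbrakk>r \<in> R; h \<in> M\<rbrakk> \<Longrightarrow> r * h \<in> M"
    and prime: "\<lbrakk>r \<in> R; s \<in> R; r * s \<in> M\<rbrakk> \<Longrightarrow> r \<in> M \<or> s \<in> M"
    and pi_mem: "\<pi> \<in> M" and pi_nz: "\<pi> \<noteq> 0"
    and e_mem: "e \<in> R" and e_notin: "e \<notin> M"
    and e_M: "h \<in> M \<Longrightarrow> \<exists>r\<in>R. e * h = \<pi> * r"
    and bounded: "\<lbrakk>f \<in> R; f \<noteq> 0\<rbrakk> \<Longrightarrow>
      \<exists>k0. \<forall>k s r. s \<in> R - M \<longrightarrow> r \<in> R \<longrightarrow> s * f = \<pi> ^ k * r \<longrightarrow> k \<le> (k0 :: nat)"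
begin

lemma units_mult: "\<lbrakk>r \<in> R - M; s \<in> R - M\<rbrakk> \<Longrightarrow> r * s \<in> R - M"
  using prime mult_mem by blast

lemma zero_M: "0 \<in> M"
  using M_mult[of 0 \<pi>] pi_mem by simp

lemma unit_nz: "r \<in> R - M \<Longrightarrow> r \<noteq> 0"
  using zero_M by blast

lemma pi_R: "\<pi> \<in> R"
  using pi_mem M_sub by blast

text \<open>Take the largest exponent \<open>k\<close> with \<open>s * f = \<pi> ^ k * r\<close>,
  which exists by \<open>bounded\<close>. If \<open>r\<close> were in \<open>M\<close>, multiplying
  by \<open>e\<close> would extract a further factor \<open>\<pi>\<close>.\<close>

lemma rep_R:
  assumes f: "f \<in> R" "f \<noteq> 0"
  shows "\<exists>k s r. s \<in> R - M \<and> r \<in> R - M \<and> s * f = \<pi> ^ k * r"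
proof -
  define P where "P k \<longleftrightarrow> (\<exists>s r. s \<in> R - M \<and> r \<in> R \<and> s * f = \<pi> ^ k * r)" for k
  obtain k0 where k0: "\<And>k. P k \<Longrightarrow> k \<le> k0"
    using bounded[OF f] unfolding P_def by blast
  have P0: "P 0"
    unfolding P_def using f one_notin by (intro exI[of _ 1] exI[of _ f]) simp
  obtain k where k: "P k" "\<not> P (Suc k)"
  proof (rule ccontr)
    assume "\<not> thesis"
    then have "P k \<Longrightarrow> P (Suc k)" for k
      using that by blast
    then have "P k" for k
      using P0 by (induction k) auto
    then show False
      using k0[of "Suc k0"] by simp
  qed
  then obtain s r where sr: "s \<in> R - M" "r \<in> R" "s * f = \<pi> ^ k * r"
    unfolding P_def by blast
  have "r \<notin> M"
  proof
    assume "r \<in> M"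
    then obtain r' where r': "r' \<in> R" "e * r = \<pi> * r'"
      using e_M by blast
    have "(e * s) * f = \<pi> ^ k * (e * r)"
      using sr(3) by (simp add: ac_simps)
    also have "\<dots> = \<pi> ^ Suc k * r'"
      using r'(2) by (simp add: ac_simps)
    finally have "(e * s) * f = \<pi> ^ Suc k * r'" .
    moreover have "e * s \<in> R - M"
      using sr(1) e_mem e_notin units_mult by blast
    ultimately show False
      using k(2) r'(1) unfolding P_def by blast
  qed
  then show ?thesis
    using sr by blast
qed

lemma rep_F:
  assumes f: "f \<in> fractions R" "f \<noteq> 0"
  shows "\<exists>(k :: int) s r. s \<in> R - M \<and> r \<in> R - M \<and> s * f = \<pi> powi k * r"
proof -
  obtain a d where ad: "f = a / d" "a \<in> R" "d \<in> R" "d \<noteq> 0"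
    using f(1) by (auto simp: fractions_def)
  have "a \<noteq> 0"
    using ad f(2) by auto
  obtain k s r where a: "s \<in> R - M" "r \<in> R - M" "s * a = \<pi> ^ k * r"
    using rep_R[OF ad(2) \<open>a \<noteq> 0\<close>] by blast
  obtain k' s' r' where d: "s' \<in> R - M" "r' \<in> R - M" "s' * d = \<pi> ^ k' * r'"
    using rep_R[OF ad(3,4)] by blast
  have nz: "s \<noteq> 0" "s' \<noteq> 0" "r' \<noteq> 0"
    using a d unit_nz by auto
  have "s * r' * (\<pi> ^ k' * a) = \<pi> ^ k' * r' * (s * a)"
    by (simp add: ac_simps)
  also have "\<dots> = \<pi> ^ k * r * (s' * d)"
    unfolding a(3) d(3) by (simp add: ac_simps)
  finally have "(s * r') * f = \<pi> powi (int k - int k') * (r * s')"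
    unfolding ad(1) using ad(4) pi_nz by (simp add: power_int_diff field_simps)
  then show ?thesis
    using units_mult[OF a(1) d(2)] units_mult[OF a(2) d(1)] by blast
qed

text \<open>Comparing representations with exponents \<open>k < k'\<close> makes a product of
  elements outside \<open>M\<close> a multiple of \<open>\<pi>\<close>, against primality.\<close>

lemma rep_unique:
  assumes "s \<in> R - M" "r \<in> R - M" "s * f = \<pi> powi k * r"
    and "s' \<in> R - M" "r' \<in> R - M" "s' * f = \<pi> powi k' * r'"
  shows "k = k'"
proof -
  have *: False
    if "s \<in> R - M" "r \<in> R - M" "s * f = \<pi> powi k * r"
      "s' \<in> R - M" "r' \<in> R - M" "s' * f = \<pi> powi k' * r'" "k < k'" for s r s' r' k k'
  proof -
    have "\<pi> powi k * (s' * r) = \<pi> powi k' * (s * r')"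
      using that(3,6) by (metis mult.left_commute)
    moreover define j where "j = nat (k' - k - 1)"
    then have "k' = k + int (Suc j)"
      using \<open>k < k'\<close> by simp
    then have "\<pi> powi k' = \<pi> powi k * \<pi> ^ Suc j"
      using power_int_add[of \<pi> k "int (Suc j)"] pi_nz by (simp only: power_int_of_nat) blast
    ultimately have "\<pi> powi k * (s' * r) = \<pi> powi k * ((\<pi> ^ j * (s * r')) * \<pi>)"
      by (simp add: ac_simps)
    then have "s' * r = (\<pi> ^ j * (s * r')) * \<pi>"
      using pi_nz by simp
    moreover have "\<pi> ^ j * (s * r') \<in> R"
      using that pi_R by (intro mult_mem power_mem) auto
    ultimately have "s' * r \<in> M"
      using M_mult pi_mem by metis
    then show False
      using that prime by blast
  qed
  show ?thesis
    using *[OF assms] *[OF assms(4-6) assms(1-3)] by (meson linorder_neqE)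
qed

definition ord_at :: "'a \<Rightarrow> int" where
  "ord_at f = (if f \<in> fractions R - {0} then
     THE k. \<exists>s r. s \<in> R - M \<and> r \<in> R - M \<and> s * f = \<pi> powi k * r else 0)"

lemma ord_at_eqI:
  assumes "f \<in> fractions R" "s \<in> R - M" "r \<in> R - M" "s * f = \<pi> powi k * r"
  shows "ord_at f = k"
proof -
  have "f \<noteq> 0"
    using assms unit_nz pi_nz by auto
  then have "ord_at f = (THE k. \<exists>s r. s \<in> R - M \<and> r \<in> R - M \<and> s * f = \<pi> powi k * r)"
    using assms(1) by (simp add: ord_at_def)
  also have "\<dots> = k"
    using assms rep_unique by (intro the_equality) blast+
  finally show ?thesis .
qed

lemma R_fractions: "r \<in> R \<Longrightarrow> r \<in> fractions R"
  unfolding fractions_def by (intro CollectI exI[of _ r] exI[of _ 1]) simp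

lemma fractionsI: "\<lbrakk>f = r / d; r \<in> R; d \<in> R; d \<noteq> 0\<rbrakk> \<Longrightarrow> f \<in> fractions R"
  unfolding fractions_def by blast

lemma fractionsE:
  assumes "f \<in> fractions R"
  obtains r d where "f = r / d" "r \<in> R" "d \<in> R" "d \<noteq> 0"
  using assms unfolding fractions_def by blast

lemma fractions_mult:
  assumes "f \<in> fractions R" "g \<in> fractions R"
  shows "f * g \<in> fractions R"
proof -
  obtain r d r' d' where "f = r / d" "r \<in> R" "d \<in> R" "d \<noteq> 0" "g = r' / d'" "r' \<in> R" "d' \<in> R" "d' \<noteq> 0"
    using assms by (elim fractionsE)
  then show ?thesis
    by (intro fractionsI[of _ "r * r'" "d * d'"]) (simp_all add: mult_mem)
qed

lemma fractions_add:
  assumes "f \<in> fractions R" "g \<in> fractions R"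
  shows "f + g \<in> fractions R"
proof -
  obtain r d r' d' where "f = r / d" "r \<in> R" "d \<in> R" "d \<noteq> 0" "g = r' / d'" "r' \<in> R" "d' \<in> R" "d' \<noteq> 0"
    using assms by (elim fractionsE)
  then show ?thesis
    by (intro fractionsI[of _ "r * d' + r' * d" "d * d'"]) (simp_all add: mult_mem add_mem add_frac_eq)
qed

lemma ord_at_R_nonneg:
  assumes "f \<in> R" "f \<noteq> 0"
  shows "0 \<le> ord_at f"
proof -
  obtain k s r where "s \<in> R - M" "r \<in> R - M" "s * f = \<pi> ^ k * r"
    using rep_R[OF assms] by blast
  then have "ord_at f = int k"
    using assms(1) by (intro ord_at_eqI[of _ s r] R_fractions) simp_all
  then show ?thesis
    by simp
qed

lemma ord_at_unit: "f \<in> R - M \<Longrightarrow> ord_at f = 0"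
  using one_notin by (intro ord_at_eqI[of _ 1 f] R_fractions) simp_all

lemma ord_at_pi: "ord_at \<pi> = 1"
  using one_notin pi_R by (intro ord_at_eqI[of _ 1 1] R_fractions) simp_all

lemma ord_at_mult:
  assumes "f \<in> fractions R - {0}" "g \<in> fractions R - {0}"
  shows "ord_at (f * g) = ord_at f + ord_at g"
proof -
  obtain k s r where f: "s \<in> R - M" "r \<in> R - M" "s * f = \<pi> powi k * r"
    using rep_F assms by blast
  obtain k' s' r' where g: "s' \<in> R - M" "r' \<in> R - M" "s' * g = \<pi> powi k' * r'"
    using rep_F assms by blast
  have "(s * s') * (f * g) = (s * f) * (s' * g)"
    by (simp add: ac_simps)
  also have "\<dots> = \<pi> powi (k + k') * (r * r')"
    unfolding f(3) g(3) using pi_nz by (simp add: power_int_add)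
  finally have "ord_at (f * g) = k + k'"
    using assms fractions_mult units_mult[OF f(1) g(1)] units_mult[OF f(2) g(2)]
    by (intro ord_at_eqI[of _ "s * s'" "r * r'"]) simp_all
  then show ?thesis
    using ord_at_eqI f g assms by (metis DiffD1)
qed

lemma ord_at_add:
  assumes "f \<in> fractions R - {0}" "g \<in> fractions R - {0}" "f + g \<noteq> 0"
  shows "min (ord_at f) (ord_at g) \<le> ord_at (f + g)"
proof -
  have *: "ord_at f \<le> ord_at (f + g)"
    if fg_F: "f \<in> fractions R - {0}" "g \<in> fractions R - {0}" "f + g \<noteq> 0"
      and le: "ord_at f \<le> ord_at g" for f g
  proof -
    obtain k s r where f: "s \<in> R - M" "r \<in> R - M" "s * f = \<pi> powi k * r"
      using rep_F[of f] fg_F by blast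
    obtain k' s' r' where g: "s' \<in> R - M" "r' \<in> R - M" "s' * g = \<pi> powi k' * r'"
      using rep_F[of g] fg_F by blast
    have k: "ord_at f = k" "ord_at g = k'"
      using ord_at_eqI f g fg_F by blast+
    define i where "i = nat (k' - k)"
    have i: "k' = k + int i"
      using le k by (simp add: i_def)
    define h where "h = s' * r + \<pi> ^ i * (s * r')"
    have "(s * s') * (f + g) = s' * (s * f) + s * (s' * g)"
      by (simp add: algebra_simps)
    also have "\<dots> = \<pi> powi k * h"
      unfolding f(3) g(3) i h_def using pi_nz by (simp add: power_int_add algebra_simps)
    finally have fg: "(s * s') * (f + g) = \<pi> powi k * h" .
    have "h \<in> R"
      unfolding h_def using f g pi_R by (intro add_mem mult_mem power_mem) auto
    moreover have "h \<noteq> 0"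
      using fg fg_F(3) unit_nz[OF f(1)] unit_nz[OF g(1)] by auto
    ultimately obtain j s'' r'' where h: "s'' \<in> R - M" "r'' \<in> R - M" "s'' * h = \<pi> ^ j * r''"
      using rep_R by blast
    have "(s'' * (s * s')) * (f + g) = \<pi> powi k * (s'' * h)"
      using fg by (simp add: ac_simps)
    also have "\<dots> = \<pi> powi (k + int j) * r''"
      unfolding h(3) using pi_nz by (simp add: power_int_add ac_simps)
    finally have "ord_at (f + g) = k + int j"
      using fg_F fractions_add units_mult[OF h(1) units_mult[OF f(1) g(1)]] h(2)
      by (intro ord_at_eqI[of _ "s'' * (s * s')" r'']) simp_all
    then show ?thesis
      using k by simp
  qed
  show ?thesis
    using *[of f g] *[of g f] assms by (cases "ord_at f \<le> ord_at g") (simp_all add: add.commute)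
qed

lemma ord_at_place:
  assumes "K \<subseteq> R" "\<And>c. c \<in> K \<Longrightarrow> inverse c \<in> K"
  shows "ord_at \<in> places K (fractions R)"
proof -
  have "ord_at c = 0" if "c \<in> K - {0}" for c
  proof (rule ord_at_unit)
    have "inverse c * c = 1" "inverse c \<in> R"
      using that assms by auto
    then have "c \<notin> M"
      using M_mult one_notin by metis
    then show "c \<in> R - M"
      using that assms(1) by blast
  qed
  moreover have "\<exists>t\<in>fractions R - {0}. ord_at t = 1"
    using ord_at_pi pi_R pi_nz R_fractions by blast
  moreover have "ord_at f = 0" if "f \<notin> fractions R - {0}" for f
    using that by (simp only: ord_at_def if_False)
  ultimately show ?thesis
    unfolding places_def using ord_at_mult ord_at_add by (intro CollectI conjI ballI impI allI) simp_all
qed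

text \<open>A place with centre \<open>M\<close> vanishes on \<open>R - M\<close>, hence is the
  multiple \<open>v \<pi>\<close> of \<open>ord_at\<close>; since it attains the value 1, the
  positive integer \<open>v \<pi>\<close> divides 1.\<close>

lemma ord_at_unique:
  assumes v: "v \<in> places K (fractions R)"
    and nonneg: "\<And>h. h \<in> R - {0} \<Longrightarrow> 0 \<le> v h"
    and centre: "\<And>h. h \<in> R - {0} \<Longrightarrow> 0 < v h \<longleftrightarrow> h \<in> M"
  shows "v = ord_at"
proof -
  have mult: "v (f * g) = v f + v g" if "f \<in> fractions R - {0}" "g \<in> fractions R - {0}" for f g
    using v that unfolding places_def by blast
  have unit: "v r = 0" if "r \<in> R - M" for r
    using nonneg[of r] centre[of r] that unit_nz by force
  have one: "v 1 = 0"
    using unit[of 1] one_notin by simp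
  have F: "r \<in> fractions R - {0}" if "r \<in> R" "r \<noteq> 0" for r
    using that R_fractions by blast
  have inv: "inverse f \<in> fractions R - {0}" if f: "f \<in> fractions R - {0}" for f
  proof -
    obtain r d where rd: "f = r / d" "r \<in> R" "d \<in> R" "d \<noteq> 0"
      using f fractionsE by blast
    then have "r \<noteq> 0" "inverse f = d / r"
      using f by auto
    then have "inverse f \<in> fractions R"
      using fractionsI rd by blast
    then show ?thesis
      using f by simp
  qed
  have pow_F: "\<pi> powi k \<in> fractions R - {0}" for k
  proof -
    have *: "\<pi> ^ i \<in> fractions R - {0}" for i
      using F[of "\<pi> ^ i"] pi_R pi_nz power_mem by simp
    show ?thesis
    proof (cases "k \<ge> 0")
      case True
      then have "\<pi> powi k = \<pi> ^ nat k"
        by (simp add: power_int_def)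
      then show ?thesis
        using * by (simp only:)
    next
      case False
      then have "\<pi> powi k = inverse (\<pi> ^ nat (- k))"
        by (simp add: power_int_def power_inverse)
      then show ?thesis
        using inv[OF *] by (simp only:)
    qed
  qed
  have pow_nat: "v (\<pi> ^ i) = int i * v \<pi>" for i
  proof (induction i)
    case (Suc i)
    have "\<pi> ^ i \<in> fractions R - {0}" "\<pi> \<in> fractions R - {0}"
      using F pi_R pi_nz power_mem by simp_all
    then show ?case
      using mult[of \<pi> "\<pi> ^ i"] Suc by (simp add: algebra_simps)
  qed (simp add: one)
  have pow: "v (\<pi> powi k) = k * v \<pi>" for k
  proof (cases "k \<ge> 0")
    case True
    then show ?thesis
      using pow_nat[of "nat k"] by (simp add: power_int_def)
  next
    case False
    have "\<pi> powi k * \<pi> ^ nat (- k) = 1"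
      using False pi_nz by (simp add: power_int_def power_inverse)
    moreover have "v (\<pi> powi k * \<pi> ^ nat (- k)) = v (\<pi> powi k) + v (\<pi> ^ nat (- k))"
      using pi_R pi_nz power_mem by (intro mult pow_F F) simp_all
    ultimately have "v (\<pi> powi k) + v (\<pi> ^ nat (- k)) = 0"
      using one by simp
    then show ?thesis
      using pow_nat[of "nat (- k)"] False by simp
  qed
  have v_eq: "v f = ord_at f * v \<pi>" if f: "f \<in> fractions R - {0}" for f
  proof -
    obtain k s r where sr: "s \<in> R - M" "r \<in> R - M" "s * f = \<pi> powi k * r"
      using rep_F f by blast
    have "v s + v f = v (\<pi> powi k) + v r"
      using mult[of s f] mult[of "\<pi> powi k" r] sr f F[of s] F[of r] unit_nz[of s] unit_nz[of r] pow_F[of k]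
      by simp
    moreover have "ord_at f = k"
      using ord_at_eqI sr f by blast
    ultimately show ?thesis
      using unit sr pow by simp
  qed
  obtain t where "t \<in> fractions R - {0}" "v t = 1"
    using v unfolding places_def by blast
  then have "ord_at t * v \<pi> = 1"
    using v_eq by simp
  moreover have "v \<pi> > 0"
    using centre[of \<pi>] pi_R pi_nz pi_mem by simp
  ultimately have "v \<pi> = 1"
    by (simp add: zmult_eq_1_iff)
  show ?thesis
  proof
    fix f
    show "v f = ord_at f"
    proof (cases "f \<in> fractions R - {0}")
      case True
      then show ?thesis
        using v_eq \<open>v \<pi> = 1\<close> by simp
    next
      case False
      show ?thesis
      proof -
        have "v f = 0"
          using v False unfolding places_def by blast
        then show ?thesis
          using False by (simp only: ord_at_def if_False)
      qed
    qed
  qed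
qed

text \<open>The valuation ring of \<open>ord_at\<close> is contained in the localization of
  \<open>R\<close> at \<open>M\<close>.\<close>

lemma nonneg_rep:
  assumes "f \<in> fractions R" "f \<noteq> 0" "0 \<le> ord_at f"
  shows "\<exists>s r. s \<in> R - M \<and> r \<in> R \<and> s * f = r"
proof -
  obtain k s r where sr: "s \<in> R - M" "r \<in> R - M" "s * f = \<pi> powi k * r"
    using rep_F assms by blast
  have "0 \<le> k"
    using ord_at_eqI[OF assms(1) sr] assms(3) by simp
  then have "s * f = \<pi> ^ nat k * r"
    using sr(3) by (simp add: power_int_def)
  moreover have "\<pi> ^ nat k * r \<in> R"
    using sr pi_R by (intro mult_mem power_mem) auto
  ultimately show ?thesis
    using sr by blast
qed

end

section \<open>Quadratic Artin-Schreier steps\<close>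

definition adjoin :: "'a::field set \<Rightarrow> 'a \<Rightarrow> 'a set" where
  "adjoin A w = {a + b * w | a b. a \<in> A \<and> b \<in> A}"

definition multiples :: "'a::field \<Rightarrow> 'a set \<Rightarrow> 'a set" where
  "multiples d A = (\<lambda>a. d * a) ` A"

text \<open>Reducedness of \<open>A / d A\<close> in the ring sense; testing squares suffices, since
  a nilpotent is killed by repeated squaring.\<close>

definition reduced_mod :: "'a::field \<Rightarrow> 'a set \<Rightarrow> bool" where
  "reduced_mod d A \<longleftrightarrow> (\<forall>h\<in>A. h ^ 2 \<in> multiples d A \<longrightarrow> h \<in> multiples d A)"

definition finite_mod :: "'a::field \<Rightarrow> 'a set \<Rightarrow> bool" where
  "finite_mod d A \<longleftrightarrow> (\<exists>T\<subseteq>A. finite T \<and> (\<forall>a\<in>A. \<exists>t\<in>T. a - t \<in> multiples d A))"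

definition eval_hom :: "'a::field set \<Rightarrow> 'a set \<Rightarrow> ('a \<Rightarrow> 'a) \<Rightarrow> bool" where
  "eval_hom K A h \<longleftrightarrow> (\<forall>a\<in>A. h a \<in> K) \<and> (\<forall>c\<in>K. h c = c) \<and>
     (\<forall>a\<in>A. \<forall>b\<in>A. h (a + b) = h a + h b \<and> h (a * b) = h a * h b)"

text \<open>The kernel of \<open>h\<close> is generated by \<open>d\<close> in the localization of \<open>A\<close> at it.\<close>

definition kernel_generated :: "'a::field \<Rightarrow> 'a set \<Rightarrow> ('a \<Rightarrow> 'a) \<Rightarrow> bool" where
  "kernel_generated d A h \<longleftrightarrow> (\<exists>e\<in>A. h e \<noteq> 0 \<and> (\<forall>a\<in>A. h a = 0 \<longrightarrow> e * a \<in> multiples d A))"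

context subring_set
begin

lemma multiples_add: "\<lbrakk>a \<in> multiples d A; b \<in> multiples d A\<rbrakk> \<Longrightarrow> a + b \<in> multiples d A"
  unfolding multiples_def using add_mem by (auto simp flip: distrib_left)

lemma multiples_uminus: "a \<in> multiples d A \<Longrightarrow> - a \<in> multiples d A"
  unfolding multiples_def using uminus_mem by (auto intro: image_eqI[of _ _ "- x" for x])

lemma multiples_diff: "\<lbrakk>a \<in> multiples d A; b \<in> multiples d A\<rbrakk> \<Longrightarrow> a - b \<in> multiples d A"
  using multiples_add[of a d "- b"] multiples_uminus[of b d] by simp

lemma multiples_mult: "\<lbrakk>a \<in> multiples d A; b \<in> A\<rbrakk> \<Longrightarrow> b * a \<in> multiples d A"
  unfolding multiples_def using mult_mem by (auto simp: mult.left_commute)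

lemma multiples_sub: "d \<in> A \<Longrightarrow> multiples d A \<subseteq> A"
  unfolding multiples_def using mult_mem by auto

lemma multiplesI: "a \<in> A \<Longrightarrow> d * a \<in> multiples d A"
  unfolding multiples_def by blast

end

lemma multiplesE:
  assumes "b \<in> multiples d A"
  obtains a where "a \<in> A" "b = d * a"
  using assms unfolding multiples_def by blast

locale as_step = subring_set A for A :: "'a::field set" +
  fixes w :: 'a
  assumes w2: "w ^ 2 + w \<in> A"
    and indep: "\<lbrakk>a \<in> A; b \<in> A; a + b * w = 0\<rbrakk> \<Longrightarrow> a = 0 \<and> b = 0"
begin

lemma unique:
  assumes "a \<in> A" "b \<in> A" "a' \<in> A" "b' \<in> A" "a + b * w = a' + b' * w"
  shows "a = a'" "b = b'"
proof -
  have "(a - a') + (b - b') * w = 0"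
    using assms(5) by (simp add: algebra_simps)
  then show "a = a'" "b = b'"
    using indep[of "a - a'" "b - b'"] assms diff_mem by auto
qed

lemma adjoinI: "\<lbrakk>a \<in> A; b \<in> A\<rbrakk> \<Longrightarrow> a + b * w \<in> adjoin A w"
  unfolding adjoin_def by blast

lemma adjoinE:
  assumes "r \<in> adjoin A w"
  obtains a b where "a \<in> A" "b \<in> A" "r = a + b * w"
  using assms unfolding adjoin_def by blast

lemma sub_adjoin: "A \<subseteq> adjoin A w"
  using adjoinI[of _ 0] by auto

lemma w_adjoin: "w \<in> adjoin A w"
  using adjoinI[of 0 1] by simp

lemma mult_formula:
  "(a + b * w) * (a' + b' * w) = (a * a' + b * b' * (w ^ 2 + w)) + (a * b' + b * a' - b * b') * w"
  by (simp add: algebra_simps power2_eq_square)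

lemma subring_adjoin: "subring_set (adjoin A w)"
proof
  show "0 \<in> adjoin A w" "1 \<in> adjoin A w"
    using sub_adjoin by auto
next
  fix r s
  assume "r \<in> adjoin A w" "s \<in> adjoin A w"
  then obtain a b a' b' where ab: "a \<in> A" "b \<in> A" "r = a + b * w" "a' \<in> A" "b' \<in> A" "s = a' + b' * w"
    by (elim adjoinE)
  have "r + s = (a + a') + (b + b') * w"
    using ab by (simp add: algebra_simps)
  then show "r + s \<in> adjoin A w"
    using ab by (simp only: adjoinI add_mem)
  show "r * s \<in> adjoin A w"
    unfolding ab(3,6) mult_formula
    by (rule adjoinI[OF add_mem[OF mult_mem[OF ab(1,4)] mult_mem[OF mult_mem[OF ab(2,5)] w2]]
      diff_mem[OF add_mem[OF mult_mem[OF ab(1,5)] mult_mem[OF ab(2,4)]] mult_mem[OF ab(2,5)]]])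
next
  fix r
  assume "r \<in> adjoin A w"
  then obtain a b where ab: "a \<in> A" "b \<in> A" "r = a + b * w"
    by (elim adjoinE)
  have "- r = - a + (- b) * w"
    using ab by simp
  then show "- r \<in> adjoin A w"
    using ab by (simp only: adjoinI uminus_mem)
qed

sublocale adj: subring_set "adjoin A w"
  by (rule subring_adjoin)

text \<open>Since \<open>1, w\<close> is a basis over \<open>A\<close>, divisibility by an element
  of \<open>A\<close> is tested coefficientwise.\<close>

lemma multiples_adjoin_iff:
  assumes "d \<in> A" "a \<in> A" "b \<in> A"
  shows "a + b * w \<in> multiples d (adjoin A w) \<longleftrightarrow> a \<in> multiples d A \<and> b \<in> multiples d A"
proof
  assume "a + b * w \<in> multiples d (adjoin A w)"
  then obtain r where "r \<in> adjoin A w" "a + b * w = d * r"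
    by (elim multiplesE)
  then obtain a' b' where ab: "a' \<in> A" "b' \<in> A" "a + b * w = d * (a' + b' * w)"
    by (auto elim: adjoinE)
  then have "a + b * w = d * a' + (d * b') * w"
    by (simp add: algebra_simps)
  then have "a = d * a'" "b = d * b'"
    using unique[of a b "d * a'" "d * b'"] ab assms mult_mem by auto
  then show "a \<in> multiples d A \<and> b \<in> multiples d A"
    using ab multiplesI by simp
next
  assume "a \<in> multiples d A \<and> b \<in> multiples d A"
  then obtain a' b' where "a' \<in> A" "a = d * a'" "b' \<in> A" "b = d * b'"
    unfolding multiples_def by blast
  then have "a + b * w = d * (a' + b' * w)" "a' + b' * w \<in> adjoin A w"
    using adjoinI by (auto simp: algebra_simps)
  then show "a + b * w \<in> multiples d (adjoin A w)"
    using adj.multiplesI by simp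
qed

text \<open>In characteristic 2, with \<open>u = w ^ 2 + w\<close>, the square of
  \<open>a + b * w\<close> is \<open>(a ^ 2 + b ^ 2 * u) - b ^ 2 * w\<close>. Divisibility by
  \<open>d\<close> thus passes to \<open>b ^ 2\<close>, then to \<open>a ^ 2\<close>. This is one of
  the forms in which unramifiedness of the step is used.\<close>

lemma reduced_mod_adjoin:
  assumes two: "(2 :: 'a) = 0" and d: "d \<in> A" and red: "reduced_mod d A"
  shows "reduced_mod d (adjoin A w)"
  unfolding reduced_mod_def
proof (intro ballI impI)
  fix h
  assume h: "h \<in> adjoin A w" "h ^ 2 \<in> multiples d (adjoin A w)"
  obtain a b where ab: "a \<in> A" "b \<in> A" "h = a + b * w"
    using h(1) by (elim adjoinE)
  have "h ^ 2 = (a ^ 2 + b ^ 2 * (w ^ 2 + w)) + (2 * (a * b) - b ^ 2) * w"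
    unfolding ab(3) power2_eq_square mult_formula by (simp add: algebra_simps power2_eq_square)
  then have "h ^ 2 = (a ^ 2 + b ^ 2 * (w ^ 2 + w)) + (- (b ^ 2)) * w"
    unfolding two by simp
  then have *: "a ^ 2 + b ^ 2 * (w ^ 2 + w) \<in> multiples d A" "- (b ^ 2) \<in> multiples d A"
    using h(2) multiples_adjoin_iff[OF d, of "a ^ 2 + b ^ 2 * (w ^ 2 + w)" "- (b ^ 2)"] ab w2
    by (simp_all add: add_mem mult_mem power_mem uminus_mem)
  then have b: "b ^ 2 \<in> multiples d A"
    using multiples_uminus by fastforce
  then have "b \<in> multiples d A"
    using red ab(2) by (simp add: reduced_mod_def)
  moreover have "a ^ 2 \<in> multiples d A"
    using multiples_diff[OF *(1) multiples_mult[OF b w2]] by (simp add: mult.commute)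
  then have "a \<in> multiples d A"
    using red ab(1) by (simp add: reduced_mod_def)
  ultimately show "h \<in> multiples d (adjoin A w)"
    using multiples_adjoin_iff[OF d ab(1,2)] ab(3) by simp
qed

lemma finite_mod_adjoin:
  assumes d: "d \<in> A" and fin: "finite_mod d A"
  shows "finite_mod d (adjoin A w)"
proof -
  obtain T where T: "T \<subseteq> A" "finite T" "\<And>a. a \<in> A \<Longrightarrow> \<exists>t\<in>T. a - t \<in> multiples d A"
    using fin unfolding finite_mod_def by blast
  let ?T = "(\<lambda>(s, t). s + t * w) ` (T \<times> T)"
  have "\<exists>t\<in>?T. r - t \<in> multiples d (adjoin A w)" if "r \<in> adjoin A w" for r
  proof -
    obtain a b where ab: "a \<in> A" "b \<in> A" "r = a + b * w"
      using \<open>r \<in> adjoin A w\<close> by (elim adjoinE)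
    obtain s t where st: "s \<in> T" "a - s \<in> multiples d A" "t \<in> T" "b - t \<in> multiples d A"
      using T(3)[OF ab(1)] T(3)[OF ab(2)] by blast
    have eq: "r - (s + t * w) = (a - s) + (b - t) * w"
      unfolding ab(3) by (simp add: algebra_simps)
    have "a - s \<in> A" "b - t \<in> A"
      using ab st T(1) diff_mem by auto
    then have "r - (s + t * w) \<in> multiples d (adjoin A w)"
      unfolding eq using multiples_adjoin_iff[OF d] st by blast
    then show ?thesis
      using st by force
  qed
  moreover have "?T \<subseteq> adjoin A w"
    using T(1) adjoinI by auto
  ultimately show ?thesis
    unfolding finite_mod_def using T(2) by (intro exI[of _ ?T]) simp
qed

text \<open>A root \<open>c\<close> of the specialized equation is a possible image of
  \<open>w\<close>; uniqueness of the coefficients makes the extension well defined.\<close>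

lemma eval_hom_adjoin:
  assumes K: "subring_set K" "K \<subseteq> A" and h: "eval_hom K A h"
    and c: "c \<in> K" "c ^ 2 + c = h (w ^ 2 + w)"
  shows "\<exists>h'. eval_hom K (adjoin A w) h' \<and> h' w = c \<and> (\<forall>a\<in>A. h' a = h a) \<and>
    (\<forall>a\<in>A. \<forall>b\<in>A. h' (a + b * w) = h a + h b * c)"
proof -
  interpret K: subring_set K by fact
  have hK: "h a \<in> K" if "a \<in> A" for a
    using h that by (simp add: eval_hom_def)
  have h_const: "h k = k" if "k \<in> K" for k
    using h that by (simp add: eval_hom_def)
  have h_add: "h (a + b) = h a + h b" and h_mult: "h (a * b) = h a * h b" if "a \<in> A" "b \<in> A" for a b
    using h that by (simp_all add: eval_hom_def)
  have h_uminus: "h (- a) = - h a" if "a \<in> A" for a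
    using h_add[OF that uminus_mem[OF that]] h_const[of 0] by (simp add: eq_neg_iff_add_eq_0 add.commute)
  have h_diff: "h (a - b) = h a - h b" if "a \<in> A" "b \<in> A" for a b
    using h_add[OF that(1) uminus_mem[OF that(2)]] h_uminus[OF that(2)] by simp
  define h' where "h' r = (THE k. \<exists>a\<in>A. \<exists>b\<in>A. r = a + b * w \<and> k = h a + h b * c)" for r
  have h': "h' (a + b * w) = h a + h b * c" if ab: "a \<in> A" "b \<in> A" for a b
    unfolding h'_def
  proof (rule the_equality)
    show "\<exists>a'\<in>A. \<exists>b'\<in>A. a + b * w = a' + b' * w \<and> h a + h b * c = h a' + h b' * c"
      using ab by blast
    show "k = h a + h b * c" if "\<exists>a'\<in>A. \<exists>b'\<in>A. a + b * w = a' + b' * w \<and> k = h a' + h b' * c" for k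
      using that unique[OF ab] by blast
  qed
  have h'A: "h' a = h a" if "a \<in> A" for a
    using h'[OF that zero_mem] h_const[of 0] by simp
  have "h' w = c"
    using h'[OF zero_mem one_mem] h_const[of 0] h_const[of 1] by simp
  moreover have "eval_hom K (adjoin A w) h'"
    unfolding eval_hom_def
  proof (intro conjI ballI)
    show "h' r \<in> K" if "r \<in> adjoin A w" for r
      using that h' hK c by (auto elim!: adjoinE intro!: K.add_mem K.mult_mem)
    show "h' k = k" if "k \<in> K" for k
      using h'A h_const K(2) that by auto
  next
    fix r s
    assume "r \<in> adjoin A w" "s \<in> adjoin A w"
    then obtain a b a' b' where ab: "a \<in> A" "b \<in> A" "r = a + b * w" "a' \<in> A" "b' \<in> A" "s = a' + b' * w"
      by (elim adjoinE)
    have "r + s = (a + a') + (b + b') * w"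
      using ab by (simp add: algebra_simps)
    then have "h' (r + s) = h (a + a') + h (b + b') * c"
      using h' ab add_mem by (simp only:)
    then show "h' (r + s) = h' r + h' s"
      using ab h' by (simp add: h_add algebra_simps)
    have mem: "a * a' + b * b' * (w ^ 2 + w) \<in> A" "a * b' + b * a' - b * b' \<in> A"
      using add_mem[OF mult_mem[OF ab(1,4)] mult_mem[OF mult_mem[OF ab(2,5)] w2]]
        diff_mem[OF add_mem[OF mult_mem[OF ab(1,5)] mult_mem[OF ab(2,4)]] mult_mem[OF ab(2,5)]] .
    have "h' (r * s) = h (a * a' + b * b' * (w ^ 2 + w)) + h (a * b' + b * a' - b * b') * c"
      unfolding ab(3,6) mult_formula h'[OF mem] ..
    also have "h (a * a' + b * b' * (w ^ 2 + w)) = h a * h a' + h b * h b' * (c ^ 2 + c)"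
      unfolding c(2) using ab w2 mult_mem by (simp only: h_add h_mult)
    also have "h (a * b' + b * a' - b * b') = h a * h b' + h b * h a' - h b * h b'"
      using ab mult_mem add_mem by (simp only: h_add h_mult h_diff)
    also have "h a * h a' + h b * h b' * (c ^ 2 + c) + (h a * h b' + h b * h a' - h b * h b') * c =
        (h a + h b * c) * (h a' + h b' * c)"
      by (simp add: algebra_simps power2_eq_square)
    finally show "h' (r * s) = h' r * h' s"
      using ab h' by simp
  qed
  ultimately show ?thesis
    using h'A h' by blast
qed

text \<open>Write \<open>r = (a + b * c) + b * (w - c)\<close>. If \<open>r\<close> is in the
  kernel, so is the first summand, which \<open>e\<close> brings into \<open>d A\<close>. For the
  second, \<open>(w - c) * (w + c + 1)\<close> is the difference of \<open>w ^ 2 + w\<close> and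
  \<open>c ^ 2 + c\<close>, again in the kernel of \<open>h\<close>.\<close>

lemma kernel_generated_adjoin:
  assumes two: "(2 :: 'a) = 0" and K: "subring_set K" "K \<subseteq> A" and h: "eval_hom K A h"
    and c: "c \<in> K" "c ^ 2 + c = h (w ^ 2 + w)"
    and h': "eval_hom K (adjoin A w) h'" "\<And>a b. a \<in> A \<Longrightarrow> b \<in> A \<Longrightarrow> h' (a + b * w) = h a + h b * c"
    and d: "d \<in> A" and gen: "kernel_generated d A h"
  shows "kernel_generated d (adjoin A w) h'"
proof -
  interpret K: subring_set K by fact
  have h_const: "h k = k" if "k \<in> K" for k
    using h that by (simp add: eval_hom_def)
  have h_add: "h (a + b) = h a + h b" and h_mult: "h (a * b) = h a * h b" if "a \<in> A" "b \<in> A" for a b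
    using h that by (simp_all add: eval_hom_def)
  obtain e where e: "e \<in> A" "h e \<noteq> 0" "\<And>a. a \<in> A \<Longrightarrow> h a = 0 \<Longrightarrow> e * a \<in> multiples d A"
    using gen unfolding kernel_generated_def by blast
  have cA: "c \<in> A"
    using c(1) K(2) by blast
  \<comment> \<open>This is \<open>e * (w + c + 1)\<close>: the new factor vanishes at the conjugate
    root \<open>- 1 - c\<close> and takes the value \<open>2 * c + 1 = 1\<close> at
    \<open>c\<close>, so the two roots are separated.\<close>
  let ?e = "e * (c + 1) + e * w"
  have eA: "e * (c + 1) \<in> A"
    using e(1) cA by (intro mult_mem add_mem) simp_all
  have "h' ?e = h e * (c + 1) + h e * c"
    using h'(2)[OF eA e(1)] h_mult[OF e(1), of "c + 1"] h_const[of "c + 1"] cA c(1)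
    by (simp add: add_mem K.add_mem)
  also have "\<dots> = h e * (2 * c + 1)"
    by (simp add: algebra_simps)
  also have "\<dots> = h e"
    unfolding two by simp
  finally have he: "h' ?e = h e" .
  have "?e * r \<in> multiples d (adjoin A w)" if r: "r \<in> adjoin A w" "h' r = 0" for r
  proof -
    obtain a b where ab: "a \<in> A" "b \<in> A" "r = a + b * w"
      using r(1) by (elim adjoinE)
    have "h (a + b * c) = 0"
      using r(2) h'(2)[OF ab(1,2)] h_add[of a "b * c"] h_mult[of b c] h_const[OF c(1)] ab cA mult_mem by simp
    then have 1: "e * (a + b * c) \<in> multiples d A"
      using e(3) ab cA add_mem mult_mem by simp
    let ?u = "(w ^ 2 + w) - (c ^ 2 + c)"
    have cc: "- (c ^ 2 + c) \<in> K" "c ^ 2 + c \<in> A"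
      by (rule K.uminus_mem[OF K.add_mem[OF K.power_mem[OF c(1)] c(1)]], rule add_mem[OF power_mem[OF cA] cA])
    have "h ?u = 0"
      unfolding diff_conv_add_uminus h_add[OF w2 uminus_mem[OF cc(2)]] h_const[OF cc(1)] c(2)[symmetric]
      by (rule right_minus)
    then have "e * ?u \<in> multiples d A"
      by (rule e(3)[OF diff_mem[OF w2 cc(2)]])
    then have 2: "b * (e * ?u) \<in> multiples d A"
      using ab(2) by (rule multiples_mult)
    have "?e * r = (e * (a + b * c)) * (w + c + 1) + b * (e * ?u)"
      unfolding ab(3) by (simp add: algebra_simps power2_eq_square)
    also have "\<dots> = (c + 1) * (e * (a + b * c)) + b * (e * ?u) + (e * (a + b * c)) * w"
      by (simp add: algebra_simps)
    also have "\<dots> \<in> multiples d (adjoin A w)"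
    proof -
      have 3: "(c + 1) * (e * (a + b * c)) + b * (e * ?u) \<in> multiples d A"
        by (rule multiples_add[OF multiples_mult[OF 1 add_mem[OF cA one_mem]] 2])
      then show ?thesis
        using multiples_adjoin_iff[OF d] multiples_sub[OF d] 1 by blast
    qed
    finally show ?thesis .
  qed
  moreover have "?e \<in> adjoin A w"
    using adjoinI[OF eA e(1)] .
  ultimately show ?thesis
    unfolding kernel_generated_def using he e(2) by (intro bexI[of _ ?e]) simp_all
qed

end

section \<open>Values along a quadratic step\<close>

locale valuation = subfield_set F for F :: "'a::field set" +
  fixes v :: "'a \<Rightarrow> int"
  assumes v_mult: "\<lbrakk>f \<in> F - {0}; g \<in> F - {0}\<rbrakk> \<Longrightarrow> v (f * g) = v f + v g"
    and v_add: "\<lbrakk>f \<in> F - {0}; g \<in> F - {0}; f + g \<noteq> 0\<rbrakk> \<Longrightarrow> min (v f) (v g) \<le> v (f + g)"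
begin

lemma v_1: "v 1 = 0"
  using v_mult[of 1 1] by simp

lemma v_uminus: "f \<in> F - {0} \<Longrightarrow> v (- f) = v f"
proof -
  assume f: "f \<in> F - {0}"
  have "v (- 1) = 0"
    using v_mult[of "- 1" "- 1"] uminus_mem[of 1] v_1 by simp
  then show "v (- f) = v f"
    using v_mult[of "- 1" f] f uminus_mem[of 1] by simp
qed

lemma v_less:
  assumes fg: "f \<in> F - {0}" "g \<in> F - {0}" "v f < v g"
  shows "f + g \<noteq> 0" "v (f + g) = v f"
proof -
  show nz: "f + g \<noteq> 0"
  proof
    assume "f + g = 0"
    then have "f = - g"
      by (simp add: add_eq_0_iff2)
    then show False
      using v_uminus[OF fg(2)] fg(3) by simp
  qed
  have 1: "v f \<le> v (f + g)"
    using v_add[OF fg(1,2) nz] fg(3) by simp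
  have "f + g \<in> F - {0}" "- g \<in> F - {0}"
    using nz fg add_mem uminus_mem by auto
  from v_add[OF this] have "min (v (f + g)) (v g) \<le> v f"
    using fg v_uminus by simp
  then show "v (f + g) = v f"
    using 1 fg(3) by simp
qed

lemma v_power: "f \<in> F - {0} \<Longrightarrow> v (f ^ i) = int i * v f"
proof (induction i)
  case (Suc i)
  then show ?case
    using v_mult[of f "f ^ i"] power_mem[of f i] by (simp add: algebra_simps)
qed (simp add: v_1)

lemma v_divide:
  assumes "f \<in> F - {0}" "g \<in> F - {0}"
  shows "v (f / g) = v f - v g"
proof -
  have "f / g \<in> F - {0}"
    using assms divide_mem by auto
  from v_mult[OF this assms(2)] show ?thesis
    using assms by simp
qed

end

text \<open>The step is ramified at \<open>v\<close>: \<open>2 * g\<close> divides the values on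
  \<open>A\<close>, and \<open>v w\<close> is an odd multiple of \<open>g\<close>. In the tower
  \<open>g\<close> is \<open>4 * e\<close>, \<open>2 * e\<close>, \<open>e\<close>, so the
  divisibility after one step is the hypothesis of the next.\<close>

locale valued_step = valuation F v for F :: "'a::field set" and v +
  fixes A :: "'a set" and w :: 'a and g :: int
  assumes A: "subring_set A" and A_F: "A \<subseteq> F" and w_F: "w \<in> F - {0}" and w2': "w ^ 2 + w \<in> A"
    and g_pos: "g > 0"
    and even_A: "a \<in> A - {0} \<Longrightarrow> 2 * g dvd v a"
    and odd_w: "\<exists>c. odd c \<and> v w = g * c"
begin

interpretation A: subring_set A
  by (rule A)

lemma value_neq:
  assumes "a \<in> A - {0}" "b \<in> A - {0}"
  shows "v a \<noteq> v b + v w"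
proof
  assume eq: "v a = v b + v w"
  obtain i j c where "v a = 2 * g * i" "v b = 2 * g * j" "odd c" "v w = g * c"
    using even_A[OF assms(1)] even_A[OF assms(2)] odd_w by (auto elim!: dvdE)
  then have "g * (2 * i) = g * (2 * j + c)"
    using eq by (simp add: algebra_simps)
  then have "2 * i = 2 * j + c"
    using g_pos by simp
  then show False
    using \<open>odd c\<close> by presburger
qed

lemma bw_F: "b \<in> A - {0} \<Longrightarrow> b * w \<in> F - {0}" and v_bw: "b \<in> A - {0} \<Longrightarrow> v (b * w) = v b + v w"
  using A_F w_F mult_mem v_mult[of b w] by auto

lemma value_sum:
  assumes "a \<in> A - {0}" "b \<in> A - {0}"
  shows "a + b * w \<noteq> 0" "v (a + b * w) = min (v a) (v b + v w)"
proof -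
  have a: "a \<in> F - {0}"
    using assms(1) A_F by blast
  have "v a < v (b * w) \<or> v (b * w) < v a"
    using value_neq[OF assms] v_bw[OF assms(2)] by linarith
  then show "a + b * w \<noteq> 0" "v (a + b * w) = min (v a) (v b + v w)"
    using v_less[OF a bw_F[OF assms(2)]] v_less[OF bw_F[OF assms(2)] a] v_bw[OF assms(2)]
    by (auto simp: add.commute)
qed

sublocale step: as_step A w
proof unfold_locales
  show "a = 0 \<and> b = 0" if "a \<in> A" "b \<in> A" "a + b * w = 0" for a b
    using value_sum(1)[of a b] that w_F by (cases "a = 0"; cases "b = 0") auto
qed (use w2' A.add_mem A.uminus_mem A.mult_mem in auto)

lemma adjoin_F: "adjoin A w \<subseteq> F"
proof
  fix r
  assume "r \<in> adjoin A w"
  then obtain a b where "a \<in> A" "b \<in> A" "r = a + b * w"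
    by (elim step.adjoinE)
  then show "r \<in> F"
    using add_mem[OF subsetD[OF A_F] mult_mem[OF subsetD[OF A_F]], of a b w] w_F by simp
qed

lemma adjoin_cases:
  assumes "r \<in> adjoin A w - {0}"
  obtains a b where "a \<in> A" "b \<in> A" "r = a + b * w" "a \<noteq> 0" "b = 0 \<or> v a < v b + v w" "v r = v a"
  | a b where "a \<in> A" "b \<in> A" "r = a + b * w" "b \<noteq> 0" "a = 0 \<or> v b + v w < v a" "v r = v b + v w"
proof -
  obtain a b where ab: "a \<in> A" "b \<in> A" "r = a + b * w"
    using assms by (auto elim: step.adjoinE)
  consider "b = 0" "a \<noteq> 0" | "a = 0" "b \<noteq> 0" | "a \<noteq> 0" "b \<noteq> 0"
    using assms ab by (cases "a = 0"; cases "b = 0") auto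
  then show thesis
  proof cases
    case 1
    then show ?thesis
      using that(1)[of a b] ab by simp
  next
    case 2
    then show ?thesis
      using that(2)[of a b] ab v_bw[of b] by simp
  next
    case 3
    then have "v r = min (v a) (v b + v w)" "v a \<noteq> v b + v w"
      using value_sum[of a b] value_neq[of a b] ab by auto
    then show ?thesis
      using that(1)[OF ab] that(2)[OF ab] 3 by (cases "v a < v b + v w") auto
  qed
qed

lemma dvd_adjoin:
  assumes "r \<in> adjoin A w - {0}"
  shows "g dvd v r"
  using assms
proof (cases rule: adjoin_cases)
  case (1 a b)
  then show ?thesis
    using even_A[of a] dvd_mult_right[of g 2 "v a"] by (auto simp: mult.commute dest: dvd_mult_left)
next
  case (2 a b)
  then have "g dvd v b"
    using even_A[of b] by (auto simp: mult.commute dest: dvd_mult_left)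
  moreover have "g dvd v w"
    using odd_w by auto
  ultimately show ?thesis
    using 2 by simp
qed

lemma values_adjoin:
  "v ` (adjoin A w - {0}) = v ` (A - {0}) \<union> (\<lambda>k. k + v w) ` v ` (A - {0})"
proof (intro equalityI subsetI)
  fix k
  assume "k \<in> v ` (adjoin A w - {0})"
  then obtain r where r: "r \<in> adjoin A w - {0}" "k = v r"
    by blast
  from r(1) show "k \<in> v ` (A - {0}) \<union> (\<lambda>k. k + v w) ` v ` (A - {0})"
    by (cases rule: adjoin_cases) (auto simp: r(2))
next
  fix k
  assume "k \<in> v ` (A - {0}) \<union> (\<lambda>k. k + v w) ` v ` (A - {0})"
  then consider a where "a \<in> A - {0}" "k = v a" | b where "b \<in> A - {0}" "k = v b + v w"
    by auto
  then show "k \<in> v ` (adjoin A w - {0})"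
  proof cases
    case 1
    then show ?thesis
      using step.sub_adjoin by blast
  next
    case 2
    then have "b * w \<in> adjoin A w - {0}" "k = v (b * w)"
      using step.adjoinI[of 0 b] bw_F[of b] v_bw[of b] by auto
    then show ?thesis
      by blast
  qed
qed

text \<open>A substitute for the norm of degree \<open>j\<close> from \<open>C\<close> to
  \<open>B\<close>: the cofactor \<open>r'\<close> plays the role of the product of the other
  conjugates, and the factor \<open>j\<close> reflects that all conjugates have the same
  value.\<close>

definition norms_to :: "'a set \<Rightarrow> 'a set \<Rightarrow> int \<Rightarrow> bool" where
  "norms_to B C j \<longleftrightarrow> (\<forall>r\<in>C - {0}. \<exists>r'\<in>C - {0}. r * r' \<in> B - {0} \<and> v (r * r') = j * v r)"

text \<open>The conjugate of \<open>a + b * w\<close> is obtained by replacing \<open>w\<close> with \<open>- 1 - w\<close>.\<close>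

lemma norm_adjoin:
  assumes neg: "v w < 0" and r: "r \<in> adjoin A w - {0}"
  shows "\<exists>r'\<in>adjoin A w - {0}. r * r' \<in> A - {0} \<and> v (r * r') = 2 * v r"
proof -
  obtain a b where ab: "a \<in> A" "b \<in> A" "r = a + b * w"
    using r by (auto elim: step.adjoinE)
  define r' where "r' = (a - b) + (- b) * w"
  have eq: "r * r' = a * a - a * b - b * b * (w ^ 2 + w)"
    unfolding ab(3) r'_def by (simp add: algebra_simps power2_eq_square)
  have mem: "r * r' \<in> A"
    unfolding eq using ab w2' by (intro A.diff_mem A.mult_mem)
  have r'_mem: "r' \<in> adjoin A w"
    unfolding r'_def using ab by (intro step.adjoinI A.diff_mem A.uminus_mem)
  have "r' \<noteq> 0 \<and> v r' = v r"
  proof (cases "b = 0")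
    case True
    then show ?thesis
      using r ab by (simp add: r'_def)
  next
    case False
    have wF: "w \<in> F - {0}" "1 \<in> F - {0}"
      using w_F by auto
    \<comment> \<open>Since \<open>v w < 0 = v 1\<close>, passing to the conjugate
      \<open>- (w + 1)\<close> keeps the value of \<open>w\<close>.\<close>
    have w1: "w + 1 \<in> F - {0}" "v (w + 1) = v w"
      using v_less[OF wF] neg v_1 add_mem[of w 1] w_F by auto
    have "- b \<in> F - {0}" "v (- b) = v b"
      using False ab A_F uminus_mem v_uminus[of b] by auto
    then have bw: "(- b) * (w + 1) \<in> F - {0}" "v ((- b) * (w + 1)) = v b + v w"
      using v_mult[of "- b" "w + 1"] w1 mult_mem[of "- b" "w + 1"] by auto
    have r'_eq: "r' = a + (- b) * (w + 1)"
      by (simp add: r'_def algebra_simps)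
    show ?thesis
    proof (cases "a = 0")
      case True
      then show ?thesis
        using bw v_bw[of b] False ab by (auto simp: r'_eq)
    next
      case a: False
      have aF: "a \<in> F - {0}"
        using a ab A_F by auto
      have "v r = min (v a) (v b + v w)" "v a \<noteq> v b + v w"
        using value_sum[of a b] value_neq[of a b] ab a False by auto
      then show ?thesis
        unfolding r'_eq using v_less[OF aF bw(1)] v_less[OF bw(1) aF] bw(2)
        by (cases "v a < v b + v w") (auto simp: add.commute)
    qed
  qed
  moreover have "r \<in> F - {0}" "r' \<in> F"
    using r r'_mem adjoin_F by auto
  ultimately show ?thesis
    using mem r'_mem v_mult[of r r'] by (intro bexI[of _ r']) auto
qed

lemma norms_to_adjoin:
  assumes "norms_to B A j" "v w < 0"
  shows "norms_to B (adjoin A w) (2 * j)"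
  unfolding norms_to_def
proof
  fix r
  assume r: "r \<in> adjoin A w - {0}"
  obtain r' where r': "r' \<in> adjoin A w - {0}" "r * r' \<in> A - {0}" "v (r * r') = 2 * v r"
    using norm_adjoin[OF assms(2) r] by blast
  obtain s where s: "s \<in> A - {0}" "r * r' * s \<in> B - {0}" "v (r * r' * s) = j * v (r * r')"
    using assms(1) r'(2) unfolding norms_to_def by blast
  have "r' * s \<in> adjoin A w - {0}"
    using r' s step.sub_adjoin step.adj.mult_mem by auto
  moreover have "r * (r' * s) \<in> B - {0}" "v (r * (r' * s)) = 2 * j * v r"
    using s r'(3) by (simp_all add: mult.assoc)
  ultimately show "\<exists>r'\<in>adjoin A w - {0}. r * r' \<in> B - {0} \<and> v (r * r') = 2 * j * v r"
    by blast
qed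

text \<open>Elements of \<open>C\<close> with equal value agree to leading order up to a constant of
  \<open>K\<close>; this becomes \<open>ord_lead\<close>.\<close>

definition leading :: "'a set \<Rightarrow> 'a set \<Rightarrow> bool" where
  "leading K C \<longleftrightarrow> (\<forall>f\<in>C - {0}. \<forall>h\<in>C - {0}. v f = v h \<longrightarrow>
     (\<exists>k\<in>K - {0}. f - k * h = 0 \<or> v f < v (f - k * h)))"

lemma v_sum_greater:
  assumes "a = 0 \<or> (a \<in> F \<and> i < v a)" "b = 0 \<or> (b \<in> F \<and> i < v b)" "a + b \<noteq> 0"
  shows "i < v (a + b)"
  using assms v_add[of a b] by (cases "a = 0"; cases "b = 0") auto

text \<open>By \<open>value_neq\<close>, two elements of equal value are dominated by the same kind
  of summand. The constant that works for the dominating coefficients works for the whole elements,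
  because the remaining summands have strictly larger value.\<close>

lemma leading_adjoin:
  assumes lead: "leading K A" and K: "K \<subseteq> A" "\<And>k. k \<in> K - {0} \<Longrightarrow> v k = 0"
  shows "leading K (adjoin A w)"
  unfolding leading_def
proof (intro ballI impI)
  fix f h
  assume f: "f \<in> adjoin A w - {0}" and h: "h \<in> adjoin A w - {0}" and eq: "v f = v h"
  have scale: "b - k * b' = 0 \<or> (b - k * b' \<in> F \<and> i < v (b - k * b'))"
    if "b \<in> F" "b' \<in> F" "b = 0 \<or> i < v b" "b' = 0 \<or> i < v b'" "k \<in> K - {0}" for b b' k i
  proof (cases "b - k * b' = 0")
    case False
    have k: "- k \<in> F - {0}" "v (- k) = 0"
      using that(5) K A_F v_uminus[of k] uminus_mem by auto
    have b': "(- k) * b' = 0 \<or> ((- k) * b' \<in> F \<and> i < v ((- k) * b'))"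
    proof (cases "b' = 0")
      case False
      then have "v ((- k) * b') = v b'"
        using v_mult[OF k(1), of b'] k(2) that(2) by simp
      then show ?thesis
        using that(2,4) False k(1) mult_mem[of "- k" b'] by simp
    qed simp
    have "i < v (b + (- k) * b')"
      using that(1,3) b' False by (intro v_sum_greater) auto
    moreover have "b + (- k) * b' \<in> F"
      using that(1,2) k by (intro add_mem mult_mem) auto
    ultimately show ?thesis
      by simp
  qed simp
  have AF: "a \<in> F" if "a \<in> A" for a
    using that A_F by blast
  have finish: "f - k * h = 0 \<or> v f < v (f - k * h)"
    if "f = a + b * w" "h = a' + b' * w" "a - k * a' = 0 \<or> (a - k * a' \<in> F \<and> v f < v (a - k * a'))"
      "(b - k * b') * w = 0 \<or> ((b - k * b') * w \<in> F \<and> v f < v ((b - k * b') * w))" for a b a' b' k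
  proof -
    have "f - k * h = (a - k * a') + (b - k * b') * w"
      unfolding that(1,2) by (simp add: algebra_simps)
    then show ?thesis
      using v_sum_greater[OF that(3,4)] by auto
  qed
  from f show "\<exists>k\<in>K - {0}. f - k * h = 0 \<or> v f < v (f - k * h)"
  proof (cases rule: adjoin_cases)
    case f: (1 a b)
    from h show ?thesis
    proof (cases rule: adjoin_cases)
      case h: (1 a' b')
      obtain k where k: "k \<in> K - {0}" "a - k * a' = 0 \<or> v a < v (a - k * a')"
        using lead f h eq unfolding leading_def by (metis DiffI empty_iff insert_iff)
      have 1: "a - k * a' = 0 \<or> (a - k * a' \<in> F \<and> v f < v (a - k * a'))"
        using k f(6) AF[OF A.diff_mem[OF f(1) A.mult_mem[of k a']]] K(1) h(1) by auto
      have "b * w - k * (b' * w) = 0 \<or> (b * w - k * (b' * w) \<in> F \<and> v f < v (b * w - k * (b' * w)))"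
      proof (rule scale)
        show "b * w \<in> F" "b' * w \<in> F"
          using f h AF w_F mult_mem by auto
        show "b * w = 0 \<or> v f < v (b * w)" "b' * w = 0 \<or> v f < v (b' * w)"
          using f h eq v_bw[of b] v_bw[of b'] by auto
      qed (rule k(1))
      then have 2: "(b - k * b') * w = 0 \<or> ((b - k * b') * w \<in> F \<and> v f < v ((b - k * b') * w))"
        by (simp add: algebra_simps)
      show ?thesis
        using finish[OF f(3) h(3) 1 2] k(1) by blast
    next
      case h: (2 a' b')
      then show ?thesis
        using value_neq[of a b'] f eq by auto
    qed
  next
    case f: (2 a b)
    from h show ?thesis
    proof (cases rule: adjoin_cases)
      case h: (1 a' b')
      then show ?thesis
        using value_neq[of a' b] f eq by auto
    next
      case h: (2 a' b')
      obtain k where k: "k \<in> K - {0}" "b - k * b' = 0 \<or> v b < v (b - k * b')"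
        using lead f h eq unfolding leading_def by (metis DiffI add_right_cancel empty_iff insert_iff)
      have mem: "b - k * b' \<in> A"
        using k(1) K(1) f h by (intro A.diff_mem A.mult_mem) auto
      then have 2: "(b - k * b') * w = 0 \<or> ((b - k * b') * w \<in> F \<and> v f < v ((b - k * b') * w))"
        using k(2) f(6) bw_F[of "b - k * b'"] v_bw[of "b - k * b'"] by auto
      have 1: "a - k * a' = 0 \<or> (a - k * a' \<in> F \<and> v f < v (a - k * a'))"
        using f h eq AF k(1) by (intro scale) auto
      show ?thesis
        using finish[OF f(3) h(3) 1 2] k(1) by blast
    qed
  qed
qed

end

text \<open>The value of \<open>a + b * w\<close> is the minimum of the values of its summands,
  hence determined by the values on \<open>A\<close> and at \<open>w\<close>. Uniqueness of the
  place at infinity rests on this.\<close>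

lemma valued_steps_agree:
  assumes "valued_step F v A w g" "valued_step F v' A w g"
    and A: "\<And>a. a \<in> A - {0} \<Longrightarrow> v a = v' a" and w: "v w = v' w" and r: "r \<in> adjoin A w - {0}"
  shows "v r = v' r"
proof -
  interpret v: valued_step F v A w g by fact
  interpret v': valued_step F v' A w g by fact
  obtain a b where ab: "a \<in> A" "b \<in> A" "r = a + b * w"
    using r by (auto elim: v.step.adjoinE)
  consider "b = 0" "a \<noteq> 0" | "a = 0" "b \<noteq> 0" | "a \<noteq> 0" "b \<noteq> 0"
    using r ab by (cases "a = 0"; cases "b = 0") auto
  then show ?thesis
  proof cases
    case 1
    then show ?thesis
      using A[of a] ab by simp
  next
    case 2
    then show ?thesis
      using v.v_bw[of b] v'.v_bw[of b] A[of b] w ab by simp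
  next
    case 3
    then show ?thesis
      using v.value_sum(2)[of a b] v'.value_sum(2)[of a b] A[of a] A[of b] w ab by simp
  qed
qed

section \<open>The tower of function fields and the place at infinity\<close>

lemma place_valuation:
  assumes "subfield_set F" "v \<in> places K F"
  shows "valuation F v"
proof -
  interpret subfield_set F by fact
  show ?thesis
    using assms(2) unfolding places_def by unfold_locales blast+
qed

lemma eval_snoc:
  "ring.eval ring_of_type_algebra (xs @ [a]) z = ring.eval ring_of_type_algebra xs z * z + (a :: 'a::field)"
proof -
  interpret R: ring "ring_of_type_algebra :: 'a ring"
    by (rule ring_from_type_algebra)
  have pow: "z [^]\<^bsub>ring_of_type_algebra\<^esub> i = z ^ i" for i :: nat
    by (induction i) (simp_all add: mult.commute)
  show ?thesis
    by (induction xs) (simp_all add: pow algebra_simps)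
qed

text \<open>Polynomial lists of the algebra library have the leading coefficient first, hence
  \<open>rev\<close>.\<close>

lemma eval_rev: "ring.eval ring_of_type_algebra (rev xs) z = poly (Poly xs) (z :: 'a::field)"
proof -
  interpret R: ring "ring_of_type_algebra :: 'a ring"
    by (rule ring_from_type_algebra)
  show ?thesis
    by (induction xs) (simp_all add: eval_snoc mult.commute add.commute)
qed

lemma transcendental_poly_eq_0:
  assumes "ring.transcendental ring_of_type_algebra K (z :: 'a::field)" and "\<And>i. coeff p i \<in> K" "poly p z = 0"
  shows "p = 0"
proof (rule ccontr)
  assume "p \<noteq> 0"
  interpret R: ring "ring_of_type_algebra :: 'a ring"
    by (rule ring_from_type_algebra)
  let ?l = "rev (coeffs p)"
  have "set ?l \<subseteq> K"
    using assms(2) by (auto simp: coeffs_def split: if_splits)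
  moreover have "coeffs p \<noteq> []" "hd ?l \<noteq> 0"
    using \<open>p \<noteq> 0\<close> by (simp_all add: hd_rev last_coeffs_eq_coeff_degree)
  ultimately have "?l \<in> carrier (univ_poly ring_of_type_algebra K)"
    unfolding univ_poly_carrier[symmetric] polynomial_def by simp
  moreover have "[] \<in> carrier (univ_poly (ring_of_type_algebra :: 'a ring) K)"
    unfolding univ_poly_carrier[symmetric] polynomial_def by simp
  moreover have "R.eval ?l z = R.eval [] z"
    using assms(3) by (simp add: eval_rev)
  ultimately have "?l = []"
    using inj_onD[OF assms(1)[unfolded R.transcendental_def], of ?l "[]"] by blast
  then show False
    using \<open>coeffs p \<noteq> []\<close> by simp
qed

locale ggs_curve =
  fixes n m :: nat and K F :: "'a::field set" and x y z :: 'a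
  assumes n_ge_5: "5 \<le> n" and n_odd: "odd n" and m_eq: "m = (2 ^ n + 1) div 3"
    and curve: "GGS2_function_field n K F x y z"
begin

lemma subfield_K: "subfield K ring_of_type_algebra"
  and trans_z: "ring.transcendental ring_of_type_algebra K z"
  and x_eq: "x ^ 2 + x = y ^ 3"
  and y_eq': "y ^ 4 - y = z ^ m"
  and F_eq: "F = generate_field ring_of_type_algebra (K \<union> {x, y, z})"
  using curve m_eq by (simp_all add: GGS2_function_field_def)

sublocale ggs_field K n m
proof -
  interpret K: subfield_set K
    by (rule subfield_set_if_subfield[OF subfield_K])
  have card: "card K = 2 ^ (2 * n)"
    using curve by (simp add: GGS2_function_field_def)
  then have "finite K"
    by (metis card.infinite power_not_zero zero_neq_numeral)
  then interpret binary_field K n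
    using card n_odd by unfold_locales simp_all
  have "2 ^ n + 1 = (3 :: nat) * ((2 ^ n + 1) div 3)"
    using q_mod_3 by presburger
  then show "ggs_field K n m"
    unfolding m_eq by unfold_locales simp
qed

lemma y_eq: "y ^ 4 + y = z ^ m"
  using y_eq' by (simp add: diff_eq)

lemma odd_m: "odd m"
proof -
  have "even ((2 :: nat) ^ n)"
    using n_ge_5 by simp
  then have "odd (3 * m)"
    unfolding m by simp
  then show ?thesis
    by simp
qed

lemma z_nz: "z \<noteq> 0"
proof
  assume "z = 0"
  then have "poly [:0, 1:] z = 0"
    by simp
  moreover have "coeff [:0, 1:] i \<in> K" for i
    by (cases i; cases "i - 1") (auto simp: coeff_pCons split: nat.splits)
  ultimately show False
    using transcendental_poly_eq_0[OF trans_z, of "[:0, 1:]"] by simp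
qed

lemma y_nz: "y \<noteq> 0" and x_nz: "x \<noteq> 0"
  using y_eq x_eq z_nz m_pos by auto

sublocale FF: subfield_set F
proof -
  interpret R: field "ring_of_type_algebra :: 'a ring"
    by (rule field_from_type_algebra)
  show "subfield_set F"
    unfolding F_eq by (intro subfield_set_if_subfield R.generate_field_is_subfield) simp
qed

lemma K_F: "K \<subseteq> F" and x_F: "x \<in> F" and y_F: "y \<in> F" and z_F: "z \<in> F"
  unfolding F_eq by (auto intro: generate_field.incl)

lemma F_least:
  assumes "subfield_set E" "K \<subseteq> E" "x \<in> E" "y \<in> E" "z \<in> E"
  shows "F \<subseteq> E"
proof
  interpret E: subfield_set E by fact
  fix f
  assume "f \<in> F"
  then show "f \<in> E"
    unfolding F_eq
  proof (induction rule: generate_field.induct)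
    case (m_inv h)
    then show ?case
      using m_inv_ring_of_type_algebra[of h] E.inverse_mem by simp
  qed (use assms in \<open>auto intro: E.closed\<close>)
qed

definition Kpoly :: "'a poly set" where "Kpoly = {p. \<forall>i. coeff p i \<in> K}"

lemma Kpoly_pCons: "pCons a p \<in> Kpoly \<longleftrightarrow> a \<in> K \<and> p \<in> Kpoly"
proof
  assume "pCons a p \<in> Kpoly"
  then have *: "coeff (pCons a p) i \<in> K" for i
    by (simp add: Kpoly_def)
  show "a \<in> K \<and> p \<in> Kpoly"
    using *[of 0] *[of "Suc _"] by (simp add: Kpoly_def)
next
  assume "a \<in> K \<and> p \<in> Kpoly"
  then show "pCons a p \<in> Kpoly"
    by (simp add: Kpoly_def coeff_pCons split: nat.splits)
qed

lemma Kpoly_0 [simp]: "0 \<in> Kpoly"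
  by (simp add: Kpoly_def)

lemma Kpoly_const: "[:a:] \<in> Kpoly \<longleftrightarrow> a \<in> K"
  by (simp add: Kpoly_pCons)

lemma Kpoly_add: "p \<in> Kpoly \<Longrightarrow> r \<in> Kpoly \<Longrightarrow> p + r \<in> Kpoly"
  and Kpoly_uminus: "p \<in> Kpoly \<Longrightarrow> - p \<in> Kpoly"
  and Kpoly_mult: "p \<in> Kpoly \<Longrightarrow> r \<in> Kpoly \<Longrightarrow> p * r \<in> Kpoly"
  by (auto simp: Kpoly_def coeff_mult add_mem intro!: uminus_mem sum_mem mult_mem)

lemma Kpoly_eval_inj: "p \<in> Kpoly \<Longrightarrow> r \<in> Kpoly \<Longrightarrow> poly p z = poly r z \<Longrightarrow> p = r"
  using transcendental_poly_eq_0[OF trans_z, of "p + - r"] Kpoly_add[OF _ Kpoly_uminus, of p r]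
  by (simp add: Kpoly_def)

definition A0 :: "'a set" where "A0 = (\<lambda>p. poly p z) ` Kpoly"
definition t :: 'a where "t = y ^ 2 + y"
definition A1 :: "'a set" where "A1 = adjoin A0 t"
definition A2 :: "'a set" where "A2 = adjoin A1 y"
definition R :: "'a set" where "R = adjoin A2 x"

lemma A0I: "p \<in> Kpoly \<Longrightarrow> poly p z \<in> A0"
  by (simp add: A0_def)

lemma A0E:
  assumes "a \<in> A0"
  obtains p where "p \<in> Kpoly" "a = poly p z"
  using assms by (auto simp: A0_def)

lemma A0_nzE:
  assumes "a \<in> A0 - {0}"
  obtains p where "p \<in> Kpoly" "a = poly p z" "p \<noteq> 0"
proof -
  obtain p where p: "p \<in> Kpoly" "a = poly p z"
    using assms A0E by blast
  then have "p \<noteq> 0"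
    using assms by auto
  then show thesis
    using that p by blast
qed

sublocale A0: subring_set A0
proof
  show "0 \<in> A0"
    using A0I[of 0] by simp
  show "1 \<in> A0"
    using A0I[of "[:1:]"] by (simp add: Kpoly_const)
next
  fix a b
  assume "a \<in> A0" "b \<in> A0"
  then obtain p r where "p \<in> Kpoly" "a = poly p z" "r \<in> Kpoly" "b = poly r z"
    by (elim A0E)
  then show "a + b \<in> A0" "a * b \<in> A0"
    using A0I[OF Kpoly_add[of p r]] A0I[OF Kpoly_mult[of p r]] by simp_all
next
  fix a
  assume "a \<in> A0"
  then obtain p where "p \<in> Kpoly" "a = poly p z"
    by (elim A0E)
  then show "- a \<in> A0"
    using A0I[OF Kpoly_uminus[of p]] by simp
qed

lemma K_A0: "K \<subseteq> A0"
  using A0I[of "[:k:]" for k] by (auto simp: Kpoly_const)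

lemma z_A0: "z \<in> A0"
  using A0I[of "[:0, 1:]"] by (simp add: Kpoly_pCons)

lemma A0_F: "A0 \<subseteq> F"
proof
  fix a
  assume "a \<in> A0"
  then obtain p where p: "p \<in> Kpoly" "a = poly p z"
    by (elim A0E)
  from p(1) have "poly p z \<in> F"
  proof (induction p)
    case (pCons a p)
    then show ?case
      using K_F z_F by (auto simp: Kpoly_pCons intro!: FF.add_mem FF.mult_mem)
  qed simp
  then show "a \<in> F"
    using p by simp
qed

lemma t_eq: "t ^ 2 + t = z ^ m"
proof -
  have "t ^ 2 + t = (y ^ 4 + y ^ 2) + (y ^ 2 + y)"
    unfolding t_def sq_add by (simp flip: power_mult)
  also have "\<dots> = y ^ 4 + y"
    by (simp add: add_ac)
  finally show ?thesis
    using y_eq by simp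
qed

lemma t_A0: "t ^ 2 + t \<in> A0"
  unfolding t_eq by (intro A0.power_mem z_A0)

text \<open>\<open>y\<close> is integral over \<open>K[z]\<close> and \<open>x\<close> over
  \<open>K[y]\<close>: a pole of \<open>y\<close> or \<open>x\<close> at a place where
  \<open>z\<close> is regular would make one side of its equation have a pole of larger order than
  the other.\<close>

lemma infinity_place_z_neg:
  assumes "v \<in> places_at_infinity K F x y z"
  shows "v z < 0"
proof (rule ccontr)
  assume nonneg: "\<not> v z < 0"
  have v: "v \<in> places K F" and sing: "\<not> (regular_at v x \<and> regular_at v y \<and> regular_at v z)"
    using assms by (auto simp: places_at_infinity_def)
  interpret valuation F v
    by (rule place_valuation[OF FF.subfield_set_axioms v])
  have pow_F: "a ^ i \<in> F - {0}" if "a \<in> F - {0}" for a i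
    using that FF.power_mem by simp
  have y: "y \<in> F - {0}" and x: "x \<in> F - {0}" and z: "z \<in> F - {0}"
    using x_F y_F z_F x_nz y_nz z_nz by auto
  have "0 \<le> v y"
  proof (rule ccontr)
    assume "\<not> 0 \<le> v y"
    then have "v (y ^ 4 + y) = 4 * v y"
      using v_less(2)[OF pow_F[OF y, of 4] y] v_power[OF y, of 4] by simp
    moreover have "0 \<le> int m * v z"
      using nonneg by simp
    ultimately show False
      using \<open>\<not> 0 \<le> v y\<close> v_power[OF z, of m] unfolding y_eq by simp
  qed
  moreover have "0 \<le> v x"
  proof (rule ccontr)
    assume "\<not> 0 \<le> v x"
    then have "v (x ^ 2 + x) = 2 * v x"
      using v_less(2)[OF pow_F[OF x, of 2] x] v_power[OF x, of 2] by simp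
    then show False
      using \<open>0 \<le> v y\<close> \<open>\<not> 0 \<le> v x\<close> v_power[OF y, of 3] unfolding x_eq by simp
  qed
  ultimately show False
    using sing nonneg by (auto simp: regular_at_def)
qed

text \<open>Comparing dominant terms gives \<open>4 * v y = m * v z\<close> and
  \<open>2 * v x = 3 * v y\<close>, so \<open>8 * v x = 3 * m * v z\<close>; as \<open>3 * m\<close>
  is odd, 8 divides \<open>v z\<close>, and \<open>e\<close> is the quotient up to sign.\<close>

lemma infinity_place_values:
  assumes v: "v \<in> places K F" and neg: "v z < 0"
  shows "\<exists>e>0. v z = - 8 * e \<and> v t = - 4 * int m * e \<and> v y = - 2 * int m * e \<and> v x = - 3 * int m * e"
proof -
  interpret valuation F v
    by (rule place_valuation[OF FF.subfield_set_axioms v])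
  have pow_F: "a ^ i \<in> F - {0}" if "a \<in> F - {0}" for a i
    using that FF.power_mem by simp
  have y: "y \<in> F - {0}" and x: "x \<in> F - {0}" and z: "z \<in> F - {0}"
    using x_F y_F z_F x_nz y_nz z_nz by auto
  have mz: "v (y ^ 4 + y) = int m * v z" "v (x ^ 2 + x) = 3 * v y"
    unfolding y_eq x_eq using v_power[OF z, of m] v_power[OF y, of 3] by simp_all
  have neg_y: "v y < 0"
  proof (rule ccontr)
    assume nonneg: "\<not> v y < 0"
    have "y ^ 4 + y \<noteq> 0"
      unfolding y_eq using z_nz by simp
    then have "0 \<le> v (y ^ 4 + y)"
      using v_add[OF pow_F[OF y, of 4] y] v_power[OF y, of 4] nonneg by simp
    then show False
      using mz(1) neg m_pos by (simp add: zero_le_mult_iff)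
  qed
  then have y4: "4 * v y = int m * v z"
    using v_less(2)[OF pow_F[OF y, of 4] y] v_power[OF y, of 4] mz(1) by simp
  have neg_x: "v x < 0"
  proof (rule ccontr)
    assume nonneg: "\<not> v x < 0"
    have "x ^ 2 + x \<noteq> 0"
      unfolding x_eq using y_nz by simp
    then have "0 \<le> v (x ^ 2 + x)"
      using v_add[OF pow_F[OF x, of 2] x] v_power[OF x, of 2] nonneg by simp
    then show False
      using mz(2) neg_y by simp
  qed
  then have x2: "2 * v x = 3 * v y"
    using v_less(2)[OF pow_F[OF x, of 2] x] v_power[OF x, of 2] mz(2) by simp
  have t2: "v t = 2 * v y"
    unfolding t_def using v_less(2)[OF pow_F[OF y, of 2] y] v_power[OF y, of 2] neg_y by simp
  have "8 * v x = 3 * int m * v z"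
    using x2 y4 by simp
  then have "8 dvd (3 * int m) * v z"
    by (metis dvd_triv_left)
  moreover have "coprime (8 :: int) (3 * int m)"
  proof -
    have "odd (3 * int m)"
      using odd_m by simp
    then have "coprime ((2 :: int) ^ 3) (3 * int m)"
      unfolding coprime_power_left_iff coprime_left_2_iff_odd by simp
    then show ?thesis
      by simp
  qed
  ultimately have "8 dvd v z"
    by (simp add: coprime_dvd_mult_right_iff)
  then obtain k where k: "v z = 8 * k"
    by (elim dvdE)
  have "v z = - 8 * (- k) \<and> v t = - 4 * int m * (- k) \<and> v y = - 2 * int m * (- k) \<and> v x = - 3 * int m * (- k)"
    using k t2 x2 y4 by simp
  moreover have "- k > 0"
    using k neg by simp
  ultimately show ?thesis
    by blast
qed

lemma value_poly:
  assumes v: "v \<in> places K F" and neg: "v z < 0" and p: "p \<in> Kpoly" "p \<noteq> 0"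
  shows "v (poly p z) = int (degree p) * v z"
  using p
proof (induction p)
  case (pCons a p)
  interpret valuation F v
    by (rule place_valuation[OF FF.subfield_set_axioms v])
  have a: "a \<in> K" and p: "p \<in> Kpoly"
    using pCons.prems by (simp_all add: Kpoly_pCons)
  have va: "v a = 0" "a \<in> F" if "a \<noteq> 0"
    using v that a K_F unfolding places_def by auto
  show ?case
  proof (cases "p = 0")
    case True
    then show ?thesis
      using pCons.prems va by simp
  next
    case False
    have z: "z \<in> F - {0}"
      using z_F z_nz by simp
    have pz: "poly p z \<in> F - {0}"
      using A0I[OF p] A0_F Kpoly_eval_inj[OF p, of 0] False by auto
    have zp: "z * poly p z \<in> F - {0}" "v (z * poly p z) = int (degree (pCons a p)) * v z"
      using v_mult[OF z pz] pCons.IH[OF p False] z pz FF.mult_mem False by (auto simp: algebra_simps)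
    show ?thesis
    proof (cases "a = 0")
      case True
      then show ?thesis
        using zp(2) by simp
    next
      case a0: False
      have "v (z * poly p z) < 0"
        using zp(2) neg False by (simp add: mult_less_0_iff)
      then have "v (z * poly p z + a) = v (z * poly p z)"
        using v_less(2)[OF zp(1), of a] va[OF a0] a0 by simp
      then show ?thesis
        using zp(2) by (simp add: add.commute)
    qed
  qed
qed simp

lemma K_value: "v \<in> places K F \<Longrightarrow> k \<in> K - {0} \<Longrightarrow> v k = 0"
  by (simp add: places_def)

text \<open>The tower of quadratic extensions, with the index \<open>e\<close> of the value group not yet known to be 1.\<close>

lemma tower:
  assumes v: "v \<in> places K F" and e: "e > 0" and vz: "v z = - 8 * e" and vt: "v t = - 4 * int m * e"
    and vy: "v y = - 2 * int m * e" and vx: "v x = - 3 * int m * e"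
  shows "valued_step F v A0 t (4 * e)" "valued_step F v A1 y (2 * e)" "valued_step F v A2 x e"
proof -
  interpret valuation F v
    by (rule place_valuation[OF FF.subfield_set_axioms v])
  have neg: "v z < 0"
    using vz e by simp
  have "t \<noteq> 0"
    using t_eq z_nz by auto
  then have t_F: "t \<in> F - {0}"
    unfolding t_def using y_F FF.add_mem FF.power_mem by simp
  show s0: "valued_step F v A0 t (4 * e)"
  proof (unfold_locales)
    show "2 * (4 * e) dvd v a" if a: "a \<in> A0 - {0}" for a
    proof -
      obtain p where "p \<in> Kpoly" "a = poly p z" "p \<noteq> 0"
        using a by (elim A0_nzE)
      then have "v a = 2 * (4 * e) * (- int (degree p))"
        using value_poly[OF v neg, of p] a vz by auto
      then show ?thesis
        by simp
    qed
    show "\<exists>c. odd c \<and> v t = 4 * e * c"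
      using vt odd_m by (intro exI[of _ "- int m"]) simp
  qed (use e t_F t_A0 A0_F A0.subring_set_axioms in auto)
  interpret s0: valued_step F v A0 t "4 * e" by (rule s0)
  have y2: "y ^ 2 + y \<in> A1"
    using s0.step.w_adjoin unfolding t_def A1_def .
  interpret B1: subring_set A1
    unfolding A1_def by (rule s0.step.subring_adjoin)
  show s1: "valued_step F v A1 y (2 * e)"
  proof (unfold_locales)
    show "2 * (2 * e) dvd v a" if "a \<in> A1 - {0}" for a
      using s0.dvd_adjoin[of a] that by (simp add: A1_def)
    show "\<exists>c. odd c \<and> v y = 2 * e * c"
      using vy odd_m by (intro exI[of _ "- int m"]) simp
  qed (use e y_F y_nz y2 s0.adjoin_F[folded A1_def] in simp_all)
  interpret s1: valued_step F v A1 y "2 * e" by (rule s1)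
  have x2: "x ^ 2 + x \<in> A2"
    unfolding x_eq A2_def by (intro s1.step.adj.power_mem s1.step.w_adjoin)
  interpret B2: subring_set A2
    unfolding A2_def by (rule s1.step.subring_adjoin)
  show s2: "valued_step F v A2 x e"
  proof (unfold_locales)
    show "2 * e dvd v a" if "a \<in> A2 - {0}" for a
      using s1.dvd_adjoin[of a] that by (simp add: A2_def)
    show "\<exists>c. odd c \<and> v x = e * c"
      using vx odd_m by (intro exI[of _ "- 3 * int m"]) simp
  qed (use e x_F x_nz x2 s1.adjoin_F[folded A2_def] in simp_all)
qed

end

locale ggs_infinity = ggs_curve +
  fixes P :: "'a \<Rightarrow> int"
  assumes P_inf: "P \<in> places_at_infinity K F x y z"
begin

lemma P: "P \<in> places K F"
  using P_inf by (simp add: places_at_infinity_def)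

text \<open>The values are first known up to the factor \<open>e\<close> only. It divides all values
  on \<open>R\<close>, hence on the fraction field \<open>F\<close> of \<open>R\<close>; as a place
  attains the value 1, \<open>e = 1\<close>.\<close>

lemma fractions_R: "fractions R = F" and P_z: "P z = - 8" and P_t: "P t = - 4 * int m"
  and P_y: "P y = - 2 * int m" and P_x: "P x = - 3 * int m"
proof -
  obtain e where e: "e > 0" "P z = - 8 * e" "P t = - 4 * int m * e" "P y = - 2 * int m * e" "P x = - 3 * int m * e"
    using infinity_place_values[OF P infinity_place_z_neg[OF P_inf]] by blast
  interpret s0: valued_step F P A0 t "4 * e" by (rule tower[OF P e])
  interpret s1: valued_step F P A1 y "2 * e" by (rule tower[OF P e])
  interpret s2: valued_step F P A2 x e by (rule tower[OF P e])
  interpret R: subring_set R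
    unfolding R_def by (rule s2.step.subring_adjoin)
  have R_F: "R \<subseteq> F"
    unfolding R_def by (rule s2.adjoin_F)
  have A2_R: "A2 \<subseteq> R"
    unfolding R_def by (rule s2.step.sub_adjoin)
  have A1_R: "A1 \<subseteq> R"
    using s1.step.sub_adjoin A2_R unfolding A2_def by blast
  have A0_R: "A0 \<subseteq> R"
    using s0.step.sub_adjoin A1_R unfolding A1_def by blast
  have xyz: "x \<in> R" "y \<in> R" "z \<in> R"
    using s2.step.w_adjoin s1.step.w_adjoin A2_R z_A0 A0_R unfolding R_def A2_def by auto
  have fracI: "r / d \<in> fractions R" if "r \<in> R" "d \<in> R" "d \<noteq> 0" for r d
    using that unfolding fractions_def by blast
  have R_frac: "r \<in> fractions R" if "r \<in> R" for r
    using fracI[OF that R.one_mem] by simp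
  have "subfield_set (fractions R)"
  proof
    show "0 \<in> fractions R" "1 \<in> fractions R"
      using R_frac by simp_all
  next
    fix a b
    assume "a \<in> fractions R" "b \<in> fractions R"
    then obtain r d r' d' where *: "a = r / d" "r \<in> R" "d \<in> R" "d \<noteq> 0" "b = r' / d'" "r' \<in> R" "d' \<in> R" "d' \<noteq> 0"
      unfolding fractions_def by blast
    have "a + b = (r * d' + r' * d) / (d * d')" "a * b = (r * r') / (d * d')"
      using * by (simp_all add: add_frac_eq)
    moreover have "r * d' + r' * d \<in> R" "r * r' \<in> R" "d * d' \<in> R" "d * d' \<noteq> 0"
      using * by (auto intro!: R.add_mem R.mult_mem)
    ultimately show "a + b \<in> fractions R" "a * b \<in> fractions R"
      using fracI by metis+
  next
    fix a
    assume "a \<in> fractions R"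
    then obtain r d where *: "a = r / d" "r \<in> R" "d \<in> R" "d \<noteq> 0"
      unfolding fractions_def by blast
    show "- a \<in> fractions R"
      using fracI[OF R.uminus_mem[OF *(2)] *(3,4)] * by simp
    show "inverse a \<in> fractions R"
      using fracI[OF *(3,2)] * R_frac[OF R.zero_mem] by (cases "r = 0") simp_all
  qed
  then have "F \<subseteq> fractions R"
    using K_A0 A0_R xyz R_frac by (intro F_least) auto
  moreover have "fractions R \<subseteq> F"
    using R_F FF.divide_mem unfolding fractions_def by auto
  ultimately show frac: "fractions R = F"
    by blast
  have "e dvd P f" if f: "f \<in> F - {0}" for f
  proof -
    obtain r d where *: "f = r / d" "r \<in> R" "d \<in> R" "d \<noteq> 0"
      using f frac unfolding fractions_def by blast
    have "r \<noteq> 0"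
      using * f by auto
    then have "P f = P r - P d" "e dvd P r" "e dvd P d"
      using * R_F s0.v_divide[of r d] s2.dvd_adjoin[of r] s2.dvd_adjoin[of d] unfolding R_def by auto
    then show ?thesis
      by simp
  qed
  moreover obtain u where "u \<in> F - {0}" "P u = 1"
    using P unfolding places_def by blast
  ultimately have "e dvd 1"
    by metis
  then have "e = 1"
    using e(1) by simp
  then show "P z = - 8" "P t = - 4 * int m" "P y = - 2 * int m" "P x = - 3 * int m"
    using e by simp_all
qed

sublocale s0: valued_step F P A0 t 4
  using tower(1)[OF P, of 1] P_z P_t P_y P_x by simp

sublocale s1: valued_step F P A1 y 2
  using tower(2)[OF P, of 1] P_z P_t P_y P_x by simp

sublocale s2: valued_step F P A2 x 1
  using tower(3)[OF P, of 1] P_z P_t P_y P_x by simp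

sublocale R: subring_set R
  unfolding R_def by (rule s2.step.subring_adjoin)

lemma R_F: "R \<subseteq> F"
  unfolding R_def by (rule s2.adjoin_F)

lemma A2_R: "A2 \<subseteq> R" and A1_A2: "A1 \<subseteq> A2" and A0_A1: "A0 \<subseteq> A1"
  using s2.step.sub_adjoin s1.step.sub_adjoin s0.step.sub_adjoin
  unfolding R_def A2_def A1_def by blast+

lemma A0_R: "A0 \<subseteq> R" and K_R: "K \<subseteq> R"
  using A2_R A1_A2 A0_A1 K_A0 by blast+

lemma x_R: "x \<in> R" and y_A2: "y \<in> A2" and t_A1: "t \<in> A1"
  using s2.step.w_adjoin s1.step.w_adjoin s0.step.w_adjoin
  unfolding R_def A2_def A1_def by blast+

lemma y_R: "y \<in> R" and z_R: "z \<in> R"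
  using y_A2 A2_R z_A0 A0_R by blast+

text \<open>Two such places agree on \<open>z\<close> and hence on \<open>K[z]\<close>, then on each
  step of the tower by \<open>valued_steps_agree\<close>, and finally on quotients.\<close>

lemma infinity_place_unique:
  assumes "v \<in> places_at_infinity K F x y z"
  shows "v = P"
proof -
  interpret v: ggs_infinity n m K F x y z v
    using assms by unfold_locales
  have 0: "v a = P a" if "a \<in> A0 - {0}" for a
  proof -
    obtain p where "p \<in> Kpoly" "a = poly p z" "p \<noteq> 0"
      using \<open>a \<in> A0 - {0}\<close> by (elim A0_nzE)
    then show ?thesis
      using value_poly[OF v.P, of p] value_poly[OF P, of p] that P_z v.P_z by auto
  qed
  have 1: "v a = P a" if "a \<in> A1 - {0}" for a
    using valued_steps_agree[OF v.s0.valued_step_axioms s0.valued_step_axioms 0, of a] that P_t v.P_t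
    by (simp add: A1_def)
  have 2: "v a = P a" if "a \<in> A2 - {0}" for a
    using valued_steps_agree[OF v.s1.valued_step_axioms s1.valued_step_axioms 1, of a] that P_y v.P_y
    by (simp add: A2_def)
  have 3: "v a = P a" if "a \<in> R - {0}" for a
    using valued_steps_agree[OF v.s2.valued_step_axioms s2.valued_step_axioms 2, of a] that P_x v.P_x
    by (simp add: R_def)
  show ?thesis
  proof
    fix f
    show "v f = P f"
    proof (cases "f \<in> F - {0}")
      case True
      then obtain r d where *: "f = r / d" "r \<in> R" "d \<in> R" "d \<noteq> 0"
        using fractions_R unfolding fractions_def by blast
      then have "r \<noteq> 0"
        using True by auto
      then have "r \<in> F - {0}" "d \<in> F - {0}" "v r = P r" "v d = P d"
        using * R_F 3 by auto
      then show ?thesis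
        using s0.v_divide[of r d] v.s0.v_divide[of r d] * by (simp del: Diff_iff)
    next
      case False
      then show ?thesis
        using P v.P unfolding places_def by (simp add: \<open>f \<notin> F - {0}\<close>)
    qed
  qed
qed

lemma P_nonpos_A0: "a \<in> A0 - {0} \<Longrightarrow> P a \<le> 0"
  and A0_const: "\<lbrakk>a \<in> A0 - {0}; P a = 0\<rbrakk> \<Longrightarrow> a \<in> K"
proof -
  assume a: "a \<in> A0 - {0}"
  then obtain p where p: "p \<in> Kpoly" "a = poly p z" "p \<noteq> 0"
    by (elim A0_nzE)
  then have Pa: "P a = - 8 * int (degree p)"
    using value_poly[OF P, of p] P_z by simp
  then show "P a \<le> 0"
    by simp
  show "a \<in> K" if "P a = 0"
  proof -
    have "degree p = 0"
      using that Pa by simp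
    then obtain k where "p = [:k:]"
      by (metis degree_eq_zeroE)
    then show ?thesis
      using p by (simp add: Kpoly_const)
  qed
qed

text \<open>Each step adjoins the old values shifted by \<open>P t\<close>, \<open>P y\<close> or
  \<open>P x\<close>; conversely the monomials in \<open>z, t, y, x\<close> attain all of
  them.\<close>

lemma image_values_R: "P ` (R - {0}) = (\<lambda>s. - int s) ` ggs_semigroup m"
proof -
  have V0: "P ` (A0 - {0}) = {- 8 * int k | k. True}"
  proof (intro equalityI subsetI)
    fix i
    assume "i \<in> P ` (A0 - {0})"
    then obtain a where "a \<in> A0 - {0}" "i = P a"
      by blast
    then obtain p where "p \<in> Kpoly" "i = P (poly p z)" "p \<noteq> 0"
      by (metis A0_nzE)
    then show "i \<in> {- 8 * int k | k. True}"
      using value_poly[OF P, of p] P_z by auto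
  next
    fix i
    assume "i \<in> {- 8 * int k | k. True}"
    then obtain k where "i = - 8 * int k"
      by blast
    then have "i = P (z ^ k)"
      using s0.v_power[of z k] z_F z_nz P_z by simp
    moreover have "z ^ k \<in> A0 - {0}"
      using z_A0 z_nz A0.power_mem by simp
    ultimately show "i \<in> P ` (A0 - {0})"
      by blast
  qed
  have V: "P ` (R - {0}) = (let V1 = P ` (A0 - {0}) \<union> (\<lambda>k. k + P t) ` P ` (A0 - {0}); V2 = V1 \<union> (\<lambda>k. k + P y) ` V1
     in V2 \<union> (\<lambda>k. k + P x) ` V2)"
    using s2.values_adjoin s1.values_adjoin s0.values_adjoin unfolding R_def A2_def A1_def Let_def by simp
  show ?thesis
  proof (intro equalityI subsetI)
    fix i
    assume "i \<in> P ` (R - {0})"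
    then obtain k a b c where "i = - 8 * int k - 4 * int m * int a - 2 * int m * int b - 3 * int m * int c"
      "a \<le> 1" "b \<le> 1" "c \<le> 1"
    proof -
      assume i: "i \<in> P ` (R - {0})"
      assume that: "\<And>k a b c. i = - 8 * int k - 4 * int m * int a - 2 * int m * int b - 3 * int m * int c \<Longrightarrow>
        a \<le> 1 \<Longrightarrow> b \<le> 1 \<Longrightarrow> c \<le> 1 \<Longrightarrow> thesis"
      from i show thesis
        unfolding V V0 P_t P_y P_x Let_def
        using that[of _ 0 0 0] that[of _ 1 0 0] that[of _ 0 1 0] that[of _ 1 1 0]
          that[of _ 0 0 1] that[of _ 1 0 1] that[of _ 0 1 1] that[of _ 1 1 1] by (auto simp: algebra_simps)
    qed
    then have "i = - int (8 * k + 4 * m * a + 2 * m * b + 3 * m * c)" "a \<le> 1" "b \<le> 1" "c \<le> 1"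
      by simp_all
    then show "i \<in> (\<lambda>s. - int s) ` ggs_semigroup m"
      unfolding ggs_semigroup_def by blast
  next
    fix i
    assume "i \<in> (\<lambda>s. - int s) ` ggs_semigroup m"
    then obtain k a b c where i: "i = - int (8 * k + 4 * m * a + 2 * m * b + 3 * m * c)" and abc: "a \<le> 1" "b \<le> 1" "c \<le> 1"
      unfolding ggs_semigroup_def by blast
    have xyz: "x \<in> F - {0}" "y \<in> F - {0}" "z \<in> F - {0}" "t \<in> F - {0}"
      using x_F y_F z_F x_nz y_nz z_nz s0.w_F by auto
    have pow: "f ^ j \<in> F - {0}" if "f \<in> F - {0}" for f j
      using that FF.power_mem by simp
    have mult: "f * h \<in> F - {0}" if "f \<in> F - {0}" "h \<in> F - {0}" for f h
      using that FF.mult_mem by simp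
    have "P (z ^ k * (t ^ a * (y ^ b * x ^ c))) = i"
      using xyz by (simp add: s0.v_mult s0.v_power pow mult P_z P_t P_y P_x i del: Diff_iff)
    moreover have "z ^ k * (t ^ a * (y ^ b * x ^ c)) \<in> R"
      using z_R t_A1 A1_A2 A2_R y_R x_R by (intro R.mult_mem R.power_mem) auto
    moreover have "z ^ k * (t ^ a * (y ^ b * x ^ c)) \<noteq> 0"
      using xyz by simp
    ultimately show "i \<in> P ` (R - {0})"
      by blast
  qed
qed

lemma leading_R: "s0.leading K R"
proof -
  have "s0.leading K A0"
    unfolding s0.leading_def
  proof (intro ballI impI)
    fix f h
    assume f: "f \<in> A0 - {0}" and h: "h \<in> A0 - {0}" and eq: "P f = P h"
    obtain p where p: "p \<in> Kpoly" "f = poly p z" "p \<noteq> 0"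
      using f by (elim A0_nzE)
    obtain r where r: "r \<in> Kpoly" "h = poly r z" "r \<noteq> 0"
      using h by (elim A0_nzE)
    have deg: "degree p = degree r"
      using eq p r value_poly[OF P, of p] value_poly[OF P, of r] P_z by simp
    define k where "k = lead_coeff p / lead_coeff r"
    have k: "k \<in> K - {0}"
      using p r divide_mem by (auto simp: k_def Kpoly_def)
    define s where "s = p + - ([:k:] * r)"
    have s: "s \<in> Kpoly" "poly s z = f - k * h"
    proof -
      show "s \<in> Kpoly"
        unfolding s_def using p r k by (intro Kpoly_add Kpoly_uminus Kpoly_mult) (simp_all add: Kpoly_const)
      show "poly s z = f - k * h"
        using p r by (simp add: s_def)
    qed
    have "f - k * h = 0 \<or> P f < P (f - k * h)"
    proof (cases "s = 0")
      case False
      have "degree s \<le> degree p"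
        unfolding s_def using deg by (intro degree_add_le) (auto intro: order_trans[OF degree_smult_le])
      moreover have "coeff s (degree p) = 0"
        using r(3) deg by (simp add: s_def k_def)
      ultimately have "degree s < degree p"
        using False by (metis le_neq_implies_less leading_coeff_0_iff)
      then show ?thesis
        using value_poly[OF P, of s] value_poly[OF P, of p] P_z False s p by simp
    qed (use s in simp)
    then show "\<exists>k\<in>K - {0}. f - k * h = 0 \<or> P f < P (f - k * h)"
      using k by blast
  qed
  then have "s0.leading K A1"
    unfolding A1_def using K_A0 K_value[OF P] by (intro s0.leading_adjoin)
  then have "s0.leading K A2"
    unfolding A2_def using K_A0 A0_A1 K_value[OF P] s1.leading_adjoin by blast
  then show ?thesis
    unfolding R_def using K_A0 A0_A1 A1_A2 K_value[OF P] s2.leading_adjoin by blast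
qed

text \<open>The conjugation cofactors of the three steps multiply to a norm of degree 8 down to
  \<open>K[z]\<close>.\<close>

lemma norm_R:
  assumes "r \<in> R - {0}"
  shows "\<exists>r'\<in>R - {0}. r * r' \<in> A0 - {0} \<and> P (r * r') = 8 * P r"
proof -
  have "s0.norms_to A0 A0 1"
    unfolding s0.norms_to_def using A0.one_mem by (intro ballI bexI[of _ 1]) auto
  then have "s0.norms_to A0 A1 (2 * 1)"
    unfolding A1_def using P_t m_pos by (intro s0.norms_to_adjoin) simp_all
  then have "s0.norms_to A0 A2 (2 * (2 * 1))"
    unfolding A2_def using P_y m_pos by (intro s1.norms_to_adjoin) simp_all
  then have "s0.norms_to A0 R (2 * (2 * (2 * 1)))"
    unfolding R_def using P_x m_pos by (intro s2.norms_to_adjoin) simp_all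
  then show ?thesis
    using assms unfolding s0.norms_to_def by simp
qed

end

section \<open>Functions regular outside the place at infinity, and rational places\<close>

lemma (in dvr_prime) ord_at_M:
  assumes "h \<in> M" "h \<noteq> 0"
  shows "0 < ord_at h"
proof -
  obtain r where r: "r \<in> R" "e * h = \<pi> * r"
    using e_M assms(1) by blast
  have eh: "e \<in> R - M" "e \<noteq> 0" "h \<in> R"
    using e_mem e_notin unit_nz M_sub assms(1) by auto
  then have "\<pi> * r \<noteq> 0"
    using r(2) assms(2) by (metis mult_eq_0_iff)
  then have "r \<noteq> 0"
    by auto
  have "ord_at (e * h) = ord_at e + ord_at h" "ord_at (\<pi> * r) = ord_at \<pi> + ord_at r"
    using eh r(1) assms(2) \<open>r \<noteq> 0\<close> pi_R pi_nz R_fractions by (auto intro!: ord_at_mult)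
  then show ?thesis
    using r(2) ord_at_unit[OF eh(1)] ord_at_pi ord_at_R_nonneg[OF r(1) \<open>r \<noteq> 0\<close>] by simp
qed

lemma eval_hom_power:
  assumes "eval_hom K A h" "subring_set A" "1 \<in> K" "a \<in> A"
  shows "h (a ^ i) = h a ^ i"
proof -
  interpret A: subring_set A by fact
  show ?thesis
    using assms(1,3,4) by (induction i) (auto simp: eval_hom_def A.power_mem)
qed

lemma finite_maximal_image:
  assumes "finite (f ` E)" "E \<noteq> {}"
  shows "\<exists>e\<in>E. \<forall>e'\<in>E. f e \<subseteq> f e' \<longrightarrow> f e' = f e"
proof -
  obtain M where "M \<in> f ` E" "\<forall>b\<in>f ` E. M \<subseteq> b \<longrightarrow> M = b"
    using finite_has_maximal[of "f ` E"] assms by blast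
  then show ?thesis
    by auto
qed

context ggs_infinity
begin

text \<open>So \<open>R\<close> is \<open>K[x, y, z]\<close>, the coordinate ring of the affine
  curve.\<close>

lemma R_least:
  assumes "subring_set E" "K \<subseteq> E" "x \<in> E" "y \<in> E" "z \<in> E"
  shows "R \<subseteq> E"
proof -
  interpret E: subring_set E by fact
  have step: "adjoin A w \<subseteq> E" if "A \<subseteq> E" "w \<in> E" for A w
    unfolding adjoin_def using E.add_mem[OF subsetD[OF that(1)] E.mult_mem[OF subsetD[OF that(1)] that(2)]]
    by auto
  have "poly p z \<in> E" if "p \<in> Kpoly" for p
    using that
  proof (induction p)
    case (pCons a p)
    then show ?case
      using assms(2,5) by (auto simp: Kpoly_pCons intro!: E.add_mem E.mult_mem)
  qed simp
  then have "A0 \<subseteq> E"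
    by (auto simp: A0_def)
  moreover have "t \<in> E"
    unfolding t_def using assms(4) by (intro E.add_mem E.power_mem)
  ultimately show ?thesis
    unfolding R_def A2_def A1_def using assms by (intro step)
qed

lemma regular_ring:
  assumes Q: "Q \<in> places K F"
  shows "subring_set {f \<in> F. regular_at Q f}" and "K \<subseteq> {f \<in> F. regular_at Q f}"
proof -
  interpret Q: valuation F Q
    by (rule place_valuation[OF FF.subfield_set_axioms Q])
  show "subring_set {f \<in> F. regular_at Q f}"
  proof
    fix a b
    assume ab: "a \<in> {f \<in> F. regular_at Q f}" "b \<in> {f \<in> F. regular_at Q f}"
    then show "a + b \<in> {f \<in> F. regular_at Q f}"
      using Q.v_add[of a b] FF.add_mem by (cases "a = 0"; cases "b = 0"; cases "a + b = 0") (auto simp: regular_at_def)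
    show "a * b \<in> {f \<in> F. regular_at Q f}"
      using Q.v_mult[of a b] FF.mult_mem ab by (cases "a = 0"; cases "b = 0") (auto simp: regular_at_def)
  next
    fix a
    assume "a \<in> {f \<in> F. regular_at Q f}"
    then show "- a \<in> {f \<in> F. regular_at Q f}"
      by (simp add: uminus_eq)
  qed (simp_all add: regular_at_def Q.v_1)
  show "K \<subseteq> {f \<in> F. regular_at Q f}"
  proof
    fix k
    assume "k \<in> K"
    then show "k \<in> {f \<in> F. regular_at Q f}"
      using K_value[OF Q, of k] K_F by (cases "k = 0") (auto simp: regular_at_def)
  qed
qed

lemma regular_on_R:
  assumes "Q \<in> places K F" "Q \<noteq> P" "r \<in> R"
  shows "regular_at Q r"
proof -
  have "Q \<notin> places_at_infinity K F x y z"
    using assms(2) infinity_place_unique by blast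
  then have "regular_at Q x" "regular_at Q y" "regular_at Q z"
    using assms(1) by (auto simp: places_at_infinity_def)
  then have "R \<subseteq> {f \<in> F. regular_at Q f}"
    using regular_ring[OF assms(1)] x_F y_F z_F by (intro R_least) auto
  then show ?thesis
    using assms(3) by blast
qed

section \<open>Euclidean arithmetic of \<open>K[z]\<close>, with \<open>- P / 8\<close> as the
  degree\<close>

lemma A0_division:
  assumes d: "d \<in> A0 - {0}" and a: "a \<in> A0"
  shows "\<exists>s\<in>A0. \<exists>r\<in>A0. a = d * s + r \<and> (r = 0 \<or> P d < P r)"
  using a
proof (induction "nat (- P a)" arbitrary: a rule: less_induct)
  case less
  show ?case
  proof (cases "a = 0 \<or> P d < P a")
    case True
    then show ?thesis
      using less.prems by (intro bexI[of _ 0] bexI[of _ a]) auto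
  next
    case False
    then have a: "a \<in> A0 - {0}" "P a \<le> P d"
      using less.prems by auto
    have "8 dvd P a" "8 dvd P d"
      using s0.even_A[OF a(1)] s0.even_A[OF d] by simp_all
    then obtain i where i: "P d - P a = 8 * i"
      by (metis dvd_diff dvdE)
    define j where "j = nat i"
    have j: "P a = P d - 8 * int j"
      using i a(2) by (simp add: j_def)
    define h where "h = z ^ j * d"
    have zj: "z ^ j \<in> A0 - {0}" "P (z ^ j) = - 8 * int j"
      using z_A0 z_nz A0.power_mem s0.v_power[of z j] z_F P_z by auto
    have h: "h \<in> A0 - {0}" "P h = P a"
      using zj d j A0_F A0.mult_mem s0.v_mult[of "z ^ j" d] by (auto simp: h_def)
    have hR: "h \<in> R - {0}" "a \<in> R - {0}"
      using h a A0_R by auto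
    obtain k where k: "k \<in> K - {0}" "a - k * h = 0 \<or> P a < P (a - k * h)"
      using leading_R[unfolded s0.leading_def, rule_format, OF hR(2,1)] h(2) by auto
    have kA: "k \<in> A0"
      using k(1) K_A0 by blast
    have mem: "a - k * h \<in> A0"
      using a h kA by (intro A0.diff_mem A0.mult_mem) auto
    have "\<exists>s\<in>A0. \<exists>r\<in>A0. a - k * h = d * s + r \<and> (r = 0 \<or> P d < P r)"
    proof (cases "a - k * h = 0")
      case True
      then show ?thesis
        by (intro bexI[of _ 0]) auto
    next
      case False
      then have "P (a - k * h) \<le> 0"
        using P_nonpos_A0 mem by blast
      then have "nat (- P (a - k * h)) < nat (- P a)"
        using k(2) False by linarith
      then show ?thesis
        using less.hyps mem by blast
    qed
    then obtain s r where sr: "s \<in> A0" "r \<in> A0" "a - k * h = d * s + r" "r = 0 \<or> P d < P r"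
      by blast
    have "a = d * (s + k * z ^ j) + r"
      using sr(3) unfolding h_def by (simp add: algebra_simps)
    moreover have "s + k * z ^ j \<in> A0"
      using sr zj kA by (intro A0.add_mem A0.mult_mem) auto
    ultimately show ?thesis
      using sr by blast
  qed
qed

text \<open>For \<open>d\<close> in \<open>A0\<close>: the quotient of \<open>A0\<close> by
  \<open>d\<close> is a field or zero, so \<open>d\<close> is prime or a unit.\<close>

definition bezout :: "'a \<Rightarrow> bool" where
  "bezout d \<longleftrightarrow> (\<forall>c\<in>A0. c \<in> multiples d A0 \<or> (\<exists>l\<in>A0. \<exists>u\<in>A0. l * d + u * c = 1))"

lemma A0_inverse:
  assumes "a \<in> A0 - {0}" "P a = 0"
  shows "inverse a \<in> A0"
  using A0_const[OF assms] inverse_mem K_A0 by blast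

lemma bezout_linear:
  assumes d: "d \<in> A0 - {0}" "P d = - 8"
  shows "bezout d"
  unfolding bezout_def
proof
  fix c
  assume c: "c \<in> A0"
  obtain s r where sr: "s \<in> A0" "r \<in> A0" "c = d * s + r" "r = 0 \<or> P d < P r"
    using A0_division[OF d(1) c] by blast
  show "c \<in> multiples d A0 \<or> (\<exists>l\<in>A0. \<exists>u\<in>A0. l * d + u * c = 1)"
  proof (cases "r = 0")
    case True
    then show ?thesis
      using sr A0.multiplesI by simp
  next
    case False
    have "8 dvd P r" "P r \<le> 0"
      using s0.even_A[of r] P_nonpos_A0[of r] sr(2) False by simp_all
    then have "P r = 0"
      using sr(4) False d(2) by (auto elim!: dvdE)
    then have inv: "inverse r \<in> A0"
      using A0_inverse sr(2) False by simp
    have "(- (inverse r * s)) * d + inverse r * c = 1"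
      using False sr(3) by (simp add: field_simps)
    moreover have "- (inverse r * s) \<in> A0"
      using inv sr(1) by (intro A0.uminus_mem A0.mult_mem)
    ultimately show ?thesis
      using inv by blast
  qed
qed

text \<open>If \<open>l * d + u * h = 1\<close>, then \<open>h = d * (l * h) + u * h ^ 2\<close>, so
  \<open>d\<close> divides \<open>h\<close> as soon as it divides \<open>h ^ 2\<close>. The three
  steps preserve this.\<close>

lemma bezout_reduced:
  assumes "bezout d" "d \<in> A0"
  shows "reduced_mod d R"
proof -
  have "reduced_mod d A0"
    unfolding reduced_mod_def
  proof (intro ballI impI)
    fix h
    assume h: "h \<in> A0" "h ^ 2 \<in> multiples d A0"
    show "h \<in> multiples d A0"
    proof (rule ccontr)
      assume "h \<notin> multiples d A0"
      then obtain l u where lu: "l \<in> A0" "u \<in> A0" "l * d + u * h = 1"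
        using assms(1) h(1) unfolding bezout_def by blast
      have "h = (l * d + u * h) * h"
        using lu(3) by simp
      also have "\<dots> = d * (l * h) + u * h ^ 2"
        by (simp add: algebra_simps power2_eq_square)
      also have "\<dots> \<in> multiples d A0"
        using lu h by (intro A0.multiples_add A0.multiplesI A0.multiples_mult A0.mult_mem)
      finally show False
        using \<open>h \<notin> multiples d A0\<close> by simp
    qed
  qed
  then have "reduced_mod d A1"
    unfolding A1_def by (rule s0.step.reduced_mod_adjoin[OF two_eq_0 assms(2)])
  then have "reduced_mod d A2"
    unfolding A2_def using A0_A1 assms(2) by (intro s1.step.reduced_mod_adjoin[OF two_eq_0]) auto
  then show ?thesis
    unfolding R_def using A0_A1 A1_A2 assms(2) by (intro s2.step.reduced_mod_adjoin[OF two_eq_0]) auto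
qed

text \<open>Remainders modulo \<open>d\<close> have bounded degree and coefficients in the finite
  field \<open>K\<close>; the three steps preserve finiteness.\<close>

lemma finite_mod_R:
  assumes d: "d \<in> A0 - {0}"
  shows "finite_mod d R"
proof -
  define N where "N = nat (- P d)"
  define T where "T = {r \<in> A0. r = 0 \<or> P d < P r}"
  have "T \<subseteq> (\<lambda>xs. poly (Poly xs) z) ` {xs. set xs \<subseteq> K \<and> length xs \<le> N + 1}"
  proof
    fix r
    assume r: "r \<in> T"
    then obtain p where p: "p \<in> Kpoly" "r = poly p z"
      by (auto simp: T_def elim: A0E)
    have "degree p \<le> N"
    proof (cases "p = 0")
      case False
      then have "r \<noteq> 0"
        using p Kpoly_eval_inj[of p 0] by auto
      then have "P d < - 8 * int (degree p)"
        using r p value_poly[OF P, of p] False P_z by (simp add: T_def)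
      then show ?thesis
        by (simp add: N_def)
    qed simp
    then have "length (coeffs p) \<le> N + 1"
      by (cases "p = 0") (simp_all add: length_coeffs_degree)
    moreover have "set (coeffs p) \<subseteq> K"
      using p(1) by (auto simp: Kpoly_def coeffs_def split: if_splits)
    ultimately show "r \<in> (\<lambda>xs. poly (Poly xs) z) ` {xs. set xs \<subseteq> K \<and> length xs \<le> N + 1}"
      using p(2) by (intro image_eqI[of _ _ "coeffs p"]) simp_all
  qed
  then have "finite T"
    using finite_lists_length_le[OF fin] finite_surj by blast
  moreover have "\<exists>r\<in>T. a - r \<in> multiples d A0" if a: "a \<in> A0" for a
  proof -
    obtain s r where sr: "s \<in> A0" "r \<in> A0" "a = d * s + r" "r = 0 \<or> P d < P r"
      using A0_division[OF d a] by blast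
    then have "a - r \<in> multiples d A0"
      using A0.multiplesI[of s d] by simp
    then show ?thesis
      using sr by (auto simp: T_def)
  qed
  ultimately have "finite_mod d A0"
    unfolding finite_mod_def by (intro exI[of _ T]) (auto simp: T_def)
  then have "finite_mod d A1"
    unfolding A1_def using d by (intro s0.step.finite_mod_adjoin) auto
  then have "finite_mod d A2"
    unfolding A2_def using A0_A1 d by (intro s1.step.finite_mod_adjoin) auto
  then show ?thesis
    unfolding R_def using A0_A1 A1_A2 d by (intro s2.step.finite_mod_adjoin) auto
qed

lemma factor_power:
  assumes d: "d \<in> A0 - {0}" "P d < 0" and c: "c \<in> A0 - {0}"
  shows "\<exists>j c'. c' \<in> A0 - {0} \<and> c = d ^ j * c' \<and> c' \<notin> multiples d A0"
  using c
proof (induction "nat (- P c)" arbitrary: c rule: less_induct)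
  case less
  show ?case
  proof (cases "c \<in> multiples d A0")
    case False
    then show ?thesis
      using less.prems by (intro exI[of _ 0] exI[of _ c]) simp
  next
    case True
    then obtain c1 where c1: "c1 \<in> A0" "c = d * c1"
      by (elim multiplesE)
    then have nz: "c1 \<in> A0 - {0}"
      using less.prems by auto
    have "P c = P d + P c1"
      using s0.v_mult[of d c1] d nz A0_F c1(2) by auto
    then have "nat (- P c1) < nat (- P c)"
      using d(2) P_nonpos_A0[OF nz] by linarith
    then obtain j c' where "c' \<in> A0 - {0}" "c1 = d ^ j * c'" "c' \<notin> multiples d A0"
      using less.hyps nz by blast
    then show ?thesis
      using c1(2) by (intro exI[of _ "Suc j"] exI[of _ c']) (simp add: mult.assoc)
  qed
qed

text \<open>Only \<open>bounded\<close> needs work. Write the norm of \<open>f\<close> as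
  \<open>d ^ j * c\<close> with \<open>c\<close> prime to \<open>d\<close>; the Bezout relation
  keeps \<open>c\<close> out of \<open>M\<close>. If \<open>s * f = d ^ k * r\<close> with
  \<open>k > j\<close>, cancelling \<open>d ^ j\<close> would put \<open>s * c\<close> into
  \<open>M\<close>.\<close>

lemma dvr_primeI:
  assumes d: "d \<in> A0 - {0}" "bezout d"
    and M: "M \<subseteq> R" "1 \<notin> M" "\<And>g h. g \<in> M \<Longrightarrow> h \<in> M \<Longrightarrow> g + h \<in> M" "\<And>r h. r \<in> R \<Longrightarrow> h \<in> M \<Longrightarrow> r * h \<in> M"
    and prime: "\<And>r s. r \<in> R \<Longrightarrow> s \<in> R \<Longrightarrow> r * s \<in> M \<Longrightarrow> r \<in> M \<or> s \<in> M"
    and dM: "d \<in> M" and e: "e \<in> R" "e \<notin> M" "\<And>h. h \<in> M \<Longrightarrow> e * h \<in> multiples d R"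
  shows "dvr_prime R M d e"
proof unfold_locales
  show "\<exists>r\<in>R. e * h = d * r" if "h \<in> M" for h
    using e(3)[OF that] by (elim multiplesE) blast
  fix f
  assume f: "f \<in> R" "f \<noteq> 0"
  have "P d < 0"
  proof (rule ccontr)
    assume "\<not> P d < 0"
    then have "inverse d \<in> A0"
      using P_nonpos_A0[OF d(1)] A0_inverse[OF d(1)] by simp
    then have "inverse d * d \<in> M"
      using M(4) dM A0_R by blast
    then show False
      using M(2) d(1) by simp
  qed
  obtain f' where f': "f' \<in> R" "f * f' \<in> A0 - {0}"
    using norm_R[of f] f by blast
  obtain j c where c: "c \<in> A0 - {0}" "f * f' = d ^ j * c" "c \<notin> multiples d A0"
    using factor_power[OF d(1) \<open>P d < 0\<close> f'(2)] by blast
  have "c \<notin> M"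
  proof
    assume "c \<in> M"
    obtain l u where lu: "l \<in> A0" "u \<in> A0" "l * d + u * c = 1"
      using d(2) c unfolding bezout_def by blast
    then have "l * d + u * c \<in> M"
      using M(3,4) dM \<open>c \<in> M\<close> A0_R by blast
    then show False
      using lu(3) M(2) by simp
  qed
  show "\<exists>k0. \<forall>k s r. s \<in> R - M \<longrightarrow> r \<in> R \<longrightarrow> s * f = d ^ k * r \<longrightarrow> k \<le> k0"
  proof (intro exI allI impI)
    fix k s r
    assume s: "s \<in> R - M" and r: "r \<in> R" and eq: "s * f = d ^ k * r"
    show "k \<le> j"
    proof (rule ccontr)
      assume "\<not> k \<le> j"
      then have k: "k = j + Suc (k - j - 1)"
        by simp
      define i where "i = k - j - 1"
      have "d ^ j * (s * c) = (s * f) * f'"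
        using c(2) by (metis mult.assoc mult.left_commute)
      also have "\<dots> = d ^ (j + Suc i) * (r * f')"
        using eq k by (simp add: i_def mult.assoc)
      also have "\<dots> = d ^ j * ((d ^ i * (r * f')) * d)"
        by (simp add: power_add ac_simps)
      finally have "s * c = (d ^ i * (r * f')) * d"
        using d(1) by simp
      moreover have "d ^ i * (r * f') \<in> R"
        using d(1) r f' A0_R by (intro R.mult_mem R.power_mem) auto
      ultimately have "s * c \<in> M"
        using M(4) dM by metis
      then show False
        using prime[of s c] s c(1) \<open>c \<notin> M\<close> A0_R by auto
    qed
  qed
qed (use assms in auto)

text \<open>Functions regular outside \<open>P\<close> lie in \<open>R\<close>: otherwise take such a \<open>g\<close> and a denominator \<open>d\<close> of minimal
  degree. Then \<open>d\<close> is prime in \<open>A0\<close>, and an annihilator of a multiple of \<open>d g\<close> in \<open>R / d R\<close> that is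
  maximal among such annihilators is the centre of a place where \<open>g\<close> has a pole.\<close>

lemma regular_outside_P_in_R:
  assumes f: "f \<in> F" "\<And>Q. Q \<in> places K F - {P} \<Longrightarrow> regular_at Q f"
  shows "f \<in> R"
proof (rule ccontr)
  assume fR: "f \<notin> R"
  define E where "E = {g \<in> F. \<forall>Q\<in>places K F - {P}. regular_at Q g}"
  have E_mult: "g * h \<in> E" if "g \<in> E" "h \<in> E" for g h
  proof -
    have "regular_at Q (g * h)" if Q: "Q \<in> places K F - {P}" for Q
    proof -
      interpret S: subring_set "{f \<in> F. regular_at Q f}"
        using regular_ring(1) Q by blast
      show ?thesis
        using S.mult_mem[of g h] \<open>g \<in> E\<close> \<open>h \<in> E\<close> Q by (simp add: E_def)
    qed
    then show ?thesis
      using that FF.mult_mem by (simp add: E_def)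
  qed
  have R_E: "R \<subseteq> E"
    using R_F regular_on_R by (auto simp: E_def)
  define good where "good d \<longleftrightarrow> d \<in> A0 - {0} \<and> (\<exists>g\<in>E - R. d * g \<in> R)" for d
  have "\<exists>d. good d"
  proof -
    obtain r d where rd: "f = r / d" "r \<in> R" "d \<in> R" "d \<noteq> 0"
      using f(1) fractions_R unfolding fractions_def by blast
    obtain d' where d': "d' \<in> R" "d * d' \<in> A0 - {0}"
      using norm_R[of d] rd by blast
    have "d * d' * f = r * d'"
      using rd by simp
    then have "d * d' * f \<in> R"
      using rd d' R.mult_mem by simp
    then show ?thesis
      using d'(2) f fR unfolding good_def E_def by (intro exI[of _ "d * d'"]) blast
  qed
  then obtain d where d_good: "good d" and d_min: "\<And>d'. good d' \<Longrightarrow> nat (- P d) \<le> nat (- P d')"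
    using ex_has_least_nat[of good _ "\<lambda>d. nat (- P d)"] by blast
  then obtain g where d: "d \<in> A0 - {0}" and g: "g \<in> E" "g \<notin> R" "d * g \<in> R"
    unfolding good_def by blast
  have d_min': "P d' \<le> P d" if "good d'" for d'
    using d_min[OF that] P_nonpos_A0[of d'] P_nonpos_A0[OF d] that by (simp add: good_def)
  \<comment> \<open>Let \<open>b\<close> generate the ideal of \<open>d\<close> and
    \<open>c\<close>, with \<open>d = b * s\<close>. If \<open>b\<close> is not constant,
    \<open>s\<close> has smaller degree than \<open>d\<close> and is not a bad denominator, so
    \<open>b * g\<close> lies in \<open>R\<close>. Then \<open>b\<close> itself is bad, minimality
    makes \<open>s\<close> constant, and \<open>d\<close> divides \<open>c\<close>.\<close>
  have "bezout d"
    unfolding bezout_def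
  proof
    fix c
    assume c: "c \<in> A0"
    define I where "I = {l * d + u * c | l u. l \<in> A0 \<and> u \<in> A0}"
    have d_I: "d \<in> I"
      unfolding I_def by (intro CollectI exI[of _ 1] exI[of _ 0]) simp
    have c_I: "c \<in> I"
      unfolding I_def by (intro CollectI exI[of _ 0] exI[of _ 1]) simp
    have I_A0: "I \<subseteq> A0"
      using c d by (auto simp: I_def intro!: A0.add_mem A0.mult_mem)
    have I_comb: "a - b * s \<in> I" if ab: "a \<in> I" "b \<in> I" "s \<in> A0" for a b s
    proof -
      obtain l u l' u' where *: "l \<in> A0" "u \<in> A0" "a = l * d + u * c" "l' \<in> A0" "u' \<in> A0" "b = l' * d + u' * c"
        using ab unfolding I_def by blast
      have "a - b * s = (l - l' * s) * d + (u - u' * s) * c"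
        unfolding *(3,6) by (simp add: algebra_simps)
      moreover have "l - l' * s \<in> A0" "u - u' * s \<in> A0"
        using * ab(3) by (intro A0.diff_mem A0.mult_mem; simp)+
      ultimately show ?thesis
        unfolding I_def by blast
    qed
    obtain b where b: "b \<in> I - {0}" and b_min: "\<And>b'. b' \<in> I - {0} \<Longrightarrow> nat (- P b) \<le> nat (- P b')"
      using ex_has_least_nat[of "\<lambda>b. b \<in> I - {0}" d "\<lambda>b. nat (- P b)"] d_I d by blast
    have b_A0: "b \<in> A0 - {0}"
      using b I_A0 by blast
    have b_dvd: "\<exists>s\<in>A0. a = b * s" if a: "a \<in> I" for a
    proof -
      obtain s r where sr: "s \<in> A0" "r \<in> A0" "a = b * s + r" "r = 0 \<or> P b < P r"
        using A0_division[OF b_A0, of a] a I_A0 by blast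
      have "r = a - b * s"
        using sr(3) by simp
      then have "r \<in> I"
        using I_comb[OF a _ sr(1), of b] b by (simp only: DiffD1)
      have "r = 0"
      proof (rule ccontr)
        assume "r \<noteq> 0"
        then show False
          using b_min[of r] \<open>r \<in> I\<close> sr(2,4) P_nonpos_A0[of r] P_nonpos_A0[OF b_A0] by simp
      qed
      then show ?thesis
        using sr by auto
    qed
    obtain s where s: "s \<in> A0" "d = b * s"
      using b_dvd[OF d_I] by blast
    have s_nz: "s \<in> A0 - {0}"
      using s d by auto
    have Pd: "P d = P b + P s"
      using s0.v_mult[of b s] b_A0 s_nz A0_F s(2) by auto
    show "c \<in> multiples d A0 \<or> (\<exists>l\<in>A0. \<exists>u\<in>A0. l * d + u * c = 1)"
    proof (cases "P b = 0")
      case True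
      obtain l u where lu: "l \<in> A0" "u \<in> A0" "b = l * d + u * c"
        using b unfolding I_def by blast
      have "inverse b * l * d + inverse b * u * c = inverse b * b"
        unfolding lu(3) by (simp add: algebra_simps)
      then have "inverse b * l * d + inverse b * u * c = 1"
        using b by simp
      then show ?thesis
        using A0.mult_mem[OF A0_inverse[OF b_A0 True]] lu by blast
    next
      case False
      then have "P d < P s"
        using P_nonpos_A0[OF b_A0] Pd by simp
      then have "\<not> good s"
        using d_min'[of s] by auto
      moreover have "b * g \<in> E" "s * (b * g) \<in> R"
        using E_mult[of b g] b_A0 A0_R R_E g s(2) by (auto simp: ac_simps)
      ultimately have "b * g \<in> R"
        using s_nz unfolding good_def by blast
      then have "good b"
        unfolding good_def using b_A0 g by blast
      then have "P b \<le> P d"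
        by (rule d_min')
      then have "P s = 0"
        using Pd P_nonpos_A0[OF s_nz] by simp
      obtain s' where s': "s' \<in> A0" "c = b * s'"
        using b_dvd[OF c_I] by blast
      have "c = d * (inverse s * s')"
        using s(2) s'(2) s_nz by simp
      moreover have "inverse s * s' \<in> A0"
        using A0_inverse[OF s_nz \<open>P s = 0\<close>] s'(1) by (intro A0.mult_mem)
      ultimately show ?thesis
        using A0.multiplesI by blast
    qed
  qed
  have dR: "d \<in> R" "d \<noteq> 0"
    using d A0_R by auto
  have red: "h \<in> multiples d R" if "h \<in> R" "h ^ 2 \<in> multiples d R" for h
    using bezout_reduced[OF \<open>bezout d\<close>] d that by (simp add: reduced_mod_def)
  \<comment> \<open>A nonzero class modulo \<open>d R\<close>. A place where \<open>d\<close> has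
    positive value and \<open>e0\<close> does not vanish is a place where \<open>g\<close> has a
    pole.\<close>
  define e0 where "e0 = d * g"
  have e0_R: "e0 \<in> R"
    using g by (simp add: e0_def)
  have e0: "e0 \<notin> multiples d R"
  proof
    assume "e0 \<in> multiples d R"
    then obtain r where "r \<in> R" "d * g = d * r"
      unfolding e0_def by (elim multiplesE)
    then show False
      using g(2) dR by simp
  qed
  define annih where "annih e = {h \<in> R. e * h \<in> multiples d R}" for e
  define cand where "cand = (\<lambda>h. h * e0) ` R - multiples d R"
  have cand_R: "cand \<subseteq> R"
    using e0_R R.mult_mem by (auto simp: cand_def)
  \<comment> \<open>The annihilator depends only on the class modulo \<open>d R\<close>, and there
    are finitely many classes.\<close>
  have "finite (annih ` cand)"
  proof -
    obtain T where T: "T \<subseteq> R" "finite T" "\<And>a. a \<in> R \<Longrightarrow> \<exists>s\<in>T. a - s \<in> multiples d R"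
      using finite_mod_R[OF d] unfolding finite_mod_def by blast
    have "annih ` cand \<subseteq> annih ` T"
    proof (rule image_subsetI)
      fix e
      assume "e \<in> cand"
      then obtain s where s: "s \<in> T" "e - s \<in> multiples d R"
        using T(3) cand_R by blast
      have "e * h \<in> multiples d R \<longleftrightarrow> s * h \<in> multiples d R" if "h \<in> R" for h
      proof -
        have "h * (e - s) \<in> multiples d R"
          using s(2) that by (rule R.multiples_mult)
        moreover have "e * h = s * h + h * (e - s)" "s * h = e * h - h * (e - s)"
          by (simp_all add: algebra_simps del: diff_eq)
        ultimately show ?thesis
          using R.multiples_add R.multiples_diff by metis
      qed
      then have "annih e = annih s"
        unfolding annih_def by blast
      then show "annih e \<in> annih ` T"
        using s(1) by blast
    qed
    then show ?thesis
      using T(2) finite_surj by blast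
  qed
  moreover have "e0 \<in> cand"
    unfolding cand_def using e0 by (intro DiffI image_eqI[of _ _ 1]) simp_all
  ultimately obtain e where e: "e \<in> cand" and e_max: "\<And>e'. e' \<in> cand \<Longrightarrow> annih e \<subseteq> annih e' \<Longrightarrow> annih e' = annih e"
    using finite_maximal_image[of annih cand] by blast
  obtain h0 where h0: "h0 \<in> R" "e = h0 * e0" and e_nm: "e \<notin> multiples d R"
    using e unfolding cand_def by blast
  have e_R: "e \<in> R"
    using e cand_R by blast
  \<comment> \<open>Here reducedness enters: \<open>e\<close> lies outside its own annihilator, so
    it can serve as the element to be inverted.\<close>
  have ee: "e * e \<notin> multiples d R"
    using red[OF e_R] e_nm by (auto simp: power2_eq_square)
  have "dvr_prime R (annih e) d e"
  proof (rule dvr_primeI[OF d \<open>bezout d\<close>])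
    show "annih e \<subseteq> R" "1 \<notin> annih e" "e \<notin> annih e"
      using e_nm ee by (auto simp: annih_def)
    show "a + b \<in> annih e" if "a \<in> annih e" "b \<in> annih e" for a b
      using that R.multiples_add[of "e * a" d "e * b"] R.add_mem by (simp add: annih_def distrib_left)
    show "r * h \<in> annih e" if "r \<in> R" "h \<in> annih e" for r h
      using that R.multiples_mult[of "e * h" d r] R.mult_mem by (simp add: annih_def mult.left_commute)
    \<comment> \<open>If \<open>s\<close> is not in the annihilator, \<open>e * s\<close> is still a
      candidate and its annihilator is at least as large. By maximality they are equal, and
      \<open>r\<close> annihilates \<open>e * s\<close>.\<close>
    show "r \<in> annih e \<or> s \<in> annih e" if rs: "r \<in> R" "s \<in> R" "r * s \<in> annih e" for r s
    proof (rule ccontr)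
      assume neg: "\<not> (r \<in> annih e \<or> s \<in> annih e)"
      have "e * s \<notin> multiples d R"
        using neg rs by (simp add: annih_def)
      moreover have "e * s = (h0 * s) * e0" "h0 * s \<in> R"
        using h0 rs R.mult_mem by (simp_all add: ac_simps)
      ultimately have "e * s \<in> cand"
        unfolding cand_def by blast
      moreover have "annih e \<subseteq> annih (e * s)"
      proof
        fix h
        assume h: "h \<in> annih e"
        then have "s * (e * h) \<in> multiples d R"
          using R.multiples_mult[OF _ rs(2)] by (simp add: annih_def)
        moreover have "s * (e * h) = e * s * h"
          by simp
        ultimately show "h \<in> annih (e * s)"
          using h by (simp only: annih_def mem_Collect_eq)
      qed
      ultimately have "annih (e * s) = annih e"
        by (rule e_max)
      moreover have "r \<in> annih (e * s)"
        using rs by (simp add: annih_def ac_simps)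
      ultimately show False
        using neg by simp
    qed
    show "d \<in> annih e"
      unfolding annih_def using dR R.multiplesI[OF e_R, of d] by (simp add: mult.commute)
    show "e \<in> R"
      by (rule e_R)
    show "e * h \<in> multiples d R" if "h \<in> annih e" for h
      using that by (simp add: annih_def)
  qed
  then interpret M: dvr_prime R "annih e" d e .
  have place: "M.ord_at \<in> places K F"
    using M.ord_at_place[OF K_R inverse_mem] unfolding fractions_R .
  have "0 \<le> M.ord_at z"
    using M.ord_at_R_nonneg z_R z_nz by blast
  then have "M.ord_at \<noteq> P"
    using P_z by auto
  \<comment> \<open>Since \<open>e\<close> is a multiple of \<open>e0\<close>, otherwise
    \<open>e * e\<close> would be in \<open>d R\<close>. So \<open>e0 = d * g\<close> has value 0
    while \<open>d\<close> has value 1, and \<open>g\<close> has a pole.\<close>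
  have "e0 \<notin> annih e"
  proof
    assume "e0 \<in> annih e"
    then have "h0 * (e * e0) \<in> multiples d R"
      using h0(1) R.multiples_mult by (simp add: annih_def)
    then show False
      using ee h0(2) by (simp add: ac_simps)
  qed
  then have "M.ord_at e0 = 0"
    using M.ord_at_unit e0_R by blast
  moreover have "g \<in> fractions R - {0}"
    using g fractions_R by (auto simp: E_def)
  then have "M.ord_at e0 = M.ord_at d + M.ord_at g"
    unfolding e0_def using dR M.R_fractions by (intro M.ord_at_mult) auto
  ultimately have "M.ord_at g < 0"
    using M.ord_at_pi by simp
  moreover have "regular_at M.ord_at g"
    using g(1) place \<open>M.ord_at \<noteq> P\<close> by (simp add: E_def)
  ultimately show False
    using \<open>g \<in> fractions R - {0}\<close> by (auto simp: regular_at_def)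
qed

section \<open>Evaluation at affine points and degree-one places\<close>

lemma A0_eval_hom:
  assumes c: "c \<in> K"
  shows "\<exists>h. eval_hom K A0 h \<and> (\<forall>p\<in>Kpoly. h (poly p z) = poly p c) \<and> kernel_generated (z - c) A0 h"
proof -
  define h where "h f = poly (THE p. p \<in> Kpoly \<and> f = poly p z) c" for f
  have h: "h (poly p z) = poly p c" if "p \<in> Kpoly" for p
  proof -
    have "(THE p'. p' \<in> Kpoly \<and> poly p z = poly p' z) = p"
      using that Kpoly_eval_inj by (intro the_equality) auto
    then show ?thesis
      by (simp add: h_def)
  qed
  have poly_K: "poly p c \<in> K" if "p \<in> Kpoly" for p
    using that c by (induction p) (auto simp: Kpoly_pCons intro!: add_mem mult_mem)
  have hom: "eval_hom K A0 h"
    unfolding eval_hom_def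
  proof (intro conjI ballI)
    show "h a \<in> K" if "a \<in> A0" for a
      using that h poly_K by (auto elim: A0E)
    show "h k = k" if "k \<in> K" for k
      using h[of "[:k:]"] that by (simp add: Kpoly_const)
    fix a b
    assume "a \<in> A0" "b \<in> A0"
    then obtain p r where "p \<in> Kpoly" "a = poly p z" "r \<in> Kpoly" "b = poly r z"
      by (elim A0E)
    then show "h (a + b) = h a + h b" "h (a * b) = h a * h b"
      using h[OF Kpoly_add[of p r]] h[OF Kpoly_mult[of p r]] h[of p] h[of r] by simp_all
  qed
  have zc: "z - c \<in> A0 - {0}" "P (z - c) = - 8" "h (z - c) = 0"
  proof -
    have p: "[:- c, 1:] \<in> Kpoly" "poly [:- c, 1:] z = z - c"
      using c uminus_mem by (simp_all add: Kpoly_pCons)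
    then show "z - c \<in> A0 - {0}"
      using A0I[OF p(1)] Kpoly_eval_inj[OF p(1), of 0] by auto
    show "P (z - c) = - 8"
      using value_poly[OF P _ p(1)] P_z p(2) by simp
    show "h (z - c) = 0"
      using h[OF p(1)] p(2) by simp
  qed
  have "a \<in> multiples (z - c) A0" if a: "a \<in> A0" "h a = 0" for a
  proof -
    obtain s r where sr: "s \<in> A0" "r \<in> A0" "a = (z - c) * s + r" "r = 0 \<or> P (z - c) < P r"
      using A0_division[OF zc(1) a(1)] by blast
    have "h a = h (z - c) * h s + h r"
      unfolding sr(3) using hom zc(1) sr(1,2) A0.mult_mem[of "z - c" s] by (simp add: eval_hom_def)
    then have "h r = 0"
      using a(2) zc(3) by simp
    \<comment> \<open>A remainder modulo the linear polynomial \<open>z - c\<close> is a constant,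
      so it equals its own value under \<open>h\<close>, which is 0.\<close>
    have "r = 0"
    proof (rule ccontr)
      assume r0: "r \<noteq> 0"
      have "8 dvd P r" "P r \<le> 0" "- 8 < P r"
        using s0.even_A[of r] P_nonpos_A0[of r] sr(2,4) r0 zc(2) by simp_all
      then have "P r = 0"
        by (auto elim!: dvdE)
      then have "h r = r"
        using A0_const[of r] r0 sr(2) hom by (simp add: eval_hom_def)
      then show False
        using \<open>h r = 0\<close> r0 by simp
    qed
    then show ?thesis
      using sr A0.multiplesI by simp
  qed
  moreover have "h 1 = 1"
    using hom by (simp add: eval_hom_def)
  ultimately have "kernel_generated (z - c) A0 h"
    unfolding kernel_generated_def by (intro bexI[of _ 1]) simp_all
  then show ?thesis
    using hom h by blast
qed

text \<open>Evaluation at \<open>(c, b, a)\<close> is built along the tower, together with the fact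
  that \<open>z - c\<close> is a local generator of its kernel.\<close>

lemma point_hom:
  assumes pt: "(c, b, a) \<in> affine_points"
  shows "\<exists>h. eval_hom K R h \<and> h z = c \<and> h y = b \<and> h x = a \<and> kernel_generated (z - c) R h"
proof -
  have cba: "c \<in> K" "b \<in> K" "a \<in> K" "b ^ 4 + b = c ^ m" "a ^ 2 + a = b ^ 3"
    using pt by (simp_all add: affine_points_def)
  have K: "subring_set K" "K \<subseteq> A0" "K \<subseteq> A1" "K \<subseteq> A2"
    using subring_set_axioms K_A0 A0_A1 A1_A2 by auto
  have zc: "z - c \<in> A0" "z - c \<in> A1" "z - c \<in> A2"
    using A0.diff_mem[OF z_A0, of c] cba(1) K_A0 A0_A1 A1_A2 by auto
  obtain h0 where h0: "eval_hom K A0 h0" "\<And>p. p \<in> Kpoly \<Longrightarrow> h0 (poly p z) = poly p c"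
    "kernel_generated (z - c) A0 h0"
    using A0_eval_hom[OF cba(1)] by blast
  have h0z: "h0 z = c"
    using h0(2)[of "[:0, 1:]"] by (simp add: Kpoly_pCons)
  \<comment> \<open>The value of the intermediate generator \<open>t = y ^ 2 + y\<close> at the
    point.\<close>
  define s where "s = b ^ 2 + b"
  have s: "s \<in> K" "s ^ 2 + s = h0 (t ^ 2 + t)"
  proof -
    show "s \<in> K"
      unfolding s_def using cba(2) by (intro add_mem power_mem)
    have "s ^ 2 + s = (b ^ 4 + b ^ 2) + (b ^ 2 + b)"
      unfolding s_def sq_add by (simp flip: power_mult)
    also have "\<dots> = c ^ m"
      using cba(4) by (simp add: add_ac)
    also have "\<dots> = h0 (t ^ 2 + t)"
      unfolding t_eq using eval_hom_power[OF h0(1) A0.subring_set_axioms one_mem z_A0, of m] h0z by simp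
    finally show "s ^ 2 + s = h0 (t ^ 2 + t)" .
  qed
  obtain h1 where h1: "eval_hom K A1 h1" "h1 t = s" "\<forall>a\<in>A0. h1 a = h0 a"
    "\<And>a b. a \<in> A0 \<Longrightarrow> b \<in> A0 \<Longrightarrow> h1 (a + b * t) = h0 a + h0 b * s"
    using s0.step.eval_hom_adjoin[OF K(1,2) h0(1) s] unfolding A1_def by blast
  have g1: "kernel_generated (z - c) A1 h1"
    using s0.step.kernel_generated_adjoin[OF two_eq_0 K(1,2) h0(1) s _ _ zc(1) h0(3), folded A1_def, OF h1(1,4)] .
  have b: "b ^ 2 + b = h1 (y ^ 2 + y)"
    using h1(2) by (simp add: s_def t_def)
  obtain h2 where h2: "eval_hom K A2 h2" "h2 y = b" "\<forall>a\<in>A1. h2 a = h1 a"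
    "\<And>a b'. a \<in> A1 \<Longrightarrow> b' \<in> A1 \<Longrightarrow> h2 (a + b' * y) = h1 a + h1 b' * b"
    using s1.step.eval_hom_adjoin[OF K(1,3) h1(1) cba(2) b] unfolding A2_def by blast
  have g2: "kernel_generated (z - c) A2 h2"
    using s1.step.kernel_generated_adjoin[OF two_eq_0 K(1,3) h1(1) cba(2) b _ _ zc(2) g1, folded A2_def, OF h2(1,4)] .
  have a: "a ^ 2 + a = h2 (x ^ 2 + x)"
    unfolding x_eq cba(5)
    using eval_hom_power[OF h2(1) s2.A one_mem y_A2, of 3] h2(2) by simp
  obtain h3 where h3: "eval_hom K R h3" "h3 x = a" "\<forall>a\<in>A2. h3 a = h2 a"
    "\<And>a' b'. a' \<in> A2 \<Longrightarrow> b' \<in> A2 \<Longrightarrow> h3 (a' + b' * x) = h2 a' + h2 b' * a"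
    using s2.step.eval_hom_adjoin[OF K(1,4) h2(1) cba(3) a] unfolding R_def by blast
  have g3: "kernel_generated (z - c) R h3"
    using s2.step.kernel_generated_adjoin[OF two_eq_0 K(1,4) h2(1) cba(3) a _ _ zc(3) g2, folded R_def, OF h3(1,4)] .
  have "h3 y = b" "h3 z = c"
    using h3(3) h2(2,3) h1(3) y_A2 z_A0 subsetD[OF A0_A1 z_A0] subsetD[OF A1_A2 subsetD[OF A0_A1 z_A0]] h0z by auto
  then show ?thesis
    using h3(1,2) g3 by blast
qed

text \<open>The elements on which both homomorphisms agree form a ring containing
  \<open>K, x, y, z\<close>, which is all of \<open>R\<close>.\<close>

lemma eval_hom_unique:
  assumes "eval_hom K R h" "eval_hom K R h'" "h x = h' x" "h y = h' y" "h z = h' z" "r \<in> R"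
  shows "h r = h' r"
proof -
  have "subring_set {r \<in> R. h r = h' r}"
  proof
    show "- a \<in> {r \<in> R. h r = h' r}" if "a \<in> {r \<in> R. h r = h' r}" for a
      using that by (simp add: uminus_eq)
  qed (use assms(1,2) R.add_mem R.mult_mem in \<open>auto simp: eval_hom_def\<close>)
  moreover have "K \<subseteq> {r \<in> R. h r = h' r}"
    using assms(1,2) K_R by (auto simp: eval_hom_def)
  ultimately have "R \<subseteq> {r \<in> R. h r = h' r}"
    using assms x_R y_R z_R by (intro R_least) auto
  then show ?thesis
    using assms(6) by blast
qed

lemma value_at_unique:
  assumes Q: "Q \<in> places K F" and k: "k \<in> K" "f \<in> F" "vanishes_at Q (f - k)"
  shows "value_at K Q f = k"
  unfolding value_at_def
proof (rule the_equality)
  fix k'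
  assume k': "k' \<in> K \<and> vanishes_at Q (f - k')"
  interpret Q: valuation F Q
    by (rule place_valuation[OF FF.subfield_set_axioms Q])
  show "k' = k"
  proof (rule ccontr)
    assume ne: "k' \<noteq> k"
    then have kk: "k' - k \<in> K - {0}" "k' - k = (f - k) + (f - k')"
      using k' k(1) diff_mem[of k' k] diff_eq[of "f - k" "f - k'"] by simp_all
    have "f - k \<in> F" "f - k' \<in> F"
      using k k' K_F FF.diff_mem by auto
    then have "0 < Q (k' - k)"
      unfolding kk(2) using k(3) k' Q.v_add[of "f - k" "f - k'"] kk
      by (cases "f - k = 0"; cases "f - k' = 0") (auto simp: vanishes_at_def)
    then show False
      using K_value[OF Q kk(1)] by simp
  qed
qed (use k in simp)

lemma value_at:
  assumes Q: "Q \<in> rational_places K F" and f: "f \<in> F" "regular_at Q f"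
  shows "value_at K Q f \<in> K" "vanishes_at Q (f - value_at K Q f)"
proof -
  have "Q \<in> places K F"
    using Q by (simp add: rational_places_def)
  moreover obtain k where "k \<in> K" "vanishes_at Q (f - k)"
    using Q f unfolding rational_places_def by blast
  ultimately show "value_at K Q f \<in> K" "vanishes_at Q (f - value_at K Q f)"
    using value_at_unique f(1) by metis+
qed

lemma value_at_eval_hom:
  assumes Q: "Q \<in> rational_places K F" "Q \<noteq> P"
  shows "eval_hom K R (value_at K Q)"
proof -
  have QP: "Q \<in> places K F"
    using Q by (simp add: rational_places_def)
  interpret Q: valuation F Q
    by (rule place_valuation[OF FF.subfield_set_axioms QP])
  have val: "value_at K Q r \<in> K" "vanishes_at Q (r - value_at K Q r)" "r \<in> F" "regular_at Q r" if "r \<in> R" for r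
    using value_at[OF Q(1), of r] regular_on_R[OF QP Q(2) that] that R_F by auto
  have van_add: "vanishes_at Q (f + g)" if "vanishes_at Q f" "vanishes_at Q g" "f \<in> F" "g \<in> F" for f g
    using that Q.v_add[of f g] by (cases "f = 0"; cases "g = 0"; cases "f + g = 0") (auto simp: vanishes_at_def)
  have van_mult: "vanishes_at Q (f * g)" if "vanishes_at Q f" "regular_at Q g" "f \<in> F" "g \<in> F" for f g
    using that Q.v_mult[of f g] by (cases "f = 0"; cases "g = 0") (auto simp: vanishes_at_def regular_at_def)
  show ?thesis
    unfolding eval_hom_def
  proof (intro conjI ballI)
    show "value_at K Q r \<in> K" if "r \<in> R" for r
      using val that by blast
    show "value_at K Q k = k" if "k \<in> K" for k
      using that K_F by (intro value_at_unique[OF QP]) (auto simp: vanishes_at_def)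
    fix r s
    assume rs: "r \<in> R" "s \<in> R"
    let ?r = "value_at K Q r" and ?s = "value_at K Q s"
    have F: "r - ?r \<in> F" "s - ?s \<in> F" "?r \<in> F" "?s \<in> F"
      using val[OF rs(1)] val[OF rs(2)] K_F FF.diff_mem by auto
    have eq: "r + s - (?r + ?s) = (r - ?r) + (s - ?s)"
      by (simp add: algebra_simps)
    have "vanishes_at Q (r + s - (?r + ?s))"
      unfolding eq by (rule van_add[OF val(2)[OF rs(1)] val(2)[OF rs(2)] F(1,2)])
    then show "value_at K Q (r + s) = ?r + ?s"
      using val rs by (intro value_at_unique[OF QP] add_mem FF.add_mem) simp_all
    have eq: "r * s - ?r * ?s = (r - ?r) * s + (s - ?s) * ?r"
      by (simp add: algebra_simps)
    have reg: "regular_at Q ?r"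
      using regular_on_R[OF QP Q(2)] val(1)[OF rs(1)] K_R by blast
    have "vanishes_at Q (r * s - ?r * ?s)"
      unfolding eq
      by (rule van_add[OF van_mult[OF val(2)[OF rs(1)] val(4)[OF rs(2)] F(1) val(3)[OF rs(2)]]
        van_mult[OF val(2)[OF rs(2)] reg F(2,3)]
        FF.mult_mem[OF F(1) val(3)[OF rs(2)]] FF.mult_mem[OF F(2,3)]])
    then show "value_at K Q (r * s) = ?r * ?s"
      using val rs by (intro value_at_unique[OF QP] mult_mem FF.mult_mem) simp_all
  qed
qed

lemma value_at_pos_iff:
  assumes Q: "Q \<in> rational_places K F" "Q \<noteq> P" and r: "r \<in> R - {0}"
  shows "0 < Q r \<longleftrightarrow> value_at K Q r = 0"
proof -
  have QP: "Q \<in> places K F"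
    using Q by (simp add: rational_places_def)
  have "value_at K Q r = 0 \<Longrightarrow> vanishes_at Q r"
    using value_at(2)[OF Q(1), of r] regular_on_R[OF QP Q(2), of r] r R_F by auto
  moreover have "vanishes_at Q r \<Longrightarrow> value_at K Q r = 0"
    using value_at_unique[OF QP zero_mem, of r] r R_F by auto
  ultimately show ?thesis
    using r by (auto simp: vanishes_at_def)
qed

text \<open>The kernel of evaluation at the point is the centre of a place with uniformizer
  \<open>z - c\<close>. Any rational place other than \<open>P\<close> with the same coordinates has
  the same residue map on \<open>R\<close>, hence the same centre, and \<open>ord_at_unique\<close>
  identifies the two.\<close>

lemma point_place:
  assumes pt: "(c, b, a) \<in> affine_points"
  shows "\<exists>Q\<in>rational_places K F - {P}. value_at K Q z = c \<and> value_at K Q y = b \<and> value_at K Q x = a \<and>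
    (\<forall>Q'\<in>rational_places K F - {P}. value_at K Q' z = c \<longrightarrow> value_at K Q' y = b \<longrightarrow> value_at K Q' x = a \<longrightarrow> Q' = Q)"
proof -
  have c: "c \<in> K"
    using pt by (simp add: affine_points_def)
  obtain h where h: "eval_hom K R h" "h z = c" "h y = b" "h x = a" "kernel_generated (z - c) R h"
    using point_hom[OF pt] by blast
  obtain e where e: "e \<in> R" "h e \<noteq> 0" "\<And>r. r \<in> R \<Longrightarrow> h r = 0 \<Longrightarrow> e * r \<in> multiples (z - c) R"
    using h(5) unfolding kernel_generated_def by blast
  have hK: "h r \<in> K" if "r \<in> R" for r
    using h(1) that by (simp add: eval_hom_def)
  have h_const: "h k = k" if "k \<in> K" for k
    using h(1) that by (simp add: eval_hom_def)
  have h_add: "h (r + s) = h r + h s" and h_mult: "h (r * s) = h r * h s" if "r \<in> R" "s \<in> R" for r s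
    using h(1) that by (simp_all add: eval_hom_def)
  define M where "M = {r \<in> R. h r = 0}"
  have p: "[:- c, 1:] \<in> Kpoly" "poly [:- c, 1:] z = z - c"
    using c uminus_mem by (simp_all add: Kpoly_pCons)
  have d: "z - c \<in> A0 - {0}" "P (z - c) = - 8"
    using A0I[OF p(1)] Kpoly_eval_inj[OF p(1), of 0] value_poly[OF P _ p(1)] P_z p(2) by auto
  have cR: "c \<in> R"
    using c K_R by blast
  have "h (z - c) = 0"
    using h_add[OF z_R cR] h(2) h_const[OF c] by (simp add: diff_eq)
  have "dvr_prime R M (z - c) e"
  proof (rule dvr_primeI[OF d(1) bezout_linear[OF d]])
    show "1 \<notin> M" "M \<subseteq> R" "e \<notin> M" "e \<in> R"
      using e h_const[of 1] by (auto simp: M_def)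
    show "g + k \<in> M" if "g \<in> M" "k \<in> M" for g k
      using that h_add R.add_mem by (simp add: M_def)
    show "r * k \<in> M" if "r \<in> R" "k \<in> M" for r k
      using that h_mult R.mult_mem by (simp add: M_def)
    show "r \<in> M \<or> s \<in> M" if "r \<in> R" "s \<in> R" "r * s \<in> M" for r s
      using that h_mult by (simp add: M_def)
    show "z - c \<in> M"
      using d A0_R \<open>h (z - c) = 0\<close> by (auto simp: M_def)
    show "e * k \<in> multiples (z - c) R" if "k \<in> M" for k
      using that e(3) by (simp add: M_def)
  qed
  then interpret M: dvr_prime R M "z - c" e .
  let ?Q = M.ord_at
  have place: "?Q \<in> places K F"
    using M.ord_at_place[OF K_R inverse_mem] unfolding fractions_R .
  interpret Q: valuation F ?Q
    by (rule place_valuation[OF FF.subfield_set_axioms place])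
  have "0 \<le> ?Q z"
    using M.ord_at_R_nonneg z_R z_nz by blast
  then have neP: "?Q \<noteq> P"
    using P_z by auto
  have van: "vanishes_at ?Q (r - h r)" if r: "r \<in> R" for r
  proof -
    have hr: "h r \<in> R"
      using hK[OF r] K_R by blast
    have "h (r - h r) = 0"
      using h_add[OF r hr] h_const[OF hK[OF r]] by (simp add: diff_eq)
    then have "r - h r \<in> M"
      using R.diff_mem[OF r hr] by (simp add: M_def)
    then show ?thesis
      using M.ord_at_M[of "r - h r"] by (auto simp: vanishes_at_def)
  qed
  have rat: "?Q \<in> rational_places K F"
    unfolding rational_places_def
  proof (intro CollectI conjI ballI impI place)
    fix f
    assume f: "f \<in> F" "regular_at ?Q f"
    show "\<exists>k\<in>K. vanishes_at ?Q (f - k)"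
    proof (cases "f = 0")
      case True
      then show ?thesis
        by (intro bexI[of _ 0]) (simp_all add: vanishes_at_def)
    next
      case False
      then obtain s r where sr: "s \<in> R - M" "r \<in> R" "s * f = r"
        using M.nonneg_rep[of f] f fractions_R by (auto simp: regular_at_def)
      have hs: "h s \<noteq> 0" "s \<noteq> 0"
        using sr(1) M.unit_nz[OF sr(1)] by (simp_all add: M_def)
      \<comment> \<open>The residue of the quotient \<open>f = r / s\<close>, whose denominator does
        not vanish at the point; it lies in \<open>K\<close>, so the place has degree one.\<close>
      define k where "k = h r / h s"
      have k: "k \<in> K" "h r = k * h s"
        using divide_mem[OF hK[OF sr(2)] hK[of s]] sr(1) hs by (simp_all add: k_def)
      have kR: "k * s \<in> R"
        using k(1) K_R sr by (intro R.mult_mem) auto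
      have "h (k * s) = k * h s"
        using h_mult[of k s] h_const[OF k(1)] subsetD[OF K_R k(1)] sr by simp
      then have "h (r - k * s) = 0"
        using h_add[OF sr(2) kR] k(2) by (simp add: diff_eq)
      then have M: "r - k * s \<in> M"
        using R.diff_mem[OF sr(2) kR] by (simp add: M_def)
      have eq: "s * (f - k) = r - k * s"
        using sr(3) by (simp add: algebra_simps)
      have "vanishes_at ?Q (f - k)"
      proof (cases "f - k = 0")
        case nz: False
        have "?Q (s * (f - k)) = ?Q s + ?Q (f - k)"
          using hs sr(1) R_F FF.diff_mem[OF f(1) subsetD[OF K_F k(1)]] nz by (intro Q.v_mult) auto
        moreover have "s * (f - k) \<noteq> 0"
          using nz hs(2) by (simp only: mult_eq_0_iff simp_thms)
        then have "0 < ?Q (r - k * s)"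
          unfolding eq by (rule M.ord_at_M[OF M])
        ultimately show ?thesis
          unfolding eq using M.ord_at_unit[OF sr(1)] by (simp add: vanishes_at_def)
      qed (simp add: vanishes_at_def)
      then show ?thesis
        using k(1) by blast
    qed
  qed
  have val: "value_at K ?Q r = h r" if "r \<in> R" for r
    using value_at_unique[OF place hK[OF that] _ van[OF that]] that R_F by blast
  have uniq: "Q' = ?Q" if Q': "Q' \<in> rational_places K F - {P}" "value_at K Q' z = c" "value_at K Q' y = b" "value_at K Q' x = a" for Q'
  proof (rule M.ord_at_unique)
    have rat': "Q' \<in> rational_places K F" "Q' \<noteq> P"
      using Q' by auto
    then show pl: "Q' \<in> places K (fractions R)"
      unfolding fractions_R by (simp add: rational_places_def)
    show "0 \<le> Q' k" if "k \<in> R - {0}" for k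
      using regular_on_R[of Q' k] pl rat'(2) that unfolding fractions_R by (auto simp: regular_at_def)
    have "value_at K Q' r = h r" if "r \<in> R" for r
      using eval_hom_unique[OF value_at_eval_hom[OF rat'] h(1) _ _ _ that] Q' h by simp
    then show "0 < Q' k \<longleftrightarrow> k \<in> M" if "k \<in> R - {0}" for k
      using value_at_pos_iff[OF rat' that] that by (simp add: M_def)
  qed
  show ?thesis
  proof (intro bexI[of _ ?Q] conjI ballI impI)
    show "value_at K ?Q z = c" "value_at K ?Q y = b" "value_at K ?Q x = a"
      using val z_R y_R x_R h(2-4) by simp_all
    show "?Q \<in> rational_places K F - {P}"
      using rat neP by blast
  qed (rule uniq)
qed

lemma evaluation_places_bij:
  "bij_betw (\<lambda>Q. (value_at K Q z, value_at K Q y, value_at K Q x)) (evaluation_places K F P) affine_points"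
proof -
  let ?\<phi> = "\<lambda>Q. (value_at K Q z, value_at K Q y, value_at K Q x)"
  have mem: "?\<phi> Q \<in> affine_points" if Q: "Q \<in> evaluation_places K F P" for Q
  proof -
    have Q': "Q \<in> rational_places K F" "Q \<noteq> P"
      using Q by (auto simp: evaluation_places_def)
    define h where "h = value_at K Q"
    have h: "eval_hom K R h"
      unfolding h_def by (rule value_at_eval_hom[OF Q'])
    have pow: "h (r ^ i) = h r ^ i" if "r \<in> R" for r i
      by (rule eval_hom_power[OF h R.subring_set_axioms one_mem that])
    have add: "h (r + s) = h r + h s" if "r \<in> R" "s \<in> R" for r s
      using h that by (simp add: eval_hom_def)
    have "h y ^ 4 + h y = h z ^ m"
      using arg_cong[OF y_eq, of h] y_R z_R R.power_mem by (simp add: pow add)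
    moreover have "h x ^ 2 + h x = h y ^ 3"
      using arg_cong[OF x_eq, of h] y_R x_R R.power_mem by (simp add: pow add)
    moreover have "h x \<in> K" "h y \<in> K" "h z \<in> K"
      using h x_R y_R z_R by (simp_all add: eval_hom_def)
    ultimately show ?thesis
      by (simp add: affine_points_def h_def)
  qed
  have inj: "inj_on ?\<phi> (evaluation_places K F P)"
  proof (rule inj_onI)
    fix Q Q'
    assume Q: "Q \<in> evaluation_places K F P" "Q' \<in> evaluation_places K F P" "?\<phi> Q = ?\<phi> Q'"
    obtain c b a where cba: "?\<phi> Q = (c, b, a)"
      by simp
    then have "(c, b, a) \<in> affine_points"
      using mem[OF Q(1)] by simp
    from point_place[OF this] obtain Q0 where Q0:
      "\<And>Q'. Q' \<in> rational_places K F - {P} \<Longrightarrow> value_at K Q' z = c \<Longrightarrow> value_at K Q' y = b \<Longrightarrow> value_at K Q' x = a \<Longrightarrow> Q' = Q0"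
      by blast
    have "Q = Q0"
      by (rule Q0) (use Q(1) cba in \<open>simp_all add: evaluation_places_def\<close>)
    moreover have "Q' = Q0"
      by (rule Q0) (use Q(2,3) cba in \<open>simp_all add: evaluation_places_def\<close>)
    ultimately show "Q = Q'"
      by simp
  qed
  have "affine_points \<subseteq> ?\<phi> ` evaluation_places K F P"
  proof
    fix p
    assume p: "p \<in> affine_points"
    obtain c b a where "p = (c, b, a)"
      by (cases p)
    with p point_place[of c b a] show "p \<in> ?\<phi> ` evaluation_places K F P"
      by (force simp: evaluation_places_def)
  qed
  then show ?thesis
    unfolding bij_betw_def using inj mem by blast
qed

end

section \<open>Parameters of the dual code\<close>

context ggs_infinity
begin

text \<open>\<open>regular_outside_P_in_R\<close> replaces the condition at all places by membership
  in \<open>R\<close>, where the values are known.\<close>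

lemma weierstrass_semigroup_eq: "weierstrass_semigroup K F P = ggs_semigroup m"
proof (intro equalityI subsetI)
  fix r
  assume "r \<in> weierstrass_semigroup K F P"
  then obtain f where f: "f \<in> F - {0}" "P f = - int r" "\<And>Q. Q \<in> places K F - {P} \<Longrightarrow> 0 \<le> Q f"
    unfolding weierstrass_semigroup_def by blast
  have "f \<in> R"
    using f by (intro regular_outside_P_in_R) (auto simp: regular_at_def)
  then have "- int r \<in> P ` (R - {0})"
    using f by force
  then show "r \<in> ggs_semigroup m"
    unfolding image_values_R by auto
next
  fix r
  assume "r \<in> ggs_semigroup m"
  then have "- int r \<in> P ` (R - {0})"
    unfolding image_values_R by blast
  then obtain f where f: "f \<in> R - {0}" "P f = - int r"
    by force
  have "0 \<le> Q f" if "Q \<in> places K F - {P}" for Q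
    using regular_on_R[of Q f] that f(1) by (auto simp: regular_at_def)
  moreover have "f \<in> F - {0}"
    using f(1) R_F by blast
  ultimately show "r \<in> weierstrass_semigroup K F P"
    unfolding weierstrass_semigroup_def using f(2) by blast
qed

lemma riemann_roch_space_eq:
  "riemann_roch_space K F (one_point_divisor r P) = {f \<in> R. f = 0 \<or> nat (- P f) \<le> r}"
proof (intro equalityI subsetI)
  fix f
  assume f: "f \<in> riemann_roch_space K F (one_point_divisor r P)"
  then have fF: "f \<in> F" and *: "f = 0 \<or> (\<forall>Q\<in>places K F. 0 \<le> Q f + one_point_divisor r P Q)"
    unfolding riemann_roch_space_def by blast+
  have "regular_at Q f" if "Q \<in> places K F - {P}" for Q
    using * that by (auto simp: regular_at_def one_point_divisor_def)
  then have "f \<in> R"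
    by (rule regular_outside_P_in_R[OF fF])
  moreover have "f = 0 \<or> 0 \<le> P f + int r"
    using * P by (auto simp: one_point_divisor_def)
  ultimately show "f \<in> {f \<in> R. f = 0 \<or> nat (- P f) \<le> r}"
    by auto
next
  fix f
  assume f: "f \<in> {f \<in> R. f = 0 \<or> nat (- P f) \<le> r}"
  have "0 \<le> Q f + one_point_divisor r P Q" if "f \<noteq> 0" "Q \<in> places K F" for Q
    using regular_on_R[of Q f] f that by (cases "Q = P") (auto simp: regular_at_def one_point_divisor_def)
  then show "f \<in> riemann_roch_space K F (one_point_divisor r P)"
    unfolding riemann_roch_space_def using f R_F by blast
qed

abbreviation D :: "('a \<Rightarrow> int) set" where "D \<equiv> evaluation_places K F P"

lemma D_iff: "Q \<in> D \<longleftrightarrow> Q \<in> rational_places K F \<and> Q \<noteq> P"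
  by (auto simp: evaluation_places_def)

lemma card_D: "card D = 4 * q * (q - 1)"
  using bij_betw_same_card[OF evaluation_places_bij] card_affine_points by simp

lemma finite_D: "finite D"
proof -
  have "affine_points \<subseteq> K \<times> K \<times> K"
    by (auto simp: affine_points_def)
  then have "finite affine_points"
    using fin finite_subset by blast
  then show ?thesis
    using bij_betw_finite[OF evaluation_places_bij] by simp
qed

text \<open>The product over the three coordinates of \<open>1 - (f - f(Q)) ^ (card K - 1)\<close> is the indicator function of \<open>Q\<close>.\<close>

lemma separate_points:
  assumes Q: "Q \<in> D"
  shows "\<exists>f\<in>R. value_at K Q f = 1 \<and> (\<forall>Q'\<in>D - {Q}. value_at K Q' f = 0)"
proof -
  define i where "i = card K - 1"
  have i: "card K = Suc i" "i > 0"
    using card_K_ge_2 by (simp_all add: i_def)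
  define \<delta> where "\<delta> f = 1 + (f + value_at K Q f) ^ i" for f
  have hom: "eval_hom K R (value_at K Q')" if "Q' \<in> D" for Q'
    using that value_at_eval_hom by (simp add: D_iff)
  have vK: "value_at K Q' f \<in> K" if "Q' \<in> D" "f \<in> R" for Q' f
    using hom[OF that(1)] that(2) by (simp add: eval_hom_def)
  have \<delta>: "\<delta> f \<in> R" "value_at K Q' (\<delta> f) = (if value_at K Q' f = value_at K Q f then 1 else 0)"
    if Q': "Q' \<in> D" and f: "f \<in> R" for Q' f
  proof -
    have c: "value_at K Q f \<in> K" "value_at K Q f \<in> R"
      using vK[OF Q f] K_R by auto
    have fc: "f + value_at K Q f \<in> R"
      using f c R.add_mem by simp
    show "\<delta> f \<in> R"
      unfolding \<delta>_def by (rule R.add_mem[OF R.one_mem R.power_mem[OF fc]])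
    let ?u = "value_at K Q' f + value_at K Q f"
    have "value_at K Q' (\<delta> f) = 1 + ?u ^ i"
    proof -
      have "value_at K Q' ((f + value_at K Q f) ^ i) = value_at K Q' (f + value_at K Q f) ^ i"
        by (rule eval_hom_power[OF hom[OF Q'] R.subring_set_axioms one_mem fc])
      then show ?thesis
        using hom[OF Q'] f c fc R.power_mem unfolding \<delta>_def eval_hom_def by simp
    qed
    also have "\<dots> = (if value_at K Q' f = value_at K Q f then 1 else 0)"
    proof (cases "?u = 0")
      case True
      then show ?thesis
        using i(2) eq_iff_add by simp
    next
      case False
      have "?u \<in> K"
        using vK[OF Q' f] c by (intro add_mem)
      then have "?u ^ i * ?u = ?u"
        using power_card[of ?u] unfolding i(1) by (simp add: mult.commute)
      then have "?u ^ i = 1"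
        using False by simp
      then show ?thesis
        using False eq_iff_add[of "value_at K Q' f" "value_at K Q f"] by simp
    qed
    finally show "value_at K Q' (\<delta> f) = (if value_at K Q' f = value_at K Q f then 1 else 0)" .
  qed
  define f where "f = \<delta> z * (\<delta> y * \<delta> x)"
  have f: "f \<in> R"
    unfolding f_def using \<delta>(1)[OF Q] x_R y_R z_R by (intro R.mult_mem)
  have val: "value_at K Q' f = value_at K Q' (\<delta> z) * (value_at K Q' (\<delta> y) * value_at K Q' (\<delta> x))" if "Q' \<in> D" for Q'
    using hom[OF that] \<delta>(1)[OF Q] x_R y_R z_R R.mult_mem unfolding f_def eval_hom_def by simp
  have "value_at K Q f = 1"
    unfolding val[OF Q] using \<delta>(2)[OF Q] x_R y_R z_R by simp
  moreover have "value_at K Q' f = 0" if Q': "Q' \<in> D - {Q}" for Q'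
  proof -
    have "(value_at K Q' z, value_at K Q' y, value_at K Q' x) \<noteq> (value_at K Q z, value_at K Q y, value_at K Q x)"
      using bij_betw_imp_inj_on[OF evaluation_places_bij] Q Q' by (auto dest: inj_onD)
    then show ?thesis
      using val[of Q'] \<delta>(2)[of Q'] Q' x_R y_R z_R by auto
  qed
  ultimately show ?thesis
    using f by blast
qed

lemma P_nonpos_R: "f \<in> R - {0} \<Longrightarrow> P f \<le> 0"
  using image_values_R by (metis (no_types, lifting) image_eqI imageE neg_le_0_iff_le of_nat_0_le_iff)

sublocale code: order_code K R D "value_at K" "\<lambda>f. nat (- P f)"
proof (unfold_locales)
  have hom: "eval_hom K R (value_at K Q)" if "Q \<in> D" for Q
    using that value_at_eval_hom by (simp add: D_iff)
  show "finite D" "K \<subseteq> R"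
    by (rule finite_D, rule K_R)
  show "value_at K Q f \<in> K" if "Q \<in> D" "f \<in> R" for Q f
    using hom[OF that(1)] that(2) by (simp add: eval_hom_def)
  show "value_at K Q (f + g) = value_at K Q f + value_at K Q g" "value_at K Q (f * g) = value_at K Q f * value_at K Q g"
    if "Q \<in> D" "f \<in> R" "g \<in> R" for Q f g
    using hom[OF that(1)] that(2,3) by (simp_all add: eval_hom_def)
  show "value_at K Q c = c" if "Q \<in> D" "c \<in> K" for Q c
    using hom[OF that(1)] that(2) by (simp add: eval_hom_def)
  show "\<exists>f\<in>R. value_at K Q f = 1 \<and> (\<forall>Q'\<in>D - {Q}. value_at K Q' f = 0)" if "Q \<in> D" for Q
    by (rule separate_points[OF that])
  show "nat (- P (f * g)) = nat (- P f) + nat (- P g)" if "f \<in> R - {0}" "g \<in> R - {0}" for f g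
  proof -
    have "P (f * g) = P f + P g"
      using that R_F by (intro s0.v_mult) auto
    then show ?thesis
      using P_nonpos_R[OF that(1)] P_nonpos_R[OF that(2)] by simp
  qed
  show "nat (- P (f + g)) \<le> max (nat (- P f)) (nat (- P g))" if "f \<in> R - {0}" "g \<in> R - {0}" "f + g \<noteq> 0" for f g
  proof -
    have "min (P f) (P g) \<le> P (f + g)"
      using that R_F by (intro s0.v_add) auto
    then show ?thesis
      by linarith
  qed
  show "nat (- P c) = 0" if "c \<in> K - {0}" for c
    using K_value[OF P that] by simp
  show "\<exists>k\<in>K - {0}. f - k * g = 0 \<or> nat (- P (f - k * g)) < nat (- P f)"
    if fg: "f \<in> R - {0}" "g \<in> R - {0}" "nat (- P f) = nat (- P g)" for f g
  proof -
    have "P f = P g"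
      using fg P_nonpos_R[OF fg(1)] P_nonpos_R[OF fg(2)] by simp
    then obtain k where k: "k \<in> K - {0}" "f - k * g = 0 \<or> P f < P (f - k * g)"
      using leading_R fg unfolding s0.leading_def by blast
    have "f - k * g \<in> R"
      using fg k(1) K_R by (intro R.diff_mem R.mult_mem) auto
    then have "f - k * g = 0 \<or> nat (- P (f - k * g)) < nat (- P f)"
      using k(2) P_nonpos_R[of "f - k * g"] by fastforce
    then show ?thesis
      using k(1) by blast
  qed
qed

lemma orders_eq: "code.orders = ggs_semigroup m"
proof -
  have "code.orders = (\<lambda>i. nat (- i)) ` P ` (R - {0})"
    unfolding code.orders_def by (simp add: image_image)
  then show ?thesis
    unfolding image_values_R by (simp add: image_image)
qed

text \<open>For \<open>n \<ge> 5\<close> the number \<open>3 * m = 2 ^ n + 1\<close> is 1 modulo 8,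
  and 3 is its own inverse modulo 8. The size of \<open>n\<close> also gives
  \<open>m \<ge> 11\<close>, hence \<open>u \<ge> 1\<close>.\<close>

lemma m_mod: "\<exists>u\<ge>1. m = 8 * u + 3"
proof -
  obtain j where j: "n = j + 5"
    using n_ge_5 by (metis add.commute le_Suc_ex)
  then have "3 * m = 32 * 2 ^ j + 1"
    unfolding m by (simp add: power_add)
  moreover define p where "p = (2 :: nat) ^ j"
  ultimately have "3 * m = 32 * p + 1" "p \<ge> 1"
    by simp_all
  then have "m \<ge> 11" "3 * (m - 3) = 8 * (4 * p - 1)"
    by linarith+
  then have "8 dvd 3 * (m - 3)"
    by simp
  moreover have "coprime ((2 :: nat) ^ 3) 3"
    unfolding coprime_power_left_iff coprime_left_2_iff_odd by simp
  ultimately have "8 dvd m - 3"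
    using coprime_dvd_mult_right_iff[of "2 ^ 3 :: nat" 3 "m - 3"] by simp
  then obtain u where "m - 3 = 8 * u"
    by (elim dvdE)
  then have "u \<ge> 1" "m = 8 * u + 3"
    using \<open>m \<ge> 11\<close> by linarith+
  then show ?thesis
    by blast
qed

lemma q_eq: "q = 3 * m - 1"
  using m by simp

text \<open>The norm of \<open>f\<close> has pole order \<open>- 8 * P f\<close> while
  \<open>z\<close> has pole order 8, so as a polynomial in \<open>z\<close> it has degree
  \<open>- P f\<close>, at most \<open>9 * m\<close>. It vanishes at all
  \<open>q * (q - 1) / 2\<close> coordinates in \<open>z_coords\<close>, which are too many.\<close>

lemma evaluation_injective:
  assumes f: "f \<in> code.L (9 * m)" and zero: "\<And>Q. Q \<in> D \<Longrightarrow> value_at K Q f = 0"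
  shows "f = 0"
proof (rule ccontr)
  assume "f \<noteq> 0"
  then have fR: "f \<in> R - {0}" "nat (- P f) \<le> 9 * m"
    using f by (auto simp: code.L_def)
  obtain f' where f': "f' \<in> R - {0}" "f * f' \<in> A0 - {0}" "P (f * f') = 8 * P f"
    using norm_R[OF fR(1)] by blast
  obtain p where p: "p \<in> Kpoly" "f * f' = poly p z" "p \<noteq> 0"
    using A0_nzE[OF f'(2)] by blast
  have "int (degree p) = - P f"
    using value_poly[OF P, of p] p f'(3) P_z by simp
  then have deg: "degree p \<le> 9 * m"
    using fR(2) by simp
  have root: "poly p c = 0" if c: "c \<in> z_coords" for c
  proof -
    obtain b a where pt: "(c, b, a) \<in> affine_points"
      using c unfolding fst_affine_points[symmetric] by auto
    then obtain Q where Q: "Q \<in> D" "value_at K Q z = c"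
      using evaluation_places_bij unfolding bij_betw_def by (metis (no_types, lifting) imageE prod.inject)
    have hom: "eval_hom K R (value_at K Q)"
      using Q value_at_eval_hom by (simp add: D_iff)
    have "value_at K Q (poly r z) = poly r c" if "r \<in> Kpoly" for r
      using that
    proof (induction r)
      case 0
      then show ?case
        using hom by (simp add: eval_hom_def)
    next
      case (pCons a r)
      then have "a \<in> K" "r \<in> Kpoly"
        by (simp_all add: Kpoly_pCons)
      moreover from this have "a \<in> R" "poly r z \<in> R"
        using K_R A0I A0_R by auto
      ultimately show ?case
        using hom Q(2) z_R R.mult_mem pCons.IH by (simp add: eval_hom_def)
    qed
    then have "poly p c = value_at K Q (f * f')"
      using p by simp
    also have "\<dots> = 0"
      using hom fR f' zero[OF Q(1)] by (simp add: eval_hom_def)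
    finally show ?thesis .
  qed
  have "card z_coords \<le> card {c. poly p c = 0}"
    using root p(3) by (intro card_mono poly_roots_finite) auto
  also have "\<dots> \<le> degree p"
    by (rule card_poly_roots_bound[OF p(3)])
  finally have "q * (q - 1) \<le> 18 * m"
    using deg card_z_coords by linarith
  moreover obtain u where "u \<ge> 1" "m = 8 * u + 3"
    using m_mod by blast
  ultimately have "(24 * u + 8) * (24 * u + 7) \<le> 144 * u + 54"
    unfolding q_eq by (simp add: add.commute)
  \<comment> \<open>The factor 31 is \<open>24 * u + 7\<close> at \<open>u = 1\<close>; it makes the
    quadratic inequality linear.\<close>
  moreover have "(24 * u + 8) * 31 \<le> (24 * u + 8) * (24 * u + 7)"
    using \<open>u \<ge> 1\<close> by (intro mult_le_mono) simp_all
  ultimately have "(24 * u + 8) * 31 \<le> 144 * u + 54"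
    by (rule le_trans[rotated])
  then show False
    by simp
qed

lemma dual_one_point_code_eq:
  assumes "pole_number K F P l = r"
  shows "dual_one_point_code K F P l = code.dual_order_code r"
proof -
  have "(\<Sum>Q\<in>D. w Q * (if Q \<in> D then value_at K Q f else 0)) = pairing D w (code.ev_word f)" for w f
    by (simp add: pairing_def code.ev_word_def)
  then show ?thesis
    unfolding dual_one_point_code_def dual_code_def ag_code_def assms riemann_roch_space_eq
      code.dual_order_code_def code.L_def by auto
qed

end

section \<open>The order bound and the code parameters\<close>

lemma enumerate_from_conductor:
  fixes S :: "nat set"
  assumes S: "\<And>s. c \<le> s \<Longrightarrow> s \<in> S" and k: "enumerate S k = c"
  shows "enumerate S (k + j) = c + j"
proof (induction j)
  case (Suc j)
  have inf: "infinite S"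
    unfolding infinite_nat_iff_unbounded_le using S by (metis max.cobounded1 max.cobounded2)
  have "enumerate S (Suc (k + j)) = (LEAST s. s \<in> S \<and> enumerate S (k + j) < s)"
    by (rule enumerate_Suc''[OF inf])
  also have "\<dots> = c + Suc j"
    unfolding Suc by (rule Least_equality) (use S in auto)
  finally show ?case
    by simp
qed (simp add: k)

locale ggs_code = ggs_infinity +
  fixes l :: nat
  assumes l: "1 \<le> l" "pole_number K F P l = 9 * m"
begin

lemma feng_rao_nu_eq:
  assumes "l \<le> r"
  shows "feng_rao_nu K F P r = summand_count (ggs_semigroup m) (9 * m + (r - l + 1))"
proof -
  let ?S = "ggs_semigroup m"
  obtain u where u: "m = 8 * u + 3"
    using m_mod by blast
  have "enumerate ?S (l - 1) = 9 * m"
    using l(2) by (simp add: pole_number_def weierstrass_semigroup_eq)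
  \<comment> \<open>The index is \<open>r\<close>, and \<open>enumerate\<close> counts from 0, so
    this is the pole number with index \<open>r + 1\<close>, the one that enters the Feng-Rao number
    of \<open>r\<close>.\<close>
  then have "enumerate ?S (l - 1 + (r - l + 1)) = 9 * m + (r - l + 1)"
    using ggs_semigroup_conductor[OF u] by (intro enumerate_from_conductor)
  then have pole: "pole_number K F P (r + 1) = 9 * m + (r - l + 1)"
    using assms l(1) by (simp add: pole_number_def weierstrass_semigroup_eq)
  have "bij_betw fst {(a, b) \<in> ?S \<times> ?S. a + b = s} {a \<in> ?S. a \<le> s \<and> s - a \<in> ?S}" for s
    by (rule bij_betw_byWitness[of _ "\<lambda>a. (a, s - a)"]) auto
  then show ?thesis
    unfolding feng_rao_nu_def weierstrass_semigroup_eq pole summand_count_def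
    by (rule bij_betw_same_card)
qed

lemma order_bound_eq: "order_bound K F P l = 16"
proof -
  obtain u where u: "u \<ge> 1" "m = 8 * u + 3"
    using m_mod by blast
  \<comment> \<open>The pole number with index \<open>l + 8\<close> is \<open>9 * m + 8\<close>,
    where the lower bound 16 is attained.\<close>
  have "feng_rao_nu K F P (l + 7) = 16"
    using feng_rao_nu_eq[of "l + 7"] summand_count_ggs_semigroup_eq[OF u(2)] by simp
  then have "16 \<in> {feng_rao_nu K F P r | r. l \<le> r}"
    by (metis (mono_tags, lifting) le_add1 mem_Collect_eq)
  moreover have "16 \<le> i" if "i \<in> {feng_rao_nu K F P r | r. l \<le> r}" for i
    using that feng_rao_nu_eq summand_count_ggs_semigroup_ge[OF u(2,1)] by auto
  ultimately show ?thesis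
    unfolding order_bound_def by (intro cInf_eq_minimum) auto
qed

abbreviation C :: "(('a \<Rightarrow> int) \<Rightarrow> 'a) set" where "C \<equiv> dual_one_point_code K F P l"

definition I :: "nat set" where "I = ggs_semigroup m \<inter> {..9 * m}"

lemma C_eq: "C = annihilator D I (\<lambda>s. code.ev_word (code.of_order s))"
  unfolding dual_one_point_code_eq[OF l(2)] code.dual_order_code_eq_annihilator orders_eq I_def ..

lemma finite_I: "finite I"
  by (simp add: I_def)

text \<open>The number of pole orders up to \<open>9 * m\<close>; it equals
  \<open>9 * m + 1 - g\<close> for the genus \<open>g = (9 * m - 7) / 2\<close>.\<close>

lemma card_I: "2 * card I = 9 * m + 9"
proof -
  obtain u where u: "m = 8 * u + 3"
    using m_mod by blast
  have "I = {s \<in> ggs_semigroup m. s \<le> 9 * m}"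
    by (auto simp: I_def)
  then show ?thesis
    using card_ggs_semigroup_le[OF u] u by simp
qed

lemma words_I: "i \<in> I \<Longrightarrow> code.ev_word (code.of_order i) \<in> words K D"
  using code.of_order(1)[of i] by (intro code.ev_word_mem) (simp add: I_def orders_eq)

text \<open>The words of one function per pole order up to \<open>9 * m\<close> are parity checks,
  independent by \<open>evaluation_injective\<close>.\<close>

lemma dim_C: "code_dim K D C + card I = card D"
  unfolding C_eq
proof (rule dim_annihilator[OF subfield_K finite_I finite_D words_I])
  show "independent_words K D I (\<lambda>s. code.ev_word (code.of_order s))"
    using code.independent_ev_words[of "9 * m"] evaluation_injective unfolding I_def orders_eq by blast
qed

lemma linear_C: "linear_code K D C"
  unfolding linear_code_def C_eq by (intro conjI finite_D annihilator_subspace[OF subfield_K] words_I)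

lemma card_D_gt: "card I < card D"
proof -
  obtain u where u: "u \<ge> 1" "m = 8 * u + 3"
    using m_mod by blast
  have "card I \<le> 9 * m"
    using card_I u by linarith
  also have "9 * m < 4 * q * 1"
    unfolding q_eq using u by simp
  also have "4 * q * 1 \<le> 4 * q * (q - 1)"
    using u unfolding q_eq by (intro mult_le_mono2) simp
  finally show ?thesis
    unfolding card_D .
qed

lemma zero_C: "(\<lambda>p. 0) \<in> C"
  unfolding C_eq annihilator_def by (simp add: words_def pairing_def)

text \<open>The lower bound is the order bound for the difference of two code words. The word of
  small weight gives the upper bound and shows that the infimum is over a nonempty set.\<close>

lemma min_dist_C: "16 \<le> min_dist D C" "min_dist D C \<le> card I + 1"
proof -
  let ?W = "{hamming_dist D v w | v w. v \<in> C \<and> w \<in> C \<and> v \<noteq> w}"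
  obtain u where u: "u \<ge> 1" "m = 8 * u + 3"
    using m_mod by blast
  obtain w0 where w0: "w0 \<in> C" "w0 \<noteq> (\<lambda>p. 0)" "card {p \<in> D. w0 p \<noteq> 0} \<le> card I + 1"
    using exists_small_weight[where f = "\<lambda>s. code.ev_word (code.of_order s)", OF finite_I finite_D words_I card_D_gt]
    unfolding C_eq by blast
  have mem: "hamming_dist D w0 (\<lambda>p. 0) \<in> ?W"
    using w0 zero_C by blast
  have "16 \<le> i" if "i \<in> ?W" for i
  proof -
    obtain v w where vw: "i = hamming_dist D v w" "v \<in> C" "w \<in> C" "v \<noteq> w"
      using \<open>i \<in> ?W\<close> by blast
    define d where "d = (\<lambda>p. v p - w p)"
    have "d \<in> C"
      using vw(2,3) words_sub[of v D w] unfolding C_eq annihilator_def d_def by (simp add: pairing_diff)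
    then have "d \<in> code.dual_order_code (9 * m)"
      unfolding dual_one_point_code_eq[OF l(2)] .
    moreover have "d \<noteq> (\<lambda>p. 0)"
      using vw(4) by (auto simp: d_def fun_eq_iff)
    ultimately obtain s where s: "s > 9 * m" "summand_count (ggs_semigroup m) s \<le> card {p \<in> D. d p \<noteq> 0}"
      using code.feng_rao_bound[of d "9 * m"] unfolding orders_eq by blast
    have "{p \<in> D. d p \<noteq> 0} = {p \<in> D. v p \<noteq> w p}"
      by (simp add: d_def)
    then show ?thesis
      using s(2) summand_count_ggs_semigroup_ge[OF u(2,1) s(1)] unfolding vw(1) hamming_dist_def by simp
  qed
  then show "16 \<le> min_dist D C"
    unfolding min_dist_def using mem by (intro cInf_greatest) auto
  have "min_dist D C \<le> hamming_dist D w0 (\<lambda>p. 0)"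
    unfolding min_dist_def using mem by (intro cInf_lower) auto
  then show "min_dist D C \<le> card I + 1"
    using w0(3) by (simp add: hamming_dist_def)
qed

lemma real_card_I: "real (card I) = (9 * real m + 9) / 2"
  using card_I by (metis of_nat_add of_nat_mult of_nat_numeral nonzero_mult_div_cancel_left zero_neq_numeral)

lemma card_D_eq: "card D = (3 * m - 1) ^ 2 + (3 * m - 1) * (9 * m - 7)"
proof -
  obtain u where u: "m = 8 * u + 3"
    using m_mod by blast
  show ?thesis
    unfolding card_D q_eq u by (simp add: algebra_simps power2_eq_square)
qed

lemma real_card_D: "real (card D) = (3 * real m - 1) * (12 * real m - 8)"
proof -
  obtain u where u: "m = 8 * u + 3"
    using m_mod by blast
  show ?thesis
    unfolding card_D q_eq u by (simp add: algebra_simps)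
qed

text \<open>As \<open>N - k = card I\<close>, the defect is \<open>card I + 1 - d\<close>, and
  \<open>d\<close> lies between 16 and \<open>card I + 1\<close>.\<close>

lemma defect_bounds: "0 \<le> singleton_defect K D C" "singleton_defect K D C \<le> int (card I) - 15"
  using dim_C min_dist_C unfolding singleton_defect_def by linarith+

lemma relative_defect_bounds:
  "0 \<le> relative_singleton_defect K D C"
  "relative_singleton_defect K D C \<le> (9 * real m - 21) / (2 * (3 * real m - 1) * (12 * real m - 8))"
proof -
  have pos: "0 < real (card D)"
    using card_D_gt by simp
  show "0 \<le> relative_singleton_defect K D C"
    unfolding relative_singleton_defect_def using defect_bounds(1) pos by simp
  have "real_of_int (singleton_defect K D C) \<le> real_of_int (int (card I) - 15)"
    using defect_bounds(2) by (simp only: of_int_le_iff)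
  also have "\<dots> = (9 * real m - 21) / 2"
    using real_card_I by simp
  finally have le: "real_of_int (singleton_defect K D C) \<le> (9 * real m - 21) / 2" .
  have "relative_singleton_defect K D C \<le> (9 * real m - 21) / 2 / real (card D)"
    unfolding relative_singleton_defect_def using pos by (intro divide_right_mono[OF le]) simp
  then show "relative_singleton_defect K D C \<le> (9 * real m - 21) / (2 * (3 * real m - 1) * (12 * real m - 8))"
    unfolding real_card_D by (simp only: divide_divide_eq_left mult.assoc)
qed

text \<open>A crude bound depending only on \<open>n\<close>, which makes the limit uniform over all
  fields, generators and indices: the estimate is below \<open>1 / (3 * m)\<close>, and
  \<open>3 * m = 2 ^ n + 1\<close> exceeds \<open>n\<close>.\<close>

lemma relative_defect_le: "relative_singleton_defect K D C \<le> 1 / real n"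
proof -
  have "n < 2 ^ n"
    by (rule less_exp)
  then have "n \<le> 3 * m"
    using m by linarith
  obtain u where u: "u \<ge> 1" "m = 8 * u + 3"
    using m_mod by blast
  then have m3: "real m \<ge> 11"
    by simp
  have "(9 * real m - 21) / (2 * (3 * real m - 1) * (12 * real m - 8)) \<le> 1 / (3 * real m)"
  proof -
    \<comment> \<open>This polynomial is what remains of the inequality after multiplying both sides
      by the two denominators.\<close>
    have "0 \<le> real m * (45 * real m - 9) + 16"
      using m3 by (intro add_nonneg_nonneg mult_nonneg_nonneg) simp_all
    also have "\<dots> = 2 * (3 * real m - 1) * (12 * real m - 8) - (9 * real m - 21) * (3 * real m)"
      by (simp add: algebra_simps)
    finally have "(9 * real m - 21) * (3 * real m) \<le> 2 * (3 * real m - 1) * (12 * real m - 8)"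
      by simp
    moreover have "0 < 2 * (3 * real m - 1) * (12 * real m - 8)"
      using m3 by simp
    ultimately show ?thesis
      using m3 by (simp add: divide_le_eq pos_le_divide_eq mult.commute)
  qed
  also have "\<dots> \<le> 1 / real n"
  proof (rule frac_le)
    have "real n \<le> real (3 * m)"
      using \<open>n \<le> 3 * m\<close> by (simp only: of_nat_le_iff)
    then show "real n \<le> 3 * real m"
      by simp
  qed (use n_ge_5 in simp_all)
  finally show ?thesis
    using relative_defect_bounds(2) by linarith
qed

end

lemma GGS2_setting_ggs_code:
  assumes "GGS2_setting n m K F x y z P l"
  shows "ggs_code n m K F x y z P l"
  using assms unfolding GGS2_setting_def by unfold_locales simp_all

text \<open>The limit is phrased with \<open>\<epsilon>\<close> and uniformly over all settings, as
  no particular sequence of codes is fixed; the absolute value is harmless because the Singleton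
  bound makes the defect nonnegative.\<close>

theorem proposition3p21:
  "(\<forall>n m (K :: 'a::field set) F x y z P l.
      GGS2_setting n m K F x y z P l \<longrightarrow>
      (let D = evaluation_places K F P;
           C = dual_one_point_code K F P l;
           N = card D;
           k = code_dim K D C;
           d = min_dist D C;
           d_ORD = order_bound K F P l;
           \<delta> = singleton_defect K D C;
           \<Delta> = relative_singleton_defect K D C
       in linear_code_params K D C (2 ^ (2 * n)) N k d \<and>
          N = (3 * m - 1) ^ 2 + (3 * m - 1) * (9 * m - 7) \<and>
          real k = real N - (9 * real m + 9) / 2 \<and>
          d \<ge> d_ORD \<and> d_ORD = 16 \<and>
          \<delta> \<le> int N - int k + 1 - int d_ORD \<and>
          real_of_int (int N - int k + 1 - int d_ORD) = (9 * real m - 21) / 2 \<and>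
          \<Delta> \<le> (9 * real m - 21) / (2 * (3 * real m - 1) * (12 * real m - 8))))
   \<and>
   (\<forall>\<epsilon>>0. \<exists>n\<^sub>0. \<forall>n\<ge>n\<^sub>0. \<forall>m (K :: 'a set) F x y z P l.
      GGS2_setting n m K F x y z P l \<longrightarrow>
      \<bar>relative_singleton_defect K (evaluation_places K F P) (dual_one_point_code K F P l)\<bar> < \<epsilon>)"
proof (intro conjI allI impI)
  fix n m K F P l and x y z :: 'a
  assume "GGS2_setting n m K F x y z P l"
  then interpret ggs_code n m K F x y z P l
    by (rule GGS2_setting_ggs_code)
  have k: "real (code_dim K D C) = real (card D) - (9 * real m + 9) / 2"
    using dim_C real_card_I by (metis add_diff_cancel_right' of_nat_add)
  have d: "singleton_defect K D C \<le> int (card D) - int (code_dim K D C) + 1 - int (order_bound K F P l)"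
    using min_dist_C(1) by (simp add: singleton_defect_def order_bound_eq)
  have "real_of_int (int (card D) - int (code_dim K D C) + 1 - int (order_bound K F P l)) = (9 * real m - 21) / 2"
    using k by (simp add: order_bound_eq)
  then show "let D = evaluation_places K F P;
           C = dual_one_point_code K F P l;
           N = card D;
           k = code_dim K D C;
           d = min_dist D C;
           d_ORD = order_bound K F P l;
           \<delta> = singleton_defect K D C;
           \<Delta> = relative_singleton_defect K D C
       in linear_code_params K D C (2 ^ (2 * n)) N k d \<and>
          N = (3 * m - 1) ^ 2 + (3 * m - 1) * (9 * m - 7) \<and>
          real k = real N - (9 * real m + 9) / 2 \<and>
          d \<ge> d_ORD \<and> d_ORD = 16 \<and>
          \<delta> \<le> int N - int k + 1 - int d_ORD \<and>
          real_of_int (int N - int k + 1 - int d_ORD) = (9 * real m - 21) / 2 \<and>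
          \<Delta> \<le> (9 * real m - 21) / (2 * (3 * real m - 1) * (12 * real m - 8))"
    unfolding Let_def linear_code_params_def
    using card_K linear_C card_D_eq k d min_dist_C(1) relative_defect_bounds(2) order_bound_eq
    by (intro conjI) simp_all
next
  fix \<epsilon> :: real
  assume "\<epsilon> > 0"
  obtain n0 where n0: "n0 > 0" "1 / real n0 < \<epsilon>"
    using reals_Archimedean[OF \<open>\<epsilon> > 0\<close>] by (metis inverse_eq_divide zero_less_Suc)
  show "\<exists>n\<^sub>0. \<forall>n\<ge>n\<^sub>0. \<forall>m (K :: 'a set) F x y z P l.
      GGS2_setting n m K F x y z P l \<longrightarrow>
      \<bar>relative_singleton_defect K (evaluation_places K F P) (dual_one_point_code K F P l)\<bar> < \<epsilon>"
  proof (intro exI[of _ n0] allI impI)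
    fix n m K F P l and x y z :: 'a
    assume "n0 \<le> n" "GGS2_setting n m K F x y z P l"
    then interpret ggs_code n m K F x y z P l
      by (intro GGS2_setting_ggs_code)
    have "relative_singleton_defect K D C \<le> 1 / real n"
      by (rule relative_defect_le)
    also have "\<dots> \<le> 1 / real n0"
      using n0(1) \<open>n0 \<le> n\<close> by (simp add: frac_le)
    finally show "\<bar>relative_singleton_defect K D C\<bar> < \<epsilon>"
      using relative_defect_bounds(1) n0(2) by simp
  qed
qed

end
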